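(* There is an algorithm that, given a digraph $D$ of order $n$ with $\ell_{\min}(D)>0$ and a positive integer $k$, either finds an out-branching of $D$ with at most $n-k$ leaves or correctly answers that none exists, in time $O(2^{O(k\log k)}+n^6)$.
   Context: Digraphs are finite, without loops or parallel arcs. An out-branching of $D$ is a spanning subgraph that is an oriented tree with exactly one vertex of in-degree zero; leaves are its vertices of out-degree zero. $\ell_{\min}(D)$ is the minimum number of leaves of an out-branching of $D$ ($0$ if none exists). *)

theory Defs
  imports "Graph_Theory.Digraph_Component" "HOL-Library.Landau_Symbols"
begin

section \<open>Out-branchings\<close>

text \<open>
  \<open>oriented_tree\<close> is an orientation of an undirected tree. The predicate \<^const>\<open>tree\<close> of
  the digraph library is not suitable here: for an asymmetric digraph it only excludes directed
  cycles, so that, e.g., a transitive triangle satisfies it. In the symmetric digraph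
  \<^term>\<open>mk_symmetric T\<close> every edge gives a directed cycle of length two, and the cycles of the
  underlying undirected graph are those of length at least three.
\<close>

definition oriented_tree :: "('a, 'b) pre_digraph \<Rightarrow> bool" where
  "oriented_tree T \<longleftrightarrow>
     digraph T \<and> asym (arcs_ends T) \<and> Digraph_Component.connected T \<and>
     \<not> (\<exists>p. pre_digraph.cycle (with_proj (mk_symmetric T)) p \<and> 3 \<le> length p)"

definition out_branching :: "('a, 'b) pre_digraph \<Rightarrow> ('a, 'b) pre_digraph \<Rightarrow> bool" where
  "out_branching T D \<longleftrightarrow>
     spanning T D \<and> oriented_tree T \<and> (\<exists>!r. r \<in> verts T \<and> in_degree T r = 0)"

definition leaves :: "('a, 'b) pre_digraph \<Rightarrow> 'a set" where
  "leaves T = {v \<in> verts T. out_degree T v = 0}"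

definition l_min :: "('a, 'b) pre_digraph \<Rightarrow> nat" where
  "l_min D =
     (if \<exists>T. out_branching T D
      then LEAST l. \<exists>T. out_branching T D \<and> l = card (leaves T)
      else 0)"


section \<open>Random access machine programs with uniform cost\<close>

text \<open>
  Running time is measured on a random access machine under the uniform cost criterion,
  with addition and truncated subtraction as the only arithmetic operations (multiplication at
  unit cost would make the machine unrealistically strong). A program is finite, so it names only
  finitely many registers; the memory is accessed by computed addresses. Control flow is
  structured, which is equivalent to jumps up to a constant factor.
\<close>

datatype exp = Const nat | Reg nat | Mem exp | Plus exp exp | Minus exp exp

datatype com =
    Skip
  | Assign nat exp
  | Store exp exp \<comment> \<open>address, value\<close>
  | Seq com com
  | Cond exp com com
  | While exp com

record state =
  reg :: "nat \<Rightarrow> nat"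
  mem :: "nat \<Rightarrow> nat"

fun val :: "exp \<Rightarrow> state \<Rightarrow> nat" where
  "val (Const c) s = c"
| "val (Reg r) s = reg s r"
| "val (Mem e) s = mem s (val e s)"
| "val (Plus e f) s = val e s + val f s"
| "val (Minus e f) s = val e s - val f s"

fun ops :: "exp \<Rightarrow> nat" where
  "ops (Const c) = 1"
| "ops (Reg r) = 1"
| "ops (Mem e) = ops e + 1"
| "ops (Plus e f) = ops e + ops f + 1"
| "ops (Minus e f) = ops e + ops f + 1"

text \<open>
  \<open>exec c s t s'\<close>: started in \<open>s\<close>, the program \<open>c\<close> halts in \<open>s'\<close> after exactly \<open>t\<close> steps.
  As execution is deterministic, \<open>\<exists>t s'. exec c s t s'\<close> means that the program halts.
  A test succeeds if the value is nonzero.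
\<close>

inductive exec :: "com \<Rightarrow> state \<Rightarrow> nat \<Rightarrow> state \<Rightarrow> bool" where
  Skip: "exec Skip s 1 s"
| Assign: "exec (Assign r e) s (ops e + 1) (s\<lparr>reg := (reg s)(r := val e s)\<rparr>)"
| Store: "exec (Store a e) s (ops a + ops e + 1) (s\<lparr>mem := (mem s)(val a s := val e s)\<rparr>)"
| Seq: "exec c s t s' \<Longrightarrow> exec d s' t' s'' \<Longrightarrow> exec (Seq c d) s (t + t') s''"
| CondTrue: "val e s \<noteq> 0 \<Longrightarrow> exec c s t s' \<Longrightarrow> exec (Cond e c d) s (ops e + 1 + t) s'"
| CondFalse: "val e s = 0 \<Longrightarrow> exec d s t s' \<Longrightarrow> exec (Cond e c d) s (ops e + 1 + t) s'"
| WhileFalse: "val e s = 0 \<Longrightarrow> exec (While e c) s (ops e + 1) s"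
| WhileTrue: "val e s \<noteq> 0 \<Longrightarrow> exec c s t s' \<Longrightarrow> exec (While e c) s' t' s'' \<Longrightarrow>
    exec (While e c) s (ops e + 1 + t + t') s''"

inductive_cases exec_elims:
  "exec Skip s t s'" "exec (Assign r e) s t s'" "exec (Store a e) s t s'"
  "exec (Seq c d) s t s'" "exec (Cond e c d) s t s'" "exec (While e c) s t s'"

lemma exec_deterministic:
  "exec c s t s' \<Longrightarrow> exec c s u s'' \<Longrightarrow> t = u \<and> s' = s''"
proof (induction arbitrary: u s'' rule: exec.induct)
  case (Seq c s t s' d t' s2)
  from Seq.prems obtain t1 s1 t2 where
    "exec c s t1 s1" "exec d s1 t2 s''" "u = t1 + t2" by (rule exec_elims(4))
  with Seq.IH show ?case by metis
next
  case (CondTrue e s c t s' d)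
  from CondTrue.prems CondTrue.hyps obtain t1 where
    "exec c s t1 s''" "u = ops e + 1 + t1" by (auto elim: exec_elims(5))
  with CondTrue.IH show ?case by metis
next
  case (CondFalse e s d t s' c)
  from CondFalse.prems CondFalse.hyps obtain t1 where
    "exec d s t1 s''" "u = ops e + 1 + t1" by (auto elim: exec_elims(5))
  with CondFalse.IH show ?case by metis
next
  case (WhileFalse e s c)
  from WhileFalse.prems show ?case by (rule exec_elims(6)) (use WhileFalse.hyps in simp_all)
next
  case (WhileTrue e s c t s' t' s2)
  from WhileTrue.prems obtain t1 s1 t2 where
    "exec c s t1 s1" "exec (While e c) s1 t2 s''" "u = ops e + 1 + t1 + t2"
    by (rule exec_elims(6)) (use WhileTrue.hyps in simp_all)
  with WhileTrue.IH show ?case by metis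
qed (auto elim: exec_elims(1-3))


section \<open>Input and output\<close>

text \<open>
  Digraphs of order \<open>n\<close> have the vertices \<open>0, \<dots>, n - 1\<close> and are stored as adjacency matrices,
  row by row from address \<open>0\<close>. On input, register \<open>0\<close> holds \<open>n\<close> and register \<open>1\<close> holds \<open>k\<close>;
  all other registers and memory cells are \<open>0\<close>. On output, register \<open>0\<close> holds the answer, and if it
  is nonzero then the matrix of the out-branching has replaced that of the input.
\<close>

definition input :: "nat \<Rightarrow> nat \<Rightarrow> nat pair_pre_digraph \<Rightarrow> state" where
  "input n k D =
     \<lparr>reg = (\<lambda>_. 0)(0 := n, 1 := k),
      mem = (\<lambda>a. if \<exists>(u, v) \<in> parcs D. a = n * u + v then 1 else 0)\<rparr>"

definition answer :: "state \<Rightarrow> bool" where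
  "answer s \<longleftrightarrow> reg s 0 \<noteq> 0"

definition output_digraph :: "nat \<Rightarrow> state \<Rightarrow> nat pair_pre_digraph" where
  "output_digraph n s =
     \<lparr>pverts = {..<n}, parcs = {(u, v). u < n \<and> v < n \<and> mem s (n * u + v) \<noteq> 0}\<rparr>"

end

theory Submission
  imports Defs
begin

text \<open>
  Every candidate root \<open>r\<close> is tried separately. Some out-branching rooted at \<open>r\<close> has at least \<open>k\<close>
  internal vertices iff there are \<open>k\<close> arcs with distinct heads and distinct tails such that \<open>r\<close>
  still reaches every vertex once all other arcs into those heads are deleted: any spanning tree
  found by a graph search then has the \<open>k\<close> tails as internal vertices. So it suffices to try sets
  of \<open>k\<close> arcs from a kernel of \<open>O(k\<^sup>3)\<close> vertices.

  To find the kernel, take any out-branching from \<open>r\<close>. If it has fewer than \<open>k\<close> internal vertices,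
  choose a maximal matching among its leaves. All matching arcs can be made tree arcs at once, so
  either there is a solution or the matching has fewer than \<open>k\<close> arcs. In the latter case the internal
  vertices, \<open>r\<close> and the matched leaves form a vertex cover \<open>S\<close> of size less than \<open>3 * k\<close>. Keep \<open>S\<close>
  and, for all \<open>y\<close> and \<open>w\<close> in \<open>S\<close>, the first \<open>8 * k\<close> vertices \<open>x\<close> with arcs from \<open>y\<close> to \<open>x\<close> and from
  \<open>x\<close> to \<open>w\<close> (only the former if \<open>w = y\<close>). A vertex of a solution that was not kept can be
  exchanged for a kept leaf.

  The time is \<open>n\<^sup>4\<close> times some \<open>f(k)\<close> of the form \<open>2\<close> to the power \<open>O(k log k)\<close>, and
  \<open>n\<^sup>4 * f(k) \<le> f(k)\<^sup>3 + n\<^sup>6\<close>.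
\<close>

section \<open>Reasoning about programs\<close>

text \<open>Where the constants come from: if the early stops fail, fewer than \<open>k\<close>
  internal vertices, the root and fewer than \<open>k\<close> matching arcs give a cover
  \<open>S\<close> of size at most \<open>3 * k - 2\<close>. A replacement must avoid the at most
  \<open>2 * k\<close> ends of chosen arcs, \<open>S\<close> itself and the parents of the vertices
  of \<open>S\<close>, altogether at most \<open>2 * k + 2 * card S <= 8 * k - 4\<close> vertices;
  hence the \<open>8 * k\<close> candidates kept for each pair. Pairs from \<open>S\<close> suffice
  because a vertex outside \<open>S\<close> has all its neighbours in \<open>S\<close>; for the same
  reason it is a leaf as soon as it is no parent of a vertex of \<open>S\<close>.

  The obstacle in the exchange is that the tree changes along with the chosen arcs. Acyclicity is
  therefore carried by a rank that increases from parent to child, so that a local change of parents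
  can be checked arc by arc.

  The factor \<open>n^4\<close> stands for \<open>n\<close> roots with \<open>n\<close> sweeps over
  all \<open>n^2\<close> pairs each. The machine cannot multiply, so multiples of \<open>n\<close>
  are tabulated and powers are computed by repeated addition.\<close>

definition run :: "com \<Rightarrow> state \<Rightarrow> nat \<Rightarrow> (state \<Rightarrow> bool) \<Rightarrow> bool" where
  "run c s T Q \<longleftrightarrow> (\<exists>t s'. exec c s t s' \<and> t \<le> T \<and> Q s')"

text \<open>The postcondition of the first command is that the second one runs well. A program is
  thus verified forwards from a fixed state \<open>s\<close>, whose known properties are plain
  hypotheses.\<close>

lemma run_Seq:
  assumes "run c s V (\<lambda>s'. run d s' U Q)" "V + U \<le> T"
  shows "run (Seq c d) s T Q"
proof -
  from assms(1) obtain t s' where "exec c s t s'" "t \<le> V" "run d s' U Q"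
    unfolding run_def by blast
  moreover from this(3) obtain t' s'' where "exec d s' t' s''" "t' \<le> U" "Q s''"
    unfolding run_def by blast
  ultimately show ?thesis
    using exec.Seq[of c s t s' d t' s''] assms(2) unfolding run_def
    by (intro exI[of _ "t + t'"] exI[of _ s'']) simp
qed

lemma run_Cond:
  assumes "val e s \<noteq> 0 \<Longrightarrow> run c s T' Q" "val e s = 0 \<Longrightarrow> run d s T' Q" "ops e + 1 + T' \<le> T"
  shows "run (Cond e c d) s T Q"
proof (cases "val e s = 0")
  case True
  with assms(2) obtain t s' where "exec d s t s'" "t \<le> T'" "Q s'" unfolding run_def by blast
  with exec.CondFalse[OF True] assms(3) show ?thesis
    unfolding run_def by (intro exI[of _ "ops e + 1 + t"] exI[of _ s']) auto
next
  case False
  with assms(1) obtain t s' where "exec c s t s'" "t \<le> T'" "Q s'" unfolding run_def by blast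
  with exec.CondTrue[OF False] assms(3) show ?thesis
    unfolding run_def by (intro exI[of _ "ops e + 1 + t"] exI[of _ s']) auto
qed

lemma run_mono: "run c s T Q \<Longrightarrow> T \<le> T' \<Longrightarrow> (\<And>s'. Q s' \<Longrightarrow> Q' s') \<Longrightarrow> run c s T' Q'"
  unfolding run_def using le_trans by blast

text \<open>
  Above the \<open>reg s 2\<close> cells of the matrix, the memory is shared by nine unbounded arrays,
  which are interleaved so that no bounds on their lengths are needed.
\<close>

primrec times :: "nat \<Rightarrow> exp \<Rightarrow> exp" where
  "times 0 e = Const 0"
| "times (Suc m) e = Plus e (times m e)"

definition addr :: "nat \<Rightarrow> exp \<Rightarrow> exp" where
  "addr j e = Plus (Plus (Reg 2) (Const j)) (times 9 e)"

definition Arr :: "nat \<Rightarrow> exp \<Rightarrow> exp" where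
  "Arr j e = Mem (addr j e)"

definition ArrStore :: "nat \<Rightarrow> exp \<Rightarrow> exp \<Rightarrow> com" where
  "ArrStore j e f = Store (addr j e) f"

definition arr :: "state \<Rightarrow> nat \<Rightarrow> nat \<Rightarrow> nat" where
  "arr s j i = mem s (reg s 2 + j + 9 * i)"

definition setr :: "nat \<Rightarrow> nat \<Rightarrow> state \<Rightarrow> state" where
  "setr x v s = s\<lparr>reg := (reg s)(x := v)\<rparr>"

definition seta :: "nat \<Rightarrow> nat \<Rightarrow> nat \<Rightarrow> state \<Rightarrow> state" where
  "seta j i v s = s\<lparr>mem := (mem s)(reg s 2 + j + 9 * i := v)\<rparr>"

lemma val_times [simp]: "val (times m e) s = m * val e s"
  by (induction m) auto

lemma ops_times [simp]: "ops (times m e) = m * (ops e + 1) + 1"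
  by (induction m) auto

lemma val_addr [simp]: "val (addr j e) s = reg s 2 + j + 9 * val e s"
  by (simp add: addr_def)

lemma ops_addr [simp]: "ops (addr j e) = 9 * ops e + 14"
  by (simp add: addr_def)

lemma val_Arr [simp]: "val (Arr j e) s = arr s j (val e s)"
  by (simp add: Arr_def arr_def)

lemma ops_Arr [simp]: "ops (Arr j e) = 9 * ops e + 15"
  by (simp add: Arr_def)

lemma reg_setr [simp]: "reg (setr x v s) y = (if y = x then v else reg s y)"
  by (simp add: setr_def)

lemma mem_setr [simp]: "mem (setr x v s) = mem s"
  by (simp add: setr_def)

lemma arr_setr [simp]: "x \<noteq> 2 \<Longrightarrow> arr (setr x v s) = arr s"
  by (auto simp: arr_def fun_eq_iff)

lemma reg_seta [simp]: "reg (seta j i v s) = reg s"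
  by (simp add: seta_def)

lemma mem_seta [simp]: "a < reg s 2 \<Longrightarrow> mem (seta j i v s) a = mem s a"
  by (simp add: seta_def)

text \<open>The offset of a cell from \<open>reg s 2\<close>, taken modulo 9, is the number of its
  array, so different arrays never share a cell.\<close>

lemma arr_seta [simp]:
  assumes "j < 9" "j' < 9"
  shows "arr (seta j i v s) j' = (if j' = j then (arr s j)(i := v) else arr s j')"
proof -
  have "j' = j \<and> i' = i" if "j' + 9 * i' = j + 9 * i" for i'
  proof -
    have "(j' + 9 * i') mod 9 = j'" "(j + 9 * i) mod 9 = j" using assms by simp_all
    with that show ?thesis by simp
  qed
  thus ?thesis by (auto simp: arr_def seta_def add.assoc fun_eq_iff)
qed

text \<open>Truncated subtraction is the machine's only means of comparison: both differences vanish
  exactly when the values agree.\<close>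

definition EEq :: "exp \<Rightarrow> exp \<Rightarrow> exp" where
  "EEq e f = Minus (Const 1) (Plus (Minus e f) (Minus f e))"

definition ENot :: "exp \<Rightarrow> exp" where
  "ENot e = Minus (Const 1) e"

definition EAnd :: "exp \<Rightarrow> exp \<Rightarrow> exp" where
  "EAnd e f = ENot (Plus (ENot e) (ENot f))"

lemma val_EEq [simp]: "val (EEq e f) s = of_bool (val e s = val f s)"
  by (auto simp: EEq_def)

lemma val_ENot [simp]: "val (ENot e) s = of_bool (val e s = 0)"
  by (auto simp: ENot_def)

lemma val_EAnd [simp]: "val (EAnd e f) s = of_bool (val e s \<noteq> 0 \<and> val f s \<noteq> 0)"
  by (auto simp: EAnd_def)

lemma ops_logic [simp]:
  "ops (EEq e f) = 2 * ops e + 2 * ops f + 5"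
  "ops (ENot e) = ops e + 2"
  "ops (EAnd e f) = ops e + ops f + 7"
  by (auto simp: EEq_def ENot_def EAnd_def)

section \<open>Loop-free commands: effect and worst-case cost by recursion on the syntax\<close>

primrec straight :: "com \<Rightarrow> bool" where
  "straight Skip = True"
| "straight (Assign x e) = True"
| "straight (Store a e) = True"
| "straight (Seq c d) = (straight c \<and> straight d)"
| "straight (Cond e c d) = (straight c \<and> straight d)"
| "straight (While e c) = False"

primrec sem :: "com \<Rightarrow> state \<Rightarrow> state" where
  "sem Skip s = s"
| "sem (Assign x e) s = setr x (val e s) s"
| "sem (Store a e) s = s\<lparr>mem := (mem s)(val a s := val e s)\<rparr>"
| "sem (Seq c d) s = sem d (sem c s)"
| "sem (Cond e c d) s = (if val e s \<noteq> 0 then sem c s else sem d s)"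
| "sem (While e c) s = s"

primrec cost :: "com \<Rightarrow> nat" where
  "cost Skip = 1"
| "cost (Assign x e) = ops e + 1"
| "cost (Store a e) = ops a + ops e + 1"
| "cost (Seq c d) = cost c + cost d"
| "cost (Cond e c d) = ops e + 1 + max (cost c) (cost d)"
| "cost (While e c) = 0"

lemma straight_ArrStore [simp]: "straight (ArrStore j e f)"
  by (simp add: ArrStore_def)

lemma sem_ArrStore [simp]: "sem (ArrStore j e f) s = seta j (val e s) (val f s) s"
  by (simp add: ArrStore_def seta_def)

lemma cost_ArrStore [simp]: "cost (ArrStore j e f) = 9 * ops e + ops f + 15"
  by (simp add: ArrStore_def)

text \<open>With this, loop-free code is settled by simplification, and only loops need invariants.
  The \<open>While\<close> clauses of \<open>sem\<close> and \<open>cost\<close> are dummies,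
  excluded by \<open>straight\<close>.\<close>

lemma exec_straight: "straight c \<Longrightarrow> \<exists>t \<le> cost c. exec c s t (sem c s)"
proof (induction c arbitrary: s)
  case Skip thus ?case using exec.Skip by (intro exI[of _ 1]) simp
next
  case (Assign x e) thus ?case using exec.Assign[of x e s] by (auto simp: setr_def)
next
  case (Store a e) thus ?case using exec.Store[of a e s] by auto
next
  case (Seq c d)
  then obtain t t' where "t \<le> cost c" "exec c s t (sem c s)"
    "t' \<le> cost d" "exec d (sem c s) t' (sem d (sem c s))" by (metis straight.simps(4))
  thus ?case by (intro exI[of _ "t + t'"]) (auto intro: exec.Seq)
next
  case (Cond e c d)
  then obtain t t' where t: "t \<le> cost c" "exec c s t (sem c s)" "t' \<le> cost d" "exec d s t' (sem d s)"
    by (metis straight.simps(5))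
  show ?case
  proof (cases "val e s = 0")
    case True
    with t exec.CondFalse[OF True t(4), of c] show ?thesis
      by (intro exI[of _ "ops e + 1 + t'"]) (simp del: One_nat_def add: max.coboundedI2)
  next
    case False
    with t exec.CondTrue[OF False t(2), of d] show ?thesis
      by (intro exI[of _ "ops e + 1 + t"]) (simp del: One_nat_def add: max.coboundedI1)
  qed
qed auto

lemma run_straight: "straight c \<Longrightarrow> Q (sem c s) \<Longrightarrow> cost c \<le> T \<Longrightarrow> run c s T Q"
  unfolding run_def using exec_straight[of c s] le_trans by blast

section \<open>Frames: what a command cannot change, read off its syntax\<close>

primrec wregs :: "com \<Rightarrow> nat set" where
  "wregs Skip = {}"
| "wregs (Assign x e) = {x}"
| "wregs (Store a e) = {}"
| "wregs (Seq c d) = wregs c \<union> wregs d"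
| "wregs (Cond e c d) = wregs c \<union> wregs d"
| "wregs (While e c) = wregs c"

primrec warrs :: "com \<Rightarrow> nat set" where
  "warrs Skip = {}"
| "warrs (Assign x e) = {}"
| "warrs (Store a e) = {j. \<exists>i. a = addr j i}"
| "warrs (Seq c d) = warrs c \<union> warrs d"
| "warrs (Cond e c d) = warrs c \<union> warrs d"
| "warrs (While e c) = warrs c"

text \<open>Register 2 is the base address of all arrays, and the matrix lies below it. Keeping this
  register and storing only at array addresses protects the matrix.\<close>

primrec array_only :: "com \<Rightarrow> bool" where
  "array_only Skip = True"
| "array_only (Assign x e) = (x \<noteq> 2)"
| "array_only (Store a e) = (\<exists>j i. j < 9 \<and> a = addr j i)"
| "array_only (Seq c d) = (array_only c \<and> array_only d)"
| "array_only (Cond e c d) = (array_only c \<and> array_only d)"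
| "array_only (While e c) = array_only c"

lemma wregs_ArrStore [simp]: "wregs (ArrStore j e f) = {}"
  by (simp add: ArrStore_def)

lemma warrs_ArrStore [simp]: "warrs (ArrStore j e f) = {j}"
  by (auto simp add: ArrStore_def addr_def)

lemma array_only_ArrStore [simp]: "array_only (ArrStore j e f) \<longleftrightarrow> j < 9"
  by (auto simp add: ArrStore_def addr_def)

definition frame :: "nat set \<Rightarrow> nat set \<Rightarrow> state \<Rightarrow> state \<Rightarrow> bool" where
  "frame R A s s' \<longleftrightarrow> (\<forall>x. x \<notin> R \<longrightarrow> reg s' x = reg s x) \<and>
     (\<forall>j<9. j \<notin> A \<longrightarrow> arr s' j = arr s j) \<and> reg s' 2 = reg s 2 \<and>
     (\<forall>a < reg s 2. mem s' a = mem s a)"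

lemma frame_refl: "frame R A s s"
  by (simp add: frame_def)

lemma frame_trans: "frame R A s s' \<Longrightarrow> frame R A s' s'' \<Longrightarrow> frame R A s s''"
  by (auto simp: frame_def)

lemma frame_arr: "frame R A s s' \<Longrightarrow> j < 9 \<Longrightarrow> j \<notin> A \<Longrightarrow> arr s' j = arr s j"
  by (simp add: frame_def)

lemma frame_setr: "x \<in> R \<Longrightarrow> x \<noteq> 2 \<Longrightarrow> frame R A s (setr x v s)"
  by (auto simp: frame_def)

lemma exec_frame:
  "exec c s t s' \<Longrightarrow> array_only c \<Longrightarrow> wregs c \<subseteq> R \<Longrightarrow> warrs c \<subseteq> A \<Longrightarrow> frame R A s s'"
proof (induction rule: exec.induct)
  case (Assign x e s)
  thus ?case using frame_setr[of x R A s] by (simp add: setr_def)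
next
  case (Store a e s)
  then obtain j i where ji: "j < 9" "a = addr j i" "j \<in> A" by auto
  have "sem (ArrStore j i e) s = seta j (val i s) (val e s) s" by (rule sem_ArrStore)
  hence *: "s\<lparr>mem := (mem s)(val a s := val e s)\<rparr> = seta j (val i s) (val e s) s"
    by (simp add: ArrStore_def ji)
  show ?case unfolding * using ji by (auto simp: frame_def fun_eq_iff)
next
  case (Seq c s t s' d t' s'')
  thus ?case using frame_trans[of R A s s' s''] by simp
next
  case (WhileTrue e s c t s' t' s'')
  thus ?case using frame_trans[of R A s s' s''] by simp
qed (simp_all add: frame_refl)

lemma run_frame:
  assumes "run c s T (\<lambda>s'. frame R A s s' \<longrightarrow> Q s')"
    "array_only c" "wregs c \<subseteq> R" "warrs c \<subseteq> A"
  shows "run c s T Q"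
proof -
  from assms(1) obtain t s' where t: "exec c s t s'" "t \<le> T" "frame R A s s' \<longrightarrow> Q s'"
    unfolding run_def by blast
  with exec_frame[OF t(1) assms(2-4)] show ?thesis unfolding run_def by blast
qed

section \<open>Counting loops\<close>

definition For :: "nat \<Rightarrow> nat \<Rightarrow> com \<Rightarrow> com" where
  "For i N c = Seq (Assign i (Const 0))
     (While (Minus (Reg N) (Reg i)) (Seq c (Assign i (Plus (Reg i) (Const 1)))))"

lemma syntax_For [simp]:
  "wregs (For i N c) = insert i (wregs c)"
  "warrs (For i N c) = warrs c"
  "array_only (For i N c) \<longleftrightarrow> i \<noteq> 2 \<and> array_only c"
  by (auto simp: For_def)

lemma exec_regs: "exec c s t s' \<Longrightarrow> x \<notin> wregs c \<Longrightarrow> reg s' x = reg s x"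
  by (induction rule: exec.induct) auto

text \<open>A round costs 4 for the test, at most \<open>T\<close> for the body and 4 for the
  increment. The spare round in \<open>Suc n\<close> pays for the initialization and the last test.
  The counter changes after the body has established the invariant, hence
  \<open>ind\<close>.\<close>

lemma run_For_basic:
  assumes init: "Inv 0 s"
    and step: "\<And>j s'. j < n \<Longrightarrow> reg s' i = j \<Longrightarrow> Inv j s' \<Longrightarrow> run c s' T (Inv (Suc j))"
    and ind: "\<And>j v s'. Inv j s' \<Longrightarrow> Inv j (setr i v s')"
    and syn: "i \<notin> wregs c" "N \<notin> wregs c" "i \<noteq> N"
    and n: "reg s N = n" and T': "Suc n * (T + 8) \<le> T'"
  shows "run (For i N c) s T' (Inv n)"
proof -
  let ?W = "While (Minus (Reg N) (Reg i)) (Seq c (Assign i (Plus (Reg i) (Const 1))))"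
  have loop: "\<exists>t s'. exec ?W s1 t s' \<and> t \<le> q * (T + 8) + 4 \<and> Inv n s'"
    if "j + q = n" "reg s1 N = n" "reg s1 i = j" "Inv j s1" for j q s1
    using that
  proof (induction q arbitrary: j s1)
    case 0
    have "exec ?W s1 (ops (Minus (Reg N) (Reg i)) + 1) s1" by (rule exec.WhileFalse) (use 0 in simp)
    thus ?case using 0 by (intro exI[of _ "ops (Minus (Reg N) (Reg i)) + 1"] exI[of _ s1]) auto
  next
    case (Suc q)
    have j: "j < n" using Suc by simp
    from step[OF j Suc.prems(3,4)] obtain t s2
      where t: "exec c s1 t s2" "t \<le> T" "Inv (Suc j) s2" unfolding run_def by blast
    have r2: "reg s2 i = j" "reg s2 N = n" using exec_regs[OF t(1)] syn Suc.prems by metis+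
    define s3 where "s3 = setr i (Suc j) s2"
    have e3: "exec (Assign i (Plus (Reg i) (Const 1))) s2 4 s3"
      using exec.Assign[of i "Plus (Reg i) (Const 1)" s2] r2
      by (simp add: s3_def setr_def numeral_eq_Suc)
    have I3: "Inv (Suc j) s3" unfolding s3_def by (rule ind) (rule t)
    from Suc.IH[of "Suc j" s3] Suc.prems r2 syn I3 obtain t' s' where
      t': "exec ?W s3 t' s'" "t' \<le> q * (T + 8) + 4" "Inv n s'"
      by (auto simp: s3_def)
    have "exec ?W s1 (ops (Minus (Reg N) (Reg i)) + 1 + (t + 4) + t') s'"
      by (rule exec.WhileTrue[OF _ exec.Seq[OF t(1) e3] t'(1)]) (use j Suc.prems in simp)
    thus ?case using t t'
      by (intro exI[of _ "ops (Minus (Reg N) (Reg i)) + 1 + (t + 4) + t'"] exI[of _ s']) auto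
  qed
  from loop[OF add_0 _ _ ind[OF init]] n syn obtain t s' where
    t: "exec ?W (setr i 0 s) t s'" "t \<le> n * (T + 8) + 4" "Inv n s'" by force
  have "exec (For i N c) s (2 + t) s'"
    unfolding For_def using exec.Seq[OF _ t(1), of "Assign i (Const 0)" s 2]
      exec.Assign[of i "Const 0" s] by (simp add: setr_def numeral_2_eq_2)
  moreover have "2 + t \<le> T'" using t(2) T' by simp
  ultimately show ?thesis using t(3) unfolding run_def by blast
qed

text \<open>The frame relation to the initial state \<open>s\<close> is added to the invariant once
  and for all, so that the invariants below speak only of what the body changes.\<close>

lemma run_For:
  assumes init: "Inv 0 s"
    and step: "\<And>j s'. j < reg s N \<Longrightarrow> frame (insert i (wregs c)) (warrs c) s s' \<Longrightarrow> reg s' i = j \<Longrightarrow>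
      Inv j s' \<Longrightarrow> run c s' T (Inv (Suc j))"
    and post: "\<And>s'. frame (insert i (wregs c)) (warrs c) s s' \<Longrightarrow> Inv (reg s N) s' \<Longrightarrow> Q s'"
    and ind: "\<And>j v s'. Inv j s' \<Longrightarrow> Inv j (setr i v s')"
    and syn: "array_only c" "i \<notin> wregs c" "N \<notin> wregs c" "i \<noteq> N" "i \<noteq> 2"
    and T': "Suc (reg s N) * (T + 8) \<le> T'"
  shows "run (For i N c) s T' Q"
proof -
  let ?F = "frame (insert i (wregs c)) (warrs c)"
  have "run (For i N c) s T' (\<lambda>s'. Inv (reg s N) s' \<and> ?F s s')"
  proof (rule run_For_basic[where Inv = "\<lambda>j s'. Inv j s' \<and> ?F s s'", OF _ _ _ syn(2-4) refl T'])
    fix j s' assume j: "j < reg s N" "reg s' i = j" "Inv j s' \<and> ?F s s'"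
    show "run c s' T (\<lambda>s'. Inv (Suc j) s' \<and> ?F s s')"
    proof (rule run_frame[where R = "insert i (wregs c)" and A = "warrs c"])
      show "run c s' T (\<lambda>s''. ?F s' s'' \<longrightarrow> Inv (Suc j) s'' \<and> ?F s s'')"
        using j frame_trans by (intro run_mono[OF step order_refl]) blast+
    qed (use syn in auto)
  next
    fix j v s' assume "Inv j s' \<and> ?F s s'"
    thus "Inv j (setr i v s') \<and> ?F s (setr i v s')"
      using ind frame_trans[OF _ frame_setr[of i]] syn by auto
  qed (use init frame_refl in auto)
  thus ?thesis by (rule run_mono[OF _ order_refl]) (use post in blast)
qed

lemma run_Seq_frame:
  assumes "run c s V P" "array_only c"
    and "\<And>s'. P s' \<Longrightarrow> frame (wregs c) (warrs c) s s' \<Longrightarrow> run d s' U Q"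
    and "V + U \<le> T"
  shows "run (Seq c d) s T Q"
proof (rule run_Seq[OF run_frame[OF run_mono[OF assms(1) order_refl] assms(2) order_refl order_refl] assms(4)])
  fix s' assume "P s'"
  thus "frame (wregs c) (warrs c) s s' \<longrightarrow> run d s' U Q" using assms(3) by blast
qed

lemma scale_add:
  fixes x y :: nat
  assumes "x \<le> y" "a + b \<le> c"
  shows "a * y + b * x \<le> c * y"
proof -
  have "a * y + b * x \<le> (a + b) * y" using assms(1) by (simp add: distrib_right)
  also have "\<dots> \<le> c * y" using assms(2) by (rule mult_le_mono1)
  finally show ?thesis .
qed

text \<open>One more loop level: the exponent of \<open>Suc n\<close> grows by one and the
  coefficient by 8, the cost of loop control.\<close>

lemma For_bound:
  assumes "T \<le> a * Suc n ^ i" "a + 8 \<le> b" "j = Suc i"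
  shows "Suc n * (T + 8) \<le> b * Suc n ^ j"
proof -
  have "(1::nat) \<le> Suc n ^ i" by simp
  with assms(1) have "T + 8 \<le> (a + 8) * Suc n ^ i" unfolding distrib_right by linarith
  also have "\<dots> \<le> b * Suc n ^ i" using assms(2) by (rule mult_le_mono1)
  finally have "Suc n * (T + 8) \<le> Suc n * (b * Suc n ^ i)" by (rule mult_le_mono2)
  thus ?thesis unfolding assms(3) power_Suc by (simp only: mult.left_commute)
qed

lemma run_fill:
  assumes "i \<noteq> N" "i \<noteq> 2" "j < 9"
  shows "run (For i N (ArrStore j (Reg i) (Const c))) s (33 * Suc (reg s N))
    (\<lambda>s'. \<forall>v < reg s N. arr s' j v = c)"
proof (rule run_For[where Inv = "\<lambda>m s'. \<forall>v<m. arr s' j v = c" and T = 25])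
  fix m s'
  assume "m < reg s N" "reg s' i = m" "\<forall>v<m. arr s' j v = c"
  thus "run (ArrStore j (Reg i) (Const c)) s' 25 (\<lambda>s'. \<forall>v<Suc m. arr s' j v = c)"
    using assms by (intro run_straight) (auto simp: less_Suc_eq)
qed (use assms in auto)

section \<open>Branchings as parent functions\<close>

text \<open>The rank \<open>d\<close> forces every chain of parents to end in \<open>r\<close>. It
  is any increasing labelling rather than the depth, so a vertex can be moved without relabelling
  its descendants.\<close>

definition btree :: "nat \<Rightarrow> (nat \<times> nat) set \<Rightarrow> nat \<Rightarrow> (nat \<Rightarrow> nat) \<Rightarrow> (nat \<Rightarrow> nat) \<Rightarrow> bool" where
  "btree n E r p d \<longleftrightarrow> r < n \<and> (\<forall>v<n. v \<noteq> r \<longrightarrow> p v < n \<and> (p v, v) \<in> E \<and> d (p v) < d v)"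

definition internals :: "nat \<Rightarrow> nat \<Rightarrow> (nat \<Rightarrow> nat) \<Rightarrow> nat set" where
  "internals n r p = p ` ({..<n} - {r})"

text \<open>
  A function \<open>h\<close> prescribes the parent \<open>u\<close> of \<open>v\<close> by \<open>h v = Suc u\<close>;
  \<open>h v = 0\<close> leaves the choice free.
\<close>

definition allowed :: "(nat \<times> nat) set \<Rightarrow> (nat \<Rightarrow> nat) \<Rightarrow> (nat \<times> nat) set" where
  "allowed E h = {(u, v) \<in> E. h v = 0 \<or> h v = Suc u}"

definition tails :: "nat \<Rightarrow> nat \<Rightarrow> (nat \<Rightarrow> nat) \<Rightarrow> nat set" where
  "tails n r h = {u. \<exists>v<n. v \<noteq> r \<and> h v = Suc u}"

lemma btreeI:
  "r < n \<Longrightarrow> (\<And>v. v < n \<Longrightarrow> v \<noteq> r \<Longrightarrow> p v < n \<and> (p v, v) \<in> E \<and> d (p v) < d v) \<Longrightarrow> btree n E r p d"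
  by (simp add: btree_def)

lemma btreeD:
  assumes "btree n E r p d"
  shows "r < n" "\<And>v. v < n \<Longrightarrow> v \<noteq> r \<Longrightarrow> p v < n"
    "\<And>v. v < n \<Longrightarrow> v \<noteq> r \<Longrightarrow> (p v, v) \<in> E" "\<And>v. v < n \<Longrightarrow> v \<noteq> r \<Longrightarrow> d (p v) < d v"
  using assms by (auto simp: btree_def)

lemma finite_internals [simp]: "finite (internals n r p)"
  by (simp add: internals_def)

lemma finite_tails [simp]: "finite (tails n r h)"
proof -
  have "tails n r h \<subseteq> (\<lambda>v. h v - 1) ` {..<n}" by (force simp: tails_def)
  thus ?thesis using finite_surj by blast
qed

lemma internals_subset: "btree n E r p d \<Longrightarrow> internals n r p \<subseteq> {..<n}"
  by (auto simp: internals_def dest: btreeD(2))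

text \<open>A prescribed head other than the root must get its parent from the only arc into it that
  is left.\<close>

lemma tails_subset_internals:
  assumes "btree n (allowed E h) r p d"
  shows "tails n r h \<subseteq> internals n r p"
  using btreeD(3)[OF assms] by (force simp: tails_def internals_def allowed_def)

lemma btree_mono: "btree n E r p d \<Longrightarrow> E \<subseteq> F \<Longrightarrow> btree n F r p d"
  by (auto simp: btree_def)

lemma allowed_subset: "allowed E h \<subseteq> E"
  by (auto simp: allowed_def)

text \<open>A walk inside the at most \<open>n\<close> tree arcs can be shortened to as many steps
  as there are arcs. The bound \<open>n\<close> is what lets \<open>n\<close> sweeps of the graph
  search suffice.\<close>

lemma btree_reach:
  assumes "btree n E r p d" "v < n"
  shows "\<exists>j\<le>n. (r, v) \<in> E ^^ j"
proof -
  define T where "T = (\<lambda>v. (p v, v)) ` ({..<n} - {r})"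
  have T: "T \<subseteq> E" "finite T" using btreeD[OF assms(1)] by (auto simp: T_def)
  have "card T \<le> card ({..<n} - {r})" unfolding T_def by (rule card_image_le) simp
  also have "\<dots> \<le> n" using card_mono[of "{..<n}" "{..<n} - {r}"] by simp
  finally have "card T \<le> n" .
  have "(r, v) \<in> T\<^sup>*" using assms(2)
  proof (induction "d v" arbitrary: v rule: less_induct)
    case less
    show ?case
    proof (cases "v = r")
      case False
      hence "(p v, v) \<in> T" "d (p v) < d v" "p v < n"
        using less btreeD[OF assms(1)] by (auto simp: T_def)
      with less.hyps[of "p v"] show ?thesis by (meson rtrancl.rtrancl_into_rtrancl)
    qed simp
  qed
  then obtain j where "j \<le> card T" "(r, v) \<in> T ^^ j"
    unfolding rtrancl_finite_eq_relpow[OF T(2)] by blast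
  moreover have "T ^^ j \<subseteq> E ^^ j" using T(1) by (induction j) (auto intro: relcomp_mono)
  ultimately show ?thesis using \<open>card T \<le> n\<close> by (meson le_trans subsetD)
qed

text \<open>\<open>w = y\<close> stands for a vertex that is only needed as a head. This code is
  free, since a child \<open>w\<close> of \<open>x\<close> has larger rank than the parent
  \<open>y\<close> of \<open>x\<close> and cannot equal it.\<close>

definition via :: "(nat \<times> nat) set \<Rightarrow> nat \<Rightarrow> nat \<Rightarrow> nat \<Rightarrow> bool" where
  "via E y w x \<longleftrightarrow> (y, x) \<in> E \<and> (w = y \<or> (x, w) \<in> E)"

text \<open>
  The core of the kernelization: a vertex outside \<open>V\<close> that takes part in the chosen arcs has its
  parent \<open>y\<close> and its chosen child \<open>w\<close> in the vertex cover \<open>S\<close>, so there are more than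
  \<open>2 * k + 2 * card S\<close> candidates in \<open>V\<close> to replace it, and one of them is a leaf that is not
  involved yet.
\<close>

lemma exchange:
  assumes E: "E \<subseteq> {..<n} \<times> {..<n}"
    and S: "S \<subseteq> V" "finite S" "r \<in> S" and cover: "\<And>u v. (u, v) \<in> E \<Longrightarrow> u \<in> S \<or> v \<in> S"
    and V: "V \<subseteq> {..<n}"
    and keep: "\<And>y w x. y \<in> S \<Longrightarrow> w \<in> S \<Longrightarrow> via E y w x \<Longrightarrow> x \<notin> V \<Longrightarrow>
      2 * k + 2 * card S < card {x \<in> V. via E y w x}"
    and tree: "btree n E r p d" and H: "H \<subseteq> {..<n} - {r}" "card H = k" "inj_on p H"
  shows "\<exists>p d H. btree n E r p d \<and> H \<subseteq> {..<n} - {r} \<and> card H = k \<and> inj_on p H \<and> H \<union> p ` H \<subseteq> V"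
  using tree H
proof (induction "card ((H \<union> p ` H) - V)" arbitrary: p d H rule: less_induct)
  case less
  note t = btreeD(2-4)[OF less.prems(1)]
  have finH: "finite H" using less.prems(2) finite_subset by blast
  show ?case
  proof (cases "H \<union> p ` H \<subseteq> V")
    case True
    thus ?thesis using less.prems by blast
  next
    case False
    then obtain x where x: "x \<in> H \<union> p ` H" "x \<notin> V" by blast
    have xn: "x < n" using x(1) less.prems(2) t by auto
    have xS: "x \<notin> S" and xr: "x \<noteq> r" using x(2) S by auto
    define y where "y = p x"
    have yS: "y \<in> S" and yx: "(y, x) \<in> E" and yn: "y < n" and dy: "d y < d x"
      using cover[of y x] t[of x] xn xr xS by (auto simp: y_def)
    define w where "w = (if x \<in> p ` H then (SOME w. w \<in> H \<and> p w = x) else y)"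
    have w: "w \<in> H" "p w = x" if "x \<in> p ` H"
      using someI_ex[of "\<lambda>w. w \<in> H \<and> p w = x"] that by (auto simp: w_def)
    have wr: "w < n" "w \<noteq> r" "(x, w) \<in> E" "w \<in> S" "d x < d w" "w \<noteq> x" if "x \<in> p ` H"
    proof -
      show "w < n" "w \<noteq> r" using w[OF that] less.prems(2) by auto
      with t[of w] w[OF that] show "(x, w) \<in> E" "d x < d w" by auto
      with cover[of x w] xS show "w \<in> S" by blast
      with xS show "w \<noteq> x" by blast
    qed
    have wS: "w \<in> S" using wr(4) yS by (cases "x \<in> p ` H") (auto simp: w_def)
    have via: "via E y w x" using yx wr(3) by (cases "x \<in> p ` H") (auto simp: w_def via_def)
    \<comment> \<open>The vertices that a replacement must avoid. By the cover property a vertex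
      outside \<open>S\<close> has all its children in \<open>S\<close>, so avoiding the parents of
      the vertices of \<open>S\<close> as well leaves only leaves.\<close>
    define Av where "Av = H \<union> p ` H \<union> S \<union> p ` (S - {r})"
    have finAv: "finite Av" using finH S(2) by (auto simp: Av_def)
    have "card Av \<le> card H + card (p ` H) + card S + card (p ` (S - {r}))"
      unfolding Av_def by (intro order_trans[OF card_Un_le] add_mono) auto
    also have "\<dots> \<le> k + k + card S + card S"
      using card_image_le[OF finH, of p] card_image_le[of "S - {r}" p] S(2) less.prems(3)
        card_mono[of S "S - {r}"] by (intro add_mono) auto
    also have "\<dots> < card {x \<in> V. via E y w x}" using keep[OF yS wS via x(2)] by simp
    finally have "\<not> {x \<in> V. via E y w x} \<subseteq> Av" using finAv card_mono by (meson leD)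
    then obtain x' where x': "x' \<in> V" "via E y w x'" "x' \<notin> Av" by blast
    have x'n: "x' < n" and yx': "(y, x') \<in> E" and x'r: "x' \<noteq> r" and x'H: "x' \<notin> H" and x'p: "x' \<notin> p ` H"
      and x'S: "x' \<notin> S" using x' V S(3) by (auto simp: via_def Av_def)
    have leaf: "p v \<noteq> x'" if "v < n" "v \<noteq> r" for v
      using cover[of "p v" v] t[OF that] x' that by (auto simp: Av_def)
    have x'w: "(x', w) \<in> E" if "x \<in> p ` H"
      using x'(2) w[OF that] wr[OF that] dy by (auto simp: via_def)
    \<comment> \<open>\<open>x'\<close> is re-hung below \<open>y\<close> and takes over the chosen
      child \<open>w\<close>, if there is one; \<open>x\<close> keeps its place and its other
      children. Since \<open>d y < d x < d w\<close>, the rank \<open>Suc (d y)\<close> stays below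
      that of \<open>w\<close>, and the leaf \<open>x'\<close> has no other children.\<close>
    define p' where "p' = (if x \<in> p ` H then p(x' := y, w := x') else p(x' := y))"
    define d' where "d' = d(x' := Suc (d y))"
    define H' where "H' = (if x \<in> H then insert x' (H - {x}) else H)"
    have wx': "w \<noteq> x'" using wS x'S by blast
    have yx'n: "y \<noteq> x'" using yS x'S by blast
    have tree': "btree n E r p' d'"
    proof (rule btreeI[OF btreeD(1)[OF less.prems(1)]])
      fix v assume v: "v < n" "v \<noteq> r"
      consider "v = x'" | "x \<in> p ` H" "v = w" | "v \<noteq> x'" "\<not> (x \<in> p ` H \<and> v = w)" by blast
      thus "p' v < n \<and> (p' v, v) \<in> E \<and> d' (p' v) < d' v"
      proof cases
        case 1
        thus ?thesis using yx' yn yx'n wx' by (auto simp: p'_def d'_def)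
      next
        case 2
        thus ?thesis using x'w wr x'n dy wx' by (auto simp: p'_def d'_def)
      next
        case 3
        hence "p' v = p v" by (auto simp: p'_def)
        thus ?thesis using t[OF v] v leaf[OF v] 3 by (auto simp: d'_def)
      qed
    qed
    have "H' \<subseteq> {..<n} - {r}" using less.prems(2) x'n x'r by (auto simp: H'_def)
    moreover have "card H' = k"
      using less.prems(3) x'H finH card_Suc_Diff1[OF finH, of x] by (auto simp: H'_def)
    moreover have img: "p' v = (if v = x' then p x else if x \<in> p ` H \<and> v = w then x' else p v)" for v
      using wx' by (auto simp: p'_def y_def)
    have injp: "p a = p b \<longleftrightarrow> a = b" if "a \<in> H" "b \<in> H" for a b
      using less.prems(4) that by (auto simp: inj_on_def)
    have "inj_on p' H'"
    proof (rule inj_onI)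
      fix a b assume ab: "a \<in> H'" "b \<in> H'" "p' a = p' b"
      have px: "p x \<noteq> x'" using yx'n by (simp add: y_def)
      have im: "p a \<noteq> x'" if "a \<in> H" for a using that x'p by blast
      show "a = b"
      proof (cases "x \<in> H")
        case True
        have H': "a = x' \<or> a \<in> H \<and> a \<noteq> x" "b = x' \<or> b \<in> H \<and> b \<noteq> x"
          using ab True by (auto simp: H'_def)
        have 1: "p c = p x \<longleftrightarrow> c = x" if "c \<in> H" for c using injp[OF that True] .
        show ?thesis using ab(3) H' 1 injp px im x'H unfolding img
          by (auto split: if_splits)
      next
        case False
        hence H': "a \<in> H" "b \<in> H" using ab by (auto simp: H'_def)
        thus ?thesis using ab(3) injp[OF H'] im x'H unfolding img by (auto split: if_splits)
      qed
    qed
    \<comment> \<open>\<open>x\<close> drops out: as a head it was removed, and as a tail it lost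
      \<open>w\<close>, by injectivity its only child in \<open>H\<close>. The only newcomer
      \<open>x'\<close> lies in \<open>V\<close>.\<close>
    moreover have "card ((H' \<union> p' ` H') - V) < card ((H \<union> p ` H) - V)"
    proof (rule psubset_card_mono)
      show "finite ((H \<union> p ` H) - V)" using finH by simp
      have "H' \<union> p' ` H' \<subseteq> insert x' (H \<union> p ` H)"
        using x'H unfolding H'_def by (auto simp: img)
      moreover have "x \<notin> H' \<union> p' ` H'"
      proof
        assume "x \<in> H' \<union> p' ` H'"
        moreover have "x \<notin> H'" using x(2) x'(1) by (auto simp: H'_def)
        ultimately obtain v where v: "v \<in> H'" "x = p' v" by blast
        have "p x \<noteq> x" using dy by (auto simp: y_def)
        hence "v \<noteq> x'" using v(2) img by auto
        hence "v \<in> H" using v(1) by (auto simp: H'_def split: if_splits)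
        moreover have "x \<noteq> x'" using x(2) x'(1) by blast
        ultimately have pv: "p v = x" "\<not> (x \<in> p ` H \<and> v = w)"
          using v(2) \<open>v \<noteq> x'\<close> img[of v] by presburger+
        hence "x \<in> p ` H" using \<open>v \<in> H\<close> by blast
        with pv w[OF this] injp[OF \<open>v \<in> H\<close>, of w] show False by simp
      qed
      ultimately show "(H' \<union> p' ` H') - V \<subset> (H \<union> p ` H) - V" using x x'(1) by blast
    qed
    ultimately show ?thesis using less.hyps[OF _ tree'] by blast
  qed
qed

section \<open>Graph search for a spanning tree with prescribed parents\<close>

definition Adj :: "exp \<Rightarrow> exp \<Rightarrow> exp" where
  "Adj e f = Mem (Plus (Arr 0 e) f)"

definition adj :: "state \<Rightarrow> nat \<Rightarrow> nat \<Rightarrow> bool" where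
  "adj s u v \<longleftrightarrow> mem s (arr s 0 u + v) \<noteq> 0"

lemma val_Adj [simp]: "val (Adj e f) s = 0 \<longleftrightarrow> \<not> adj s (val e s) (val f s)"
  by (simp add: Adj_def adj_def)

lemma ops_Adj [simp]: "ops (Adj e f) = 9 * ops e + ops f + 17"
  by (simp add: Adj_def)

text \<open>
  Registers: \<open>0\<close>, \<open>1\<close>, \<open>2\<close> hold \<open>n\<close>, \<open>k\<close>, \<open>n * n\<close>; \<open>3\<close> the root; \<open>4\<close>, \<open>5\<close>, \<open>6\<close>, \<open>15\<close>, \<open>16\<close> are loop
  indices; \<open>9\<close> tells whether a solution has been found, and \<open>10\<close> whether the last search tree spans;
  \<open>12\<close> holds \<open>8 * k\<close>, \<open>13\<close> the number \<open>m\<close> of candidate arcs, and \<open>14\<close> holds \<open>m ^ k\<close>.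

  Arrays: \<open>0\<close> holds the multiples of \<open>n\<close>, which locate the rows of the matrix; \<open>1\<close> the prescribed
  parents and \<open>2\<close> the parents in the search tree, both shifted by one, with the dummy parent \<open>n\<close> for
  the root; \<open>3\<close>, \<open>4\<close>, \<open>5\<close> mark the internal vertices, the vertex cover and the kernel; \<open>6\<close> and \<open>7\<close>
  hold the tails and heads of the candidate arcs; \<open>8\<close> the selection of \<open>k\<close> of them, as the digits
  of a number in base \<open>m\<close>.
\<close>

definition graph_state :: "nat \<Rightarrow> nat \<Rightarrow> (nat \<times> nat) set \<Rightarrow> state \<Rightarrow> bool" where
  "graph_state n k E s \<longleftrightarrow> reg s 0 = n \<and> reg s 1 = k \<and> reg s 2 = n * n \<and> (\<forall>u<n. arr s 0 u = n * u) \<and>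
     (\<forall>u<n. \<forall>v<n. mem s (n * u + v) \<noteq> 0 \<longleftrightarrow> (u, v) \<in> E) \<and>
     E \<subseteq> {..<n} \<times> {..<n} \<and> (\<forall>u. (u, u) \<notin> E)"

lemma row_address: "u < n \<Longrightarrow> v < n \<Longrightarrow> n * u + v < n * (n::nat)"
proof -
  assume "u < n" "v < n"
  hence "n * u + v < n * Suc u" by simp
  also have "\<dots> \<le> n * n" using \<open>u < n\<close> by (intro mult_le_mono2) simp
  finally show ?thesis .
qed

lemma graph_state_adj:
  "graph_state n k E s \<Longrightarrow> u < n \<Longrightarrow> v < n \<Longrightarrow> adj s u v \<longleftrightarrow> (u, v) \<in> E"
  by (auto simp: graph_state_def adj_def)

lemma graph_stateD:
  assumes "graph_state n k E s"
  shows "reg s 0 = n" "reg s 1 = k" "E \<subseteq> {..<n} \<times> {..<n}" "(u, u) \<notin> E"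
  using assms by (auto simp: graph_state_def)

lemma graph_state_frame:
  "graph_state n k E s \<Longrightarrow> frame R A s s' \<Longrightarrow> 0 \<notin> R \<Longrightarrow> 1 \<notin> R \<Longrightarrow> 0 \<notin> A \<Longrightarrow> graph_state n k E s'"
  unfolding graph_state_def frame_def by (auto simp: row_address)

text \<open>Invariant of the graph search, with 0 for vertices not yet reached. The rank exists only
  in the proof and is never computed.\<close>

definition partial :: "nat \<Rightarrow> (nat \<times> nat) set \<Rightarrow> nat \<Rightarrow> (nat \<Rightarrow> nat) \<Rightarrow> bool" where
  "partial n A r par \<longleftrightarrow> par r = Suc n \<and> (\<exists>d::nat \<Rightarrow> nat. \<forall>v<n. par v \<noteq> 0 \<longrightarrow> v \<noteq> r \<longrightarrow>
     (\<exists>u<n. par v = Suc u \<and> par u \<noteq> 0 \<and> (u, v) \<in> A \<and> d u < d v))"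

text \<open>An unreached vertex is nobody's parent, so its rank can be chosen freely above that of
  \<open>u\<close>.\<close>

lemma partial_step:
  assumes "partial n A r par" "(u, v) \<in> A" "u < n" "par u \<noteq> 0" "par v = 0"
  shows "partial n A r (par(v := Suc u))"
proof -
  from assms(1) obtain d :: "nat \<Rightarrow> nat" where d: "par r = Suc n"
    "\<And>v. v < n \<Longrightarrow> par v \<noteq> 0 \<Longrightarrow> v \<noteq> r \<Longrightarrow> \<exists>u<n. par v = Suc u \<and> par u \<noteq> 0 \<and> (u, v) \<in> A \<and> d u < d v"
    by (auto simp: partial_def)
  have uv: "u \<noteq> v" and vr: "v \<noteq> r" using assms d(1) by auto
  show ?thesis unfolding partial_def
  proof (intro conjI exI[of _ "d(v := Suc (d u))"] allI impI)
    show "(par(v := Suc u)) r = Suc n" using vr d by simp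
    fix w assume w: "w < n" "(par(v := Suc u)) w \<noteq> 0" "w \<noteq> r"
    show "\<exists>x<n. (par(v := Suc u)) w = Suc x \<and> (par(v := Suc u)) x \<noteq> 0 \<and> (x, w) \<in> A \<and>
      (d(v := Suc (d u))) x < (d(v := Suc (d u))) w"
    proof (cases "w = v")
      case True
      thus ?thesis using assms uv by (intro exI[of _ u]) auto
    next
      case False
      with d(2)[of w] w obtain x where "x < n" "par w = Suc x" "par x \<noteq> 0" "(x, w) \<in> A" "d x < d w"
        by auto
      moreover from this assms have "x \<noteq> v" by auto
      ultimately show ?thesis using False by (intro exI[of _ x]) auto
    qed
  qed
qed

definition closure_step :: com where
  "closure_step =
     Cond (EAnd (EAnd (Arr 2 (Reg 5)) (ENot (Arr 2 (Reg 6)))) (EAnd (Adj (Reg 5) (Reg 6))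
         (Plus (ENot (Arr 1 (Reg 6))) (EEq (Arr 1 (Reg 6)) (Plus (Reg 5) (Const 1))))))
       (ArrStore 2 (Reg 6) (Plus (Reg 5) (Const 1))) Skip"

text \<open>As in the Bellman-Ford algorithm, \<open>m\<close> sweeps over all pairs reach
  everything within \<open>m\<close> steps of the root, and by \<open>btree_reach\<close>
  \<open>n\<close> sweeps suffice.\<close>

definition closure :: com where
  "closure =
     Seq (For 4 0 (ArrStore 2 (Reg 4) (Const 0)))
     (Seq (ArrStore 2 (Reg 3) (Plus (Reg 0) (Const 1)))
     (For 4 0 (For 5 0 (For 6 0 closure_step))))"

lemma syntax_closure_step [simp]:
  "wregs closure_step = {}" "warrs closure_step = {2}" "array_only closure_step" "straight closure_step"
  "cost closure_step \<le> 292"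
  by (auto simp: closure_step_def)

lemma syntax_closure [simp]:
  "wregs closure = {4, 5, 6}" "warrs closure = {2}" "array_only closure"
  by (auto simp: closure_def)

lemma run_closure:
  assumes G: "graph_state n k E s" and r: "reg s 3 = r" "r < n"
  defines "A \<equiv> allowed E (arr s 1)"
  shows "run closure s (1000 * Suc n ^ 3) (\<lambda>s'. partial n A r (arr s' 2) \<and>
    (\<forall>v<n. \<forall>j\<le>n. (r, v) \<in> A ^^ j \<longrightarrow> arr s' 2 v \<noteq> 0))"
proof -
  let ?n = "Suc n"
  have An: "A \<subseteq> {..<n} \<times> {..<n}" using graph_stateD(3)[OF G] allowed_subset unfolding A_def by blast
  have pos: "1 \<le> ?n ^ 3" "?n \<le> ?n ^ 3" by (simp, rule self_le_power) auto
  have sweep: "run (For 5 0 (For 6 0 closure_step)) s2 (316 * ?n ^ 2)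
      (\<lambda>s'. partial n A r (arr s' 2) \<and> (\<forall>x. arr s2 2 x \<noteq> 0 \<longrightarrow> arr s' 2 x \<noteq> 0) \<and>
        (\<forall>u<n. \<forall>v<n. arr s2 2 u \<noteq> 0 \<longrightarrow> (u, v) \<in> A \<longrightarrow> arr s' 2 v \<noteq> 0))"
    if G2: "graph_state n k E s2" and p2: "partial n A r (arr s2 2)" and h2: "arr s2 1 = arr s 1" for s2
  proof -
    have n2: "reg s2 0 = n" using graph_stateD[OF G2] by simp
    let ?Inv = "\<lambda>m s'. partial n A r (arr s' 2) \<and> (\<forall>x. arr s2 2 x \<noteq> 0 \<longrightarrow> arr s' 2 x \<noteq> 0) \<and>
        (\<forall>u<m. \<forall>v<n. arr s2 2 u \<noteq> 0 \<longrightarrow> (u, v) \<in> A \<longrightarrow> arr s' 2 v \<noteq> 0)"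
    show ?thesis
    proof (rule run_For[where Inv = ?Inv and T = "308 * ?n ^ 1"])
      fix u s3
      assume u: "u < reg s2 0" "frame (insert 5 (wregs (For 6 0 closure_step))) (warrs (For 6 0 closure_step)) s2 s3"
        "reg s3 5 = u" "?Inv u s3"
      have n3: "reg s3 0 = n" and h3: "arr s3 1 = arr s 1" using u(2) n2 h2 by (auto simp: frame_def)
      have G3: "graph_state n k E s3" using graph_state_frame[OF G2 u(2)] by auto
      let ?Inv' = "\<lambda>m s'. ?Inv u s' \<and> (\<forall>v<m. arr s2 2 u \<noteq> 0 \<longrightarrow> (u, v) \<in> A \<longrightarrow> arr s' 2 v \<noteq> 0)"
      show "run (For 6 0 closure_step) s3 (308 * ?n ^ 1) (?Inv (Suc u))"
      proof (rule run_For[where Inv = ?Inv' and T = 292])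
        show "Suc (reg s3 0) * (292 + 8) \<le> 308 * ?n ^ 1" using n3 by simp
        fix v s4
        assume v: "v < reg s3 0" "frame (insert 6 (wregs closure_step)) (warrs closure_step) s3 s4"
          "reg s4 6 = v" "?Inv' v s4"
        have G4: "graph_state n k E s4" using graph_state_frame[OF G3 v(2)] by auto
        have r4: "reg s4 5 = u" "arr s4 1 = arr s 1" using v(2) u h3 by (auto simp: frame_def)
        have uv: "u < n" "v < n" using u v n2 n3 by auto
        have A: "(u, v) \<in> A \<longleftrightarrow> adj s4 u v \<and> (arr s 1 v = 0 \<or> arr s 1 v = Suc u)"
          using graph_state_adj[OF G4 uv] by (auto simp: A_def allowed_def)
        let ?p = "arr s4 2"
        have sem: "arr (sem closure_step s4) 2 = (if ?p u \<noteq> 0 \<and> ?p v = 0 \<and> (u, v) \<in> A then ?p(v := Suc u) else ?p)"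
          using r4 v(3) by (auto simp: closure_step_def A)
        have "partial n A r (arr (sem closure_step s4) 2)"
          unfolding sem using v(4) partial_step[of n A r ?p u v] uv by auto
        moreover have "?p x \<noteq> 0 \<Longrightarrow> arr (sem closure_step s4) 2 x \<noteq> 0" for x unfolding sem by auto
        moreover have "?p u \<noteq> 0 \<Longrightarrow> (u, v) \<in> A \<Longrightarrow> arr (sem closure_step s4) 2 v \<noteq> 0" unfolding sem by auto
        ultimately show "run closure_step s4 292 (?Inv' (Suc v))"
          using v(4) by (intro run_straight) (auto simp: less_Suc_eq)
      qed (use u n3 in \<open>auto simp: less_Suc_eq\<close>)
    next
      show "Suc (reg s2 0) * (308 * ?n ^ 1 + 8) \<le> 316 * ?n ^ 2"
        unfolding n2 by (rule For_bound[OF order_refl]) simp_all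
    qed (use p2 n2 in auto)
  qed
  show ?thesis unfolding closure_def
  proof (rule run_Seq_frame[OF run_fill])
    fix s1 assume s1: "\<forall>v<reg s 0. arr s1 2 v = 0"
      "frame (wregs (For 4 0 (ArrStore 2 (Reg 4) (Const 0)))) (warrs (For 4 0 (ArrStore 2 (Reg 4) (Const 0)))) s s1"
    define s2 where "s2 = seta 2 r (Suc n) s1"
    have G1: "graph_state n k E s1" using graph_state_frame[OF G s1(2)] by auto
    have r1: "reg s1 3 = r" "reg s1 0 = n" "arr s1 1 = arr s 1" using s1(2) r graph_stateD[OF G]
      by (auto simp: frame_def)
    have sem: "sem (ArrStore 2 (Reg 3) (Plus (Reg 0) (Const 1))) s1 = s2" using r1 by (simp add: s2_def)
    let ?Inv = "\<lambda>m s'. partial n A r (arr s' 2) \<and> (\<forall>v<n. \<forall>j\<le>m. (r, v) \<in> A ^^ j \<longrightarrow> arr s' 2 v \<noteq> 0)"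
    show "run (Seq (ArrStore 2 (Reg 3) (Plus (Reg 0) (Const 1))) (For 4 0 (For 5 0 (For 6 0 closure_step))))
        s1 (400 * ?n ^ 3) (?Inv n)"
    proof (rule run_Seq_frame[OF run_straight])
      fix s2'
      assume "s2' = s2" "frame (wregs (ArrStore 2 (Reg 3) (Plus (Reg 0) (Const 1))))
         (warrs (ArrStore 2 (Reg 3) (Plus (Reg 0) (Const 1)))) s1 s2'"
      hence f2: "frame {} {2} s1 s2" by simp
      have G2: "graph_state n k E s2" using graph_state_frame[OF G1 f2] by auto
      have r2: "reg s2 3 = r" "reg s2 0 = n" "arr s2 1 = arr s 1" using r1 by (auto simp: s2_def)
      have p2: "arr s2 2 v = (if v = r then Suc n else 0)" if "v < n" for v
        using that s1 graph_stateD[OF G] by (auto simp: s2_def)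
      show "run (For 4 0 (For 5 0 (For 6 0 closure_step))) s2' (324 * ?n ^ 3) (?Inv n)" unfolding \<open>s2' = s2\<close>
      proof (rule run_For[where Inv = ?Inv and T = "316 * ?n ^ 2"])
        show "?Inv 0 s2" using p2 r by (auto simp: partial_def)
        fix m s3
        assume m: "m < reg s2 0" "frame (insert 4 (wregs (For 5 0 (For 6 0 closure_step))))
          (warrs (For 5 0 (For 6 0 closure_step))) s2 s3" "reg s3 4 = m" "?Inv m s3"
        have G3: "graph_state n k E s3" using graph_state_frame[OF G2 m(2)] by auto
        have h3: "arr s3 1 = arr s 1" using m(2) r2 by (auto simp: frame_def)
        show "run (For 5 0 (For 6 0 closure_step)) s3 (316 * ?n ^ 2) (?Inv (Suc m))"
        proof (rule run_mono[OF sweep[OF G3 conjunct1[OF m(4)] h3] order_refl])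
          fix s4 assume s4: "partial n A r (arr s4 2) \<and> (\<forall>x. arr s3 2 x \<noteq> 0 \<longrightarrow> arr s4 2 x \<noteq> 0) \<and>
            (\<forall>u<n. \<forall>v<n. arr s3 2 u \<noteq> 0 \<longrightarrow> (u, v) \<in> A \<longrightarrow> arr s4 2 v \<noteq> 0)"
          have "arr s4 2 v \<noteq> 0" if v: "v < n" "j \<le> Suc m" "(r, v) \<in> A ^^ j" for v j
          proof (cases "j \<le> m")
            case True
            thus ?thesis using m(4) s4 v by blast
          next
            case False
            with v have "(r, v) \<in> A ^^ Suc m" by (simp add: le_Suc_eq)
            then obtain u where u: "(r, u) \<in> A ^^ m" "(u, v) \<in> A" by auto
            with An have "u < n" by auto
            with u m(4) s4 v show ?thesis by blast
          qed
          thus "?Inv (Suc m) s4" using s4 by blast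
        qed
      next
        show "Suc (reg s2 0) * (316 * ?n ^ 2 + 8) \<le> 324 * ?n ^ 3"
          unfolding r2 by (rule For_bound[OF order_refl]) simp_all
      qed (use r2 in auto)
    qed (use sem pos in auto)
  qed (use pos graph_stateD[OF G] in auto)
qed

text \<open>The dummy parent of the root marks cell \<open>n\<close> of array 3, which the count
  over the cells below \<open>n\<close> does not see.\<close>

definition stats :: com where
  "stats =
     Seq (For 4 0 (ArrStore 3 (Reg 4) (Const 0)))
     (Seq (Assign 7 (Const 0))
     (Seq (For 4 0 (Cond (Arr 2 (Reg 4))
        (Seq (ArrStore 3 (Minus (Arr 2 (Reg 4)) (Const 1)) (Const 1)) (Assign 7 (Plus (Reg 7) (Const 1)))) Skip))
     (Seq (Assign 8 (Const 0))
     (Seq (For 4 0 (Cond (Arr 3 (Reg 4)) (Assign 8 (Plus (Reg 8) (Const 1))) Skip))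
     (Seq (Assign 10 (EEq (Reg 7) (Reg 0)))
     (Assign 9 (EAnd (Reg 10) (ENot (Minus (Reg 1) (Reg 8))))))))))"

lemma syntax_stats [simp]:
  "wregs stats = {4, 7, 8, 9, 10}" "warrs stats = {3}" "array_only stats"
  by (auto simp: stats_def)

lemma card_less_Suc: "card {v::nat. v < Suc m \<and> P v} = card {v. v < m \<and> P v} + of_bool (P m)"
proof -
  have "{v. v < Suc m \<and> P v} = (if P m then insert m {v. v < m \<and> P v} else {v. v < m \<and> P v})"
    by (auto simp: less_Suc_eq)
  thus ?thesis by simp
qed

lemma run_Assign:
  "Q (setr x (val e s) s) \<Longrightarrow> ops e + 1 \<le> T \<Longrightarrow> run (Assign x e) s T Q"
  by (rule run_straight) auto

lemma run_stats:
  assumes n: "reg s 0 = n" and k: "reg s 1 = k"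
  defines "I \<equiv> {u. u < n \<and> (\<exists>v<n. arr s 2 v = Suc u)}"
  shows "run stats s (700 * Suc n) (\<lambda>s'. (\<forall>u<n. arr s' 3 u \<noteq> 0 \<longleftrightarrow> u \<in> I) \<and>
     reg s' 10 = of_bool (\<forall>v<n. arr s 2 v \<noteq> 0) \<and>
     reg s' 9 = of_bool ((\<forall>v<n. arr s 2 v \<noteq> 0) \<and> k \<le> card I))"
proof -
  let ?p = "arr s 2"
  define Q where "Q = (\<lambda>s'. (\<forall>u<n. arr s' 3 u \<noteq> 0 \<longleftrightarrow> u \<in> I) \<and>
     reg s' 10 = of_bool (\<forall>v<n. ?p v \<noteq> 0) \<and> reg s' 9 = of_bool ((\<forall>v<n. ?p v \<noteq> 0) \<and> k \<le> card I))"
  have "run stats s (700 * Suc n) Q" unfolding stats_def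
  proof (rule run_Seq_frame[where U = "660 * Suc n", OF run_fill], goal_cases)
    case (5 s1)
    have s1: "reg s1 0 = n" "reg s1 1 = k" "arr s1 2 = ?p" "\<forall>v<n. arr s1 3 v = 0"
      using 5 n k by (auto simp: frame_def)
    let ?Inv = "\<lambda>m s'. reg s' 7 = card {v. v < m \<and> ?p v \<noteq> 0} \<and>
      (\<forall>u<n. arr s' 3 u \<noteq> 0 \<longleftrightarrow> (\<exists>v<m. ?p v = Suc u))"
    show ?case
    proof (rule run_Seq[where U = "650 * Suc n", OF run_Assign], rule run_Seq_frame[where U = "250 * Suc n", OF run_For[where Inv = ?Inv and T = 300 and Q = "?Inv n" and T' = "308 * Suc n"]], goal_cases)
      case (2 m s2)
      have p2: "arr s2 2 = ?p" using 2(2) s1 by (auto simp: frame_def)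
      have "m < n" using 2 s1 by simp
      have ex: "(\<exists>v<Suc m. ?p v = Suc u) \<longleftrightarrow> (\<exists>v<m. ?p v = Suc u) \<or> ?p m = Suc u" for u
        by (auto simp: less_Suc_eq)
      show ?case
        using 2(3,4) p2 \<open>m < n\<close> by (intro run_straight) (auto simp: card_less_Suc ex)
    next
      case (12 s2)
      have s2: "reg s2 0 = n" "reg s2 1 = k" using 12(2) s1 by (auto simp: frame_def)
      have I2: "\<forall>u<n. arr s2 3 u \<noteq> 0 \<longleftrightarrow> u \<in> I" and c2: "reg s2 7 = card {v. v < n \<and> ?p v \<noteq> 0}"
        using 12(1) by (auto simp: I_def)
      have sub: "{v. v < n \<and> ?p v \<noteq> 0} \<subseteq> {..<n}" by auto
      have full: "card {v. v < n \<and> ?p v \<noteq> 0} = n \<longleftrightarrow> (\<forall>v<n. ?p v \<noteq> 0)"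
      proof
        assume "card {v. v < n \<and> ?p v \<noteq> 0} = n"
        with card_subset_eq[OF _ sub] have "{v. v < n \<and> ?p v \<noteq> 0} = {..<n}" by simp
        thus "\<forall>v<n. ?p v \<noteq> 0" by blast
      next
        assume "\<forall>v<n. ?p v \<noteq> 0"
        hence "{v. v < n \<and> ?p v \<noteq> 0} = {..<n}" by blast
        thus "card {v. v < n \<and> ?p v \<noteq> 0} = n" by simp
      qed
      let ?Inv = "\<lambda>m s'. reg s' 8 = card {u. u < m \<and> u \<in> I}"
      show ?case
      proof (rule run_Seq[where U = "240 * Suc n", OF run_Assign], rule run_Seq_frame[where U = "100 * Suc n", OF run_For[where Inv = ?Inv and T = 100 and Q = "?Inv n" and T' = "108 * Suc n"]], goal_cases)
        case (2 m s3)
        have "arr s3 3 = arr s2 3" "m < n" using 2 s2 by (auto simp: frame_def)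
        thus ?case using 2(3,4) I2 by (intro run_straight) (auto simp: card_less_Suc)
      next
        case (12 s3)
        have "{u. u < n \<and> u \<in> I} = I" by (auto simp: I_def)
        hence "reg s3 0 = n" "reg s3 1 = k" "arr s3 3 = arr s2 3" "reg s3 7 = reg s2 7" "reg s3 8 = card I"
          using 12 s2 by (auto simp: frame_def)
        thus ?case using I2 c2 full by (intro run_straight) (auto simp: Q_def)
      qed (use s2 in auto)
    qed (use s1 in auto)
  qed (use n in auto)
  thus ?thesis unfolding Q_def .
qed

definition check :: com where
  "check = Seq closure stats"

lemma syntax_check [simp]:
  "wregs check = {4, 5, 6, 7, 8, 9, 10}" "warrs check = {2, 3}" "array_only check"
  by (auto simp: check_def)

text \<open>Register 10 decides whether some spanning tree obeys the prescription, whereas register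
  9 judges only the tree that was found: a 0 there says nothing about other trees.\<close>

definition checked :: "nat \<Rightarrow> nat \<Rightarrow> (nat \<times> nat) set \<Rightarrow> nat \<Rightarrow> state \<Rightarrow> bool" where
  "checked n k E r s \<longleftrightarrow> (let A = allowed E (arr s 1); p = (\<lambda>v. arr s 2 v - 1) in
     ((\<exists>p d. btree n A r p d) \<longrightarrow> reg s 10 \<noteq> 0) \<and>
     (reg s 10 \<noteq> 0 \<longrightarrow> (\<exists>d. btree n A r p d) \<and> arr s 2 r = Suc n \<and>
        (\<forall>v<n. v \<noteq> r \<longrightarrow> arr s 2 v = Suc (p v)) \<and> (\<forall>u<n. arr s 3 u \<noteq> 0 \<longleftrightarrow> u \<in> internals n r p)) \<and>
     (reg s 9 \<noteq> 0 \<longleftrightarrow> reg s 10 \<noteq> 0 \<and> k \<le> card (internals n r p)))"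

lemma run_check:
  assumes G: "graph_state n k E s" and r: "reg s 3 = r" "r < n"
  shows "run check s (1700 * Suc n ^ 3) (checked n k E r)"
  unfolding check_def
proof (rule run_Seq_frame[where U = "700 * Suc n", OF run_closure[OF assms]], goal_cases)
  case (2 s1)
  have G1: "graph_state n k E s1" using graph_state_frame[OF G 2(2)] by auto
  let ?A = "allowed E (arr s 1)" and ?par = "arr s1 2" and ?p = "\<lambda>v. arr s1 2 v - 1"
  note part = conjunct1[OF 2(1)]
  have pr: "?par r = Suc n" using part by (simp add: partial_def)
  show ?case
  proof (rule run_frame[where R = "wregs stats" and A = "warrs stats"], rule run_mono[OF run_stats[OF graph_stateD(1,2)[OF G1]] order_refl], rule impI, goal_cases)
    case (1 s2)
    have h2: "arr s2 1 = arr s 1" "arr s2 2 = ?par" using 1(2) 2(2) by (auto simp: frame_def)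
    have complete: "\<forall>v<n. ?par v \<noteq> 0" if "btree n ?A r p d" for p d
      using btree_reach[OF that] 2(1) by blast
    have par: "?par v = Suc (?p v)" "v \<noteq> r \<Longrightarrow> ?p v < n" if "\<forall>v<n. ?par v \<noteq> 0" "v < n" for v
    proof -
      show "?par v = Suc (?p v)" using that by simp
      show "v \<noteq> r \<Longrightarrow> ?p v < n" using part that by (force simp: partial_def)
    qed
    have tree: "\<exists>d. btree n ?A r ?p d" if all: "\<forall>v<n. ?par v \<noteq> 0"
    proof -
      from part obtain d :: "nat \<Rightarrow> nat" where d: "\<And>v. v < n \<Longrightarrow> ?par v \<noteq> 0 \<Longrightarrow> v \<noteq> r \<Longrightarrow>
        (\<exists>u<n. ?par v = Suc u \<and> ?par u \<noteq> 0 \<and> (u, v) \<in> ?A \<and> d u < d v)" by (auto simp: partial_def)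
      have "btree n ?A r ?p d"
      proof (rule btreeI[OF r(2)])
        fix v assume "v < n" "v \<noteq> r"
        with d[of v] all show "?p v < n \<and> (?p v, v) \<in> ?A \<and> d (?p v) < d v" by auto
      qed
      thus ?thesis by blast
    qed
    have int: "{u. u < n \<and> (\<exists>v<n. ?par v = Suc u)} = internals n r ?p" if "\<forall>v<n. ?par v \<noteq> 0"
    proof (intro equalityI subsetI)
      fix u assume "u \<in> {u. u < n \<and> (\<exists>v<n. ?par v = Suc u)}"
      then obtain v where "u < n" "v < n" "?par v = Suc u" by blast
      moreover from this pr have "v \<noteq> r" by auto
      ultimately show "u \<in> internals n r ?p" by (force simp: internals_def)
    next
      fix u assume "u \<in> internals n r ?p"
      then obtain v where "v < n" "v \<noteq> r" "u = ?p v" by (auto simp: internals_def)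
      thus "u \<in> {u. u < n \<and> (\<exists>v<n. ?par v = Suc u)}" using par[OF that] by auto
    qed
    show ?case
      unfolding checked_def Let_def h2 using 1(1) complete tree int pr par by auto
  qed auto
next
  case 3
  have "Suc n \<le> Suc n ^ 3" by (rule self_le_power) auto
  thus ?case by (rule scale_add) simp
qed auto

text \<open>If the prescription alone has \<open>k\<close> tails, every tree obeying it has
  \<open>k\<close> internal vertices, so that testing the one tree found is conclusive.\<close>

lemma checked_tails:
  assumes "checked n k E r s" "btree n (allowed E (arr s 1)) r p d" "k \<le> card (tails n r (arr s 1))"
  shows "reg s 9 \<noteq> 0"
proof -
  let ?p = "\<lambda>v. arr s 2 v - 1"
  from assms(1,2) obtain d' where "reg s 10 \<noteq> 0" "btree n (allowed E (arr s 1)) r ?p d'"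
    unfolding checked_def Let_def by blast
  moreover have "card (tails n r (arr s 1)) \<le> card (internals n r ?p)"
    using tails_subset_internals[OF calculation(2)] by (intro card_mono) auto
  ultimately show ?thesis using assms(1,3) unfolding checked_def Let_def by auto
qed

section \<open>A small vertex cover\<close>

text \<open>\<open>h\<close> uses the code for prescriptions, so that the matching can be handed to
  the graph search as it stands. The clause \<open>h u = 0\<close> keeps tails apart from heads, and
  injectivity keeps the tails apart from each other.\<close>

definition matching :: "nat \<Rightarrow> (nat \<times> nat) set \<Rightarrow> nat set \<Rightarrow> (nat \<Rightarrow> nat) \<Rightarrow> nat set \<Rightarrow> bool" where
  "matching n E S0 h S \<longleftrightarrow> S = S0 \<union> {v. v < n \<and> h v \<noteq> 0} \<union> {u. \<exists>v<n. h v = Suc u} \<and>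
     (\<forall>v<n. h v \<noteq> 0 \<longrightarrow> (\<exists>u<n. h v = Suc u \<and> (u, v) \<in> E \<and> u \<notin> S0 \<and> v \<notin> S0 \<and> h u = 0)) \<and>
     inj_on h {v. v < n \<and> h v \<noteq> 0}"

lemma matching_empty: "(\<And>v. v < n \<Longrightarrow> h v = 0) \<Longrightarrow> matching n E S0 h S0"
  by (auto simp: matching_def inj_on_def)

lemma matching_insert:
  assumes M: "matching n E S0 h S" and uv: "(u, v) \<in> E" "u < n" "v < n" "u \<notin> S" "v \<notin> S" "u \<noteq> v"
  shows "matching n E S0 (h(v := Suc u)) (insert u (insert v S))"
proof -
  have S: "S = S0 \<union> {v. v < n \<and> h v \<noteq> 0} \<union> {u. \<exists>v<n. h v = Suc u}" and
    h: "\<And>v. v < n \<Longrightarrow> h v \<noteq> 0 \<Longrightarrow> \<exists>u<n. h v = Suc u \<and> (u, v) \<in> E \<and> u \<notin> S0 \<and> v \<notin> S0 \<and> h u = 0" and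
    inj: "inj_on h {v. v < n \<and> h v \<noteq> 0}"
    using M by (auto simp: matching_def)
  have z: "h u = 0" "h v = 0" "u \<notin> S0" "v \<notin> S0" and ne: "\<And>w. w < n \<Longrightarrow> h w \<noteq> Suc u" "\<And>w. w < n \<Longrightarrow> h w \<noteq> Suc v"
    using uv unfolding S by auto
  show ?thesis unfolding matching_def
  proof (intro conjI allI impI)
    have "{w. w < n \<and> (h(v := Suc u)) w \<noteq> 0} = insert v {w. w < n \<and> h w \<noteq> 0}" using uv by auto
    moreover have "{x. \<exists>w<n. (h(v := Suc u)) w = Suc x} = insert u {x. \<exists>w<n. h w = Suc x}"
    proof (intro equalityI subsetI)
      fix x assume "x \<in> insert u {x. \<exists>w<n. h w = Suc x}"
      then consider "x = u" | w where "w < n" "h w = Suc x" by auto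
      thus "x \<in> {x. \<exists>w<n. (h(v := Suc u)) w = Suc x}"
      proof cases
        case 2
        with z have "w \<noteq> v" by auto
        with 2 show ?thesis by auto
      qed (use uv in auto)
    qed (auto split: if_splits)
    ultimately show "insert u (insert v S) =
      S0 \<union> {w. w < n \<and> (h(v := Suc u)) w \<noteq> 0} \<union> {x. \<exists>w<n. (h(v := Suc u)) w = Suc x}"
      unfolding S by blast
  next
    fix w assume w: "w < n" "(h(v := Suc u)) w \<noteq> 0"
    show "\<exists>x<n. (h(v := Suc u)) w = Suc x \<and> (x, w) \<in> E \<and> x \<notin> S0 \<and> w \<notin> S0 \<and> (h(v := Suc u)) x = 0"
    proof (cases "w = v")
      case True
      thus ?thesis using uv z by (intro exI[of _ u]) auto
    next
      case False
      with h[of w] w obtain x where "x<n" "h w = Suc x" "(x, w) \<in> E" "x \<notin> S0" "w \<notin> S0" "h x = 0" by auto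
      moreover have "x \<noteq> v" using ne(2)[of w] w calculation by auto
      ultimately show ?thesis using False by (intro exI[of _ x]) auto
    qed
  next
    show "inj_on (h(v := Suc u)) {w. w < n \<and> (h(v := Suc u)) w \<noteq> 0}"
      using inj ne(1) by (auto simp: inj_on_def dest: sym)
  qed
qed

text \<open>As \<open>S0\<close> contains all internal vertices, both ends of a matching arc are
  leaves of the tree. Re-hanging a leaf moves nothing else, and a tail keeps its own place because
  it is no head, so all arcs can be inserted together.\<close>

lemma matching_btree:
  assumes M: "matching n E S0 h S" and t: "btree n E r p d" and S0: "S0 = insert r (internals n r p)"
  shows "\<exists>p d. btree n (allowed E h) r p d"
proof -
  have h: "\<And>v. v < n \<Longrightarrow> h v \<noteq> 0 \<Longrightarrow> \<exists>u<n. h v = Suc u \<and> (u, v) \<in> E \<and> u \<notin> S0 \<and> v \<notin> S0 \<and> h u = 0"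
    using M by (auto simp: matching_def)
  define p' where "p' = (\<lambda>v. if h v = 0 then p v else h v - 1)"
  define d' where "d' = (\<lambda>v. if h v = 0 then d v else Suc (d (h v - 1)))"
  have "btree n (allowed E h) r p' d'"
  proof (rule btreeI[OF btreeD(1)[OF t]])
    fix v assume v: "v < n" "v \<noteq> r"
    note tv = btreeD(2-4)[OF t v]
    show "p' v < n \<and> (p' v, v) \<in> allowed E h \<and> d' (p' v) < d' v"
    proof (cases "h v = 0")
      case True
      have "h (p v) = 0" using h[of "p v"] tv v by (auto simp: S0 internals_def)
      thus ?thesis using tv True by (simp add: p'_def d'_def allowed_def)
    next
      case False
      with h[OF v(1)] obtain u where "u<n" "h v = Suc u" "(u, v) \<in> E" "h u = 0" by auto
      thus ?thesis using False by (simp add: p'_def d'_def allowed_def)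
    qed
  qed
  thus ?thesis by blast
qed

text \<open>A matching has as many heads as tails, and no head is \<open>r\<close>, so
  \<open>tails\<close> misses none of its arcs.\<close>

lemma matching_card:
  assumes M: "matching n E S0 h S" and r: "r \<in> S0" and fin: "finite S0"
  shows "card S \<le> card S0 + 2 * card (tails n r h)"
proof -
  let ?H = "{v. v < n \<and> h v \<noteq> 0}"
  have S: "S = S0 \<union> ?H \<union> {u. \<exists>v<n. h v = Suc u}" and
    h: "\<And>v. v < n \<Longrightarrow> h v \<noteq> 0 \<Longrightarrow> \<exists>u<n. h v = Suc u \<and> (u, v) \<in> E \<and> u \<notin> S0 \<and> v \<notin> S0 \<and> h u = 0" and
    inj: "inj_on h ?H"
    using M by (auto simp: matching_def)
  have *: "{u. \<exists>v<n. h v = Suc u} = tails n r h"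
    using h r by (fastforce simp: tails_def)
  have "h ` ?H \<subseteq> Suc ` tails n r h" using h r by (fastforce simp: tails_def)
  hence "card (h ` ?H) \<le> card (Suc ` tails n r h)" by (intro card_mono) auto
  hence H: "card ?H \<le> card (tails n r h)" using card_image[OF inj] by (simp add: card_image)
  have "card S \<le> card S0 + card ?H + card (tails n r h)"
    unfolding S * by (intro order_trans[OF card_Un_le] add_mono) auto
  thus ?thesis using H by simp
qed

text \<open>A greedy matching: an arc is taken if both ends are still unmarked, so afterwards every
  arc has a marked end. The arcs taken are prescribed in array 1 for the \<open>check\<close> that
  follows.\<close>

definition cover :: com where
  "cover =
     Seq (For 4 0 (ArrStore 4 (Reg 4) (Plus (Arr 3 (Reg 4)) (EEq (Reg 4) (Reg 3)))))
     (For 5 0 (For 6 0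
       (Cond (EAnd (Adj (Reg 5) (Reg 6)) (EAnd (ENot (Arr 4 (Reg 5))) (ENot (Arr 4 (Reg 6)))))
         (Seq (ArrStore 4 (Reg 5) (Const 1)) (Seq (ArrStore 4 (Reg 6) (Const 1))
            (ArrStore 1 (Reg 6) (Plus (Reg 5) (Const 1))))) Skip)))"

definition marked :: "nat \<Rightarrow> nat \<Rightarrow> state \<Rightarrow> nat set" where
  "marked n j s = {v. v < n \<and> arr s j v \<noteq> 0}"

lemma syntax_cover [simp]:
  "wregs cover = {4, 5, 6}" "warrs cover = {1, 4}" "array_only cover"
  by (auto simp: cover_def)

lemma run_cover:
  assumes G: "graph_state n k E s" and r: "reg s 3 = r" "r < n" and h: "\<And>v. v < n \<Longrightarrow> arr s 1 v = 0"
  shows "run cover s (500 * Suc n ^ 2) (\<lambda>s'.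
    matching n E (insert r (marked n 3 s)) (arr s' 1) (marked n 4 s') \<and>
    (\<forall>(u, v) \<in> E. u \<in> marked n 4 s' \<or> v \<in> marked n 4 s'))"
proof -
  let ?n = "Suc n" and ?base = "insert r (marked n 3 s)"
  let ?c = "For 4 0 (ArrStore 4 (Reg 4) (Plus (Arr 3 (Reg 4)) (EEq (Reg 4) (Reg 3))))"
  let ?b = "Cond (EAnd (Adj (Reg 5) (Reg 6)) (EAnd (ENot (Arr 4 (Reg 5))) (ENot (Arr 4 (Reg 6)))))
         (Seq (ArrStore 4 (Reg 5) (Const 1)) (Seq (ArrStore 4 (Reg 6) (Const 1))
            (ArrStore 1 (Reg 6) (Plus (Reg 5) (Const 1))))) Skip"
  have n: "reg s 0 = n" using graph_stateD[OF G] by simp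
  have init: "run ?c s (100 * ?n) (\<lambda>s'. \<forall>v<n. arr s' 4 v \<noteq> 0 \<longleftrightarrow> v \<in> ?base)"
  proof (rule run_For[where Inv = "\<lambda>m s'. \<forall>v<m. arr s' 4 v \<noteq> 0 \<longleftrightarrow> v \<in> ?base" and T = 70])
    fix m s1
    assume m: "m < reg s 0" "frame (insert 4 (wregs (ArrStore 4 (Reg 4) (Plus (Arr 3 (Reg 4)) (EEq (Reg 4) (Reg 3))))))
       (warrs (ArrStore 4 (Reg 4) (Plus (Arr 3 (Reg 4)) (EEq (Reg 4) (Reg 3))))) s s1"
      "reg s1 4 = m" "\<forall>v<m. arr s1 4 v \<noteq> 0 \<longleftrightarrow> v \<in> ?base"
    have "arr s1 3 = arr s 3" "reg s1 3 = r" "m < n" using m r n by (auto simp: frame_def)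
    thus "run (ArrStore 4 (Reg 4) (Plus (Arr 3 (Reg 4)) (EEq (Reg 4) (Reg 3)))) s1 70
      (\<lambda>s'. \<forall>v<Suc m. arr s' 4 v \<noteq> 0 \<longleftrightarrow> v \<in> ?base)"
      using m(3,4) by (intro run_straight) (auto simp: less_Suc_eq marked_def)
  qed (use n in auto)
  have sq: "Suc n \<le> Suc n ^ 2" by (rule self_le_power) auto
  show ?thesis unfolding cover_def
  proof (rule run_Seq_frame[where U = "400 * ?n ^ 2", OF init], goal_cases)
    case (2 s1)
    have G1: "graph_state n k E s1" using graph_state_frame[OF G 2(2)] by auto
    have n1: "reg s1 0 = n" using graph_stateD[OF G1] by simp
    have M1: "marked n 4 s1 = ?base" using 2(1) r by (auto simp: marked_def)
    have h1: "matching n E ?base (arr s1 1) (marked n 4 s1)"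
      unfolding M1 by (rule matching_empty) (use h 2(2) in \<open>auto simp: frame_def\<close>)
    let ?cov = "\<lambda>u v s'. (u, v) \<in> E \<longrightarrow> u \<in> marked n 4 s' \<or> v \<in> marked n 4 s'"
    let ?I = "\<lambda>m s'. matching n E ?base (arr s' 1) (marked n 4 s') \<and> (\<forall>u<m. \<forall>v<n. ?cov u v s')"
    show ?case
    proof (rule run_For[where Inv = ?I and T = "316 * ?n ^ 1"], goal_cases)
      case (2 u s2)
      have G2: "graph_state n k E s2" using graph_state_frame[OF G1 2(2)] by auto
      have n2: "reg s2 0 = n" using graph_stateD[OF G2] by simp
      have u: "u < n" using 2 n1 by simp
      let ?J = "\<lambda>m s'. ?I u s' \<and> (\<forall>v<m. ?cov u v s')"
      show ?case
      proof (rule run_For[where Inv = ?J and T = 300], goal_cases)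
        case (2 v s3)
        have G3: "graph_state n k E s3" using graph_state_frame[OF G2 2(2)] by auto
        have v: "v < n" using 2 n2 by simp
        have r3: "reg s3 5 = u" "reg s3 6 = v" using 2(2,3) \<open>reg s2 5 = u\<close> by (auto simp: frame_def)
        have A: "adj s3 u v \<longleftrightarrow> (u, v) \<in> E" by (rule graph_state_adj[OF G3 u v])
        let ?S = "marked n 4 s3" and ?s = "sem ?b s3"
        show ?case
        proof (rule run_straight)
          show "?J (Suc v) ?s"
          proof (cases "(u, v) \<in> E \<and> u \<notin> ?S \<and> v \<notin> ?S")
            case True
            have s: "arr ?s 1 = (arr s3 1)(v := Suc u)" "marked n 4 ?s = insert u (insert v ?S)"
              using True r3 A u v by (auto simp: marked_def)
            have "u \<noteq> v" using True graph_stateD(4)[OF G] by auto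
            hence "matching n E ?base (arr ?s 1) (marked n 4 ?s)"
              unfolding s using True 2(4) u v by (intro matching_insert) simp_all
            thus ?thesis using 2(4) unfolding s by (auto simp: less_Suc_eq)
          next
            case False
            hence "?s = s3" using r3 A u v by (auto simp: marked_def)
            thus ?thesis using 2(4) False by (auto simp: less_Suc_eq)
          qed
        qed auto
      next
        case 3
        thus ?case using n2 by (auto simp: less_Suc_eq)
      next
        case 4
        thus ?case by (simp add: marked_def)
      next
        case (10)
        show ?case using n2 by simp
      qed (use 2 n2 in \<open>auto simp: less_Suc_eq\<close>)
    next
      case 3
      thus ?case using n1 graph_stateD(3)[OF G] by fastforce
    next
      case 4
      thus ?case by (simp add: marked_def)
    next
      case 10
      show ?case unfolding n1 by (rule For_bound[OF order_refl]) simp_all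
    qed (use h1 in auto)
  next
    case 3
    show ?case using scale_add[OF sq, of 400 100 500] by simp
  qed auto
qed

section \<open>The kernel and its arcs\<close>

definition firsts :: "(nat \<times> nat) set \<Rightarrow> nat \<Rightarrow> nat \<Rightarrow> nat \<Rightarrow> nat set" where
  "firsts E M y w = {x. via E y w x \<and> card {x'. x' < x \<and> via E y w x'} < M}"

text \<open>The number of smaller candidates is an injective rank, with values below
  \<open>M\<close> on \<open>firsts\<close>.\<close>

lemma card_firsts: "finite (firsts E M y w) \<and> card (firsts E M y w) \<le> M"
proof -
  let ?P = "via E y w"
  let ?c = "\<lambda>x. card {x'. x' < x \<and> ?P x'}"
  have less: "?c x < ?c z" if "x < z" "?P x" for x z
    by (rule psubset_card_mono) (use that in auto)
  have inj: "inj_on ?c (firsts E M y w)"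
    by (rule inj_onI) (metis (no_types, lifting) firsts_def less linorder_neqE_nat mem_Collect_eq nat_neq_iff)
  have "?c ` firsts E M y w \<subseteq> {..<M}" by (auto simp: firsts_def)
  from inj_on_finite[OF inj this] card_inj_on_le[OF inj this] show ?thesis by simp
qed

text \<open>The number of candidates below \<open>z\<close> grows by at most one with
  \<open>z\<close>. At the least \<open>z\<close> where it reaches \<open>M\<close> it is exactly
  \<open>M\<close>, and these candidates are all kept.\<close>

lemma firsts_full:
  assumes "via E y w x" "x \<notin> firsts E M y w"
  shows "M \<le> card (firsts E M y w)"
proof -
  let ?P = "via E y w"
  let ?c = "\<lambda>x. card {x'. x' < x \<and> ?P x'}"
  have Mx: "M \<le> ?c x" using assms by (auto simp: firsts_def)
  define z where "z = (LEAST z. M \<le> ?c z)"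
  have "M \<le> ?c z" unfolding z_def using Mx by (rule LeastI)
  moreover have "?c z \<le> M"
  proof (cases z)
    case (Suc z')
    have "\<not> M \<le> ?c z'" using Suc not_less_Least[of z' "\<lambda>z. M \<le> ?c z"] unfolding z_def by simp
    thus ?thesis unfolding Suc card_less_Suc by (simp add: of_bool_def)
  qed simp
  ultimately have z: "?c z = M" by simp
  have "{x'. x' < z \<and> ?P x'} \<subseteq> firsts E M y w"
  proof
    fix x' assume x': "x' \<in> {x'. x' < z \<and> ?P x'}"
    hence "?c x' < ?c z" by (intro psubset_card_mono) auto
    with x' z show "x' \<in> firsts E M y w" by (simp add: firsts_def)
  qed
  hence "?c z \<le> card (firsts E M y w)" using card_firsts by (intro card_mono) auto
  thus ?thesis using z by simp
qed

definition kernel_step :: com where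
  "kernel_step =
     Cond (EAnd (Adj (Reg 5) (Reg 4)) (Plus (EEq (Reg 6) (Reg 5)) (Adj (Reg 4) (Reg 6))))
       (Seq (Cond (Minus (Reg 12) (Reg 11)) (ArrStore 5 (Reg 4) (Const 1)) Skip)
         (Assign 11 (Plus (Reg 11) (Const 1)))) Skip"

definition kernel :: com where
  "kernel =
     Seq (For 4 0 (ArrStore 5 (Reg 4) (Arr 4 (Reg 4))))
     (For 5 0 (For 6 0 (Cond (EAnd (Arr 4 (Reg 5)) (Arr 4 (Reg 6)))
        (Seq (Assign 11 (Const 0)) (For 4 0 kernel_step)) Skip)))"

lemma syntax_kernel_step [simp]:
  "wregs kernel_step = {11}" "warrs kernel_step = {5}" "array_only kernel_step" "straight kernel_step"
  "cost kernel_step \<le> 200"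
  by (auto simp: kernel_step_def)

lemma syntax_kernel [simp]:
  "wregs kernel = {4, 5, 6, 11}" "warrs kernel = {5}" "array_only kernel"
  by (auto simp: kernel_def)

lemma run_kernel:
  assumes G: "graph_state n k E s"
  defines "S \<equiv> marked n 4 s"
  shows "run kernel s (500 * Suc n ^ 3) (\<lambda>s'.
    marked n 5 s' = S \<union> (\<Union>y\<in>S. \<Union>w\<in>S. firsts E (reg s 12) y w))"
proof -
  let ?n = "Suc n"
  define M where "M = reg s 12"
  have n: "reg s 0 = n" using graph_stateD[OF G] by simp
  have En: "firsts E M y w \<subseteq> {..<n}" for y w
    using graph_stateD(3)[OF G] by (auto simp: firsts_def via_def)
  have init: "run (For 4 0 (ArrStore 5 (Reg 4) (Arr 4 (Reg 4)))) s (100 * ?n) (\<lambda>s'. marked n 5 s' = S)"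
  proof (rule run_For[where Inv = "\<lambda>m s'. \<forall>v<m. arr s' 5 v = arr s 4 v" and T = 70], goal_cases)
    case (2 m s1)
    have "arr s1 4 = arr s 4" using 2 by (auto simp: frame_def)
    with 2(3,4) show ?case by (intro run_straight) (auto simp: less_Suc_eq)
  qed (use n in \<open>auto simp: marked_def S_def\<close>)
  have sq: "Suc n \<le> Suc n ^ 3" by (rule self_le_power) auto
  show ?thesis unfolding kernel_def M_def[symmetric]
  proof (rule run_Seq_frame[where U = "400 * ?n ^ 3", OF init], goal_cases)
    case (2 s1)
    have G1: "graph_state n k E s1" using graph_state_frame[OF G 2(2)] by auto
    have n1: "reg s1 0 = n" "reg s1 12 = M" "arr s1 4 = arr s 4"
      using graph_stateD[OF G1] 2(2) by (auto simp: M_def frame_def)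
    have S1: "marked n 4 s' = S" if "arr s' 4 = arr s 4" for s' using that by (simp add: S_def marked_def)
    let ?I = "\<lambda>m s'. marked n 5 s' = S \<union> (\<Union>y\<in>S \<inter> {..<m}. \<Union>w\<in>S. firsts E M y w)"
    show ?case
    proof (rule run_For[where Inv = ?I and T = "324 * ?n ^ 2"], goal_cases)
      case 1
      show ?case using 2 by simp
    next
      case (2 y s2)
      have G2: "graph_state n k E s2" using graph_state_frame[OF G1 2(2)] by auto
      have n2: "reg s2 0 = n" "reg s2 12 = M" "arr s2 4 = arr s 4"
        using graph_stateD[OF G2] 2(2) n1 by (auto simp: frame_def)
      have y: "y < n" using 2 n1 by simp
      let ?J = "\<lambda>m s'. marked n 5 s' = S \<union> (\<Union>y\<in>S \<inter> {..<y}. \<Union>w\<in>S. firsts E M y w) \<union>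
        (if y \<in> S then \<Union>w\<in>S \<inter> {..<m}. firsts E M y w else {})"
      show ?case
      proof (rule run_For[where Inv = ?J and T = "316 * ?n ^ 1"], goal_cases)
        case 1
        show ?case using 2 by simp
      next
        case (2 w s3)
        have G3: "graph_state n k E s3" using graph_state_frame[OF G2 2(2)] by auto
        have n3: "reg s3 0 = n" "reg s3 12 = M" "arr s3 4 = arr s 4" "reg s3 5 = y" "reg s3 6 = w"
          using graph_stateD[OF G3] 2(2,3) n2 \<open>reg s2 5 = y\<close> by (auto simp: frame_def)
        have w: "w < n" using 2 n2 by simp
        have mem: "arr s3 4 y \<noteq> 0 \<longleftrightarrow> y \<in> S" "arr s3 4 w \<noteq> 0 \<longleftrightarrow> w \<in> S"
          using y w n3 by (auto simp: S_def marked_def)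
        have lt: "S \<inter> {..<Suc w} = (if w \<in> S then insert w (S \<inter> {..<w}) else S \<inter> {..<w})"
          by (auto simp: less_Suc_eq)
        show ?case
        proof (rule run_Cond[where T' = "250 * ?n ^ 1"], goal_cases)
          case 1
          have yw: "y \<in> S" "w \<in> S" using 1 mem n3 by auto
          show ?case
          proof (rule run_Seq[where U = "216 * ?n ^ 1", OF run_Assign], goal_cases)
            case 1
            let ?t = "setr 11 (val (Const 0) s3) s3"
            have G4: "graph_state n k E ?t"
              by (rule graph_state_frame[OF G3 frame_setr[of 11 "{11}" "{}"]]) auto
            \<comment> \<open>Register 11 counts all candidates passed so far, kept or not, because
              this is the quantity that \<open>firsts\<close> compares with
              \<open>M\<close>.\<close>
            let ?K = "\<lambda>m s'. reg s' 11 = card {x. x < m \<and> via E y w x} \<and>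
              marked n 5 s' = marked n 5 s3 \<union> (firsts E M y w \<inter> {..<m})"
            show ?case
            proof (rule run_For[where Inv = ?K and T = 200], goal_cases)
              case 1
              show ?case by (simp add: marked_def)
            next
              case (2 x s5)
              have G5: "graph_state n k E s5" using graph_state_frame[OF G4 2(2)] by auto
              have n5: "reg s5 12 = M" "reg s5 5 = y" "reg s5 6 = w" using 2(2) n3 by (auto simp: frame_def)
              have x: "x < n" using 2 n3 by simp
              have A: "adj s5 y x \<longleftrightarrow> (y, x) \<in> E" "adj s5 x w \<longleftrightarrow> (x, w) \<in> E"
                using graph_state_adj[OF G5] x y w by auto
              have lt': "firsts E M y w \<inter> {..<Suc x} =
                (if x \<in> firsts E M y w then insert x (firsts E M y w \<inter> {..<x}) else firsts E M y w \<inter> {..<x})"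
                by (auto simp: less_Suc_eq)
              have c: "reg s5 11 = card {x'. x' < x \<and> via E y w x'}" using 2(4) by simp
              have x_iff: "x \<in> firsts E M y w \<longleftrightarrow> via E y w x \<and> reg s5 11 < M"
                using c by (simp add: firsts_def)
              let ?s = "sem kernel_step s5"
              have s11: "reg ?s 11 = reg s5 11 + of_bool (via E y w x)"
                using 2(3) n5 A by (auto simp: kernel_step_def via_def)
              have s5: "marked n 5 ?s = (if x \<in> firsts E M y w then insert x (marked n 5 s5) else marked n 5 s5)"
                using 2(3) n5 A x unfolding x_iff by (auto simp: kernel_step_def via_def marked_def)
              show ?case
              proof (rule run_straight)
                show "?K (Suc x) ?s" unfolding s11 s5 card_less_Suc lt' using 2(4) by auto
              qed auto
            next
              case (3 s5)
              have "firsts E M y w \<inter> {..<n} = firsts E M y w" using En by blast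
              hence "marked n 5 s5 = marked n 5 s3 \<union> firsts E M y w" using 3(2) n3 by simp
              thus ?case using 2(4) yw unfolding lt by auto
            next
              case 4
              thus ?case by (simp add: marked_def)
            next
              case 10
              show ?case using n3 by simp
            qed auto
          qed auto
        next
          case 2
          hence "\<not> (y \<in> S \<and> w \<in> S)" using mem n3 by auto
          thus ?case using \<open>?J w s3\<close> by (intro run_straight) (auto simp: lt)
        qed auto
      next
        case (3 s3)
        have "S \<inter> {..<n} = S" by (auto simp: S_def marked_def)
        moreover have "S \<inter> {..<Suc y} = (if y \<in> S then insert y (S \<inter> {..<y}) else S \<inter> {..<y})"
          by (auto simp: less_Suc_eq)
        ultimately show ?case using 3(2) n2 by auto
      next
        case 4
        thus ?case by (simp add: marked_def)
      next
        case 10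
        show ?case unfolding n2 by (rule For_bound[OF order_refl]) simp_all
      qed auto
    next
      case (3 s2)
      have "S \<inter> {..<n} = S" by (auto simp: S_def marked_def)
      with 3 n1 show ?case by simp
    next
      case 4
      thus ?case by (simp add: marked_def)
    next
      case 10
      show ?case unfolding n1 by (rule For_bound[OF order_refl]) simp_all
    qed auto
  next
    case 3
    show ?case using scale_add[OF sq, of 400 100 500] by simp
  qed auto
qed

text \<open>All pairs of kernel vertices are listed, arcs or not. Prescribing a pair that is no arc
  leaves its head without an incoming arc, so no tree is found unless the head is the root, and
  \<open>tails\<close> ignores the root.\<close>

definition arc_list :: com where
  "arc_list =
     Seq (Assign 13 (Const 0))
     (For 5 0 (For 6 0 (Cond (EAnd (Arr 5 (Reg 5)) (Arr 5 (Reg 6)))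
       (Seq (ArrStore 6 (Reg 13) (Reg 5)) (Seq (ArrStore 7 (Reg 13) (Reg 6))
         (Assign 13 (Plus (Reg 13) (Const 1))))) Skip)))"

lemma syntax_arc_list [simp]:
  "wregs arc_list = {5, 6, 13}" "warrs arc_list = {6, 7}" "array_only arc_list"
  by (auto simp: arc_list_def)

lemma run_arc_list:
  assumes n: "reg s 0 = n"
  defines "V \<equiv> marked n 5 s"
  shows "run arc_list s (500 * Suc n ^ 2) (\<lambda>s'. reg s' 13 = card V * card V \<and>
    (\<lambda>i. (arr s' 6 i, arr s' 7 i)) ` {..<reg s' 13} = V \<times> V)"
  unfolding arc_list_def
proof (rule run_Seq[where V = 2 and U = "400 * Suc n ^ 2", OF run_Assign], goal_cases)
  case 1
  let ?n = "Suc n" and ?t = "setr 13 (val (Const 0) s) s"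
  let ?P = "\<lambda>X s'. reg s' 13 = card X \<and> (\<lambda>i. (arr s' 6 i, arr s' 7 i)) ` {..<reg s' 13} = X"
  have finV: "finite V" and Vn: "V \<subseteq> {..<n}" by (auto simp: V_def marked_def)
  let ?I = "\<lambda>m s'. ?P ((V \<inter> {..<m}) \<times> V) s'"
  show ?case
  proof (rule run_For[where Inv = ?I and T = "308 * ?n ^ 1"], goal_cases)
    case (2 u s1)
    have n1: "reg s1 0 = n" "arr s1 5 = arr s 5" using 2(2) n by (auto simp: frame_def)
    have u: "u < n" using 2 n by simp
    let ?X = "\<lambda>m. (V \<inter> {..<u}) \<times> V \<union> (if u \<in> V then {u} \<times> (V \<inter> {..<m}) else {})"
    show ?case
    proof (rule run_For[where Inv = "\<lambda>m. ?P (?X m)" and T = 300], goal_cases)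
      case 1
      have X: "?X 0 = (V \<inter> {..<u}) \<times> V" by simp
      show ?case unfolding X by (rule 2(4))
    next
      case (2 v s2)
      have n2: "arr s2 5 = arr s 5" "reg s2 5 = u" "reg s2 6 = v" using 2 n1 \<open>reg s1 5 = u\<close> by (auto simp: frame_def)
      have v: "v < n" using 2 n1 by simp
      have mem: "arr s2 5 u \<noteq> 0 \<longleftrightarrow> u \<in> V" "arr s2 5 v \<noteq> 0 \<longleftrightarrow> v \<in> V"
        using u v n2 by (auto simp: V_def marked_def)
      show ?case
      proof (rule run_straight)
        let ?c = "Cond (EAnd (Arr 5 (Reg 5)) (Arr 5 (Reg 6)))
          (Seq (ArrStore 6 (Reg 13) (Reg 5)) (Seq (ArrStore 7 (Reg 13) (Reg 6))
            (Assign 13 (Plus (Reg 13) (Const 1))))) Skip"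
        show "?P (?X (Suc v)) (sem ?c s2)"
        proof (cases "u \<in> V \<and> v \<in> V")
          case True
          have X: "?X (Suc v) = insert (u, v) (?X v)" using True by (auto simp: less_Suc_eq)
          have new: "(u, v) \<notin> ?X v" by auto
          have fin: "finite (?X v)" using finV by auto
          let ?m = "reg s2 13"
          have s: "reg (sem ?c s2) 13 = Suc ?m" "arr (sem ?c s2) 6 = (arr s2 6)(?m := u)"
            "arr (sem ?c s2) 7 = (arr s2 7)(?m := v)"
            using True mem n2 by auto
          have img: "(\<lambda>i. (arr (sem ?c s2) 6 i, arr (sem ?c s2) 7 i)) ` {..<Suc ?m} =
            insert (u, v) ((\<lambda>i. (arr s2 6 i, arr s2 7 i)) ` {..<?m})"
            unfolding s by (auto simp: lessThan_Suc)
          have "card (?X (Suc v)) = Suc (card (?X v))" unfolding X using fin new by (rule card_insert_disjoint)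
          thus ?thesis unfolding s(1) img conjunct2[OF 2(4)] X using conjunct1[OF 2(4)] by (metis (no_types))
        next
          case False
          have X: "?X (Suc v) = ?X v" using False by (auto simp: less_Suc_eq)
          have sem: "sem ?c s2 = s2" using False mem n2 by auto
          show ?thesis unfolding X sem by (rule 2(4))
        qed
      qed auto
    next
      case (3 s2)
      have X: "?X n = (V \<inter> {..<Suc u}) \<times> V" using Vn by (auto simp: less_Suc_eq)
      show ?case using 3(2) unfolding n1 X .
    next
      case (4 m x s')
      have t: "arr (setr 6 x s') = arr s'" "reg (setr 6 x s') 13 = reg s' 13" by simp_all
      show ?case unfolding t by (rule 4)
    next
      case 10
      show ?case unfolding n1 by simp
    qed simp_all
  next
    case (3 s1)
    have V: "V \<inter> {..<n} = V" using Vn by blast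
    have r: "reg (setr 13 (val (Const 0) s) s) 0 = n" using n by simp
    show ?case using 3(2) unfolding r V card_cartesian_product .
  next
    case 10
    have r: "reg (setr 13 (val (Const 0) s) s) 0 = n" using n by simp
    show ?case unfolding r by (rule For_bound[OF order_refl]) simp_all
  next
    case (4 m x s')
    have t: "arr (setr 5 x s') = arr s'" "reg (setr 5 x s') 13 = reg s' 13" by simp_all
    show ?case unfolding t by (rule 4)
  qed simp_all
next
  case 3
  have "Suc 0 \<le> Suc n ^ 2" by simp
  from scale_add[OF this, of 400 2 500] show ?case by simp
qed auto

section \<open>The number of selections of \<open>k\<close> candidate arcs, by repeated
  addition\<close>

definition power_loop :: com where
  "power_loop =
     Seq (Assign 14 (Const 1))
     (For 16 1 (Seq (Assign 18 (Const 0)) (Seq (For 4 13 (Assign 18 (Plus (Reg 18) (Reg 14)))) (Assign 14 (Reg 18)))))"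

lemma syntax_power_loop [simp]:
  "wregs power_loop = {4, 14, 16, 18}" "warrs power_loop = {}" "array_only power_loop"
  by (auto simp: power_loop_def)

lemma run_power_loop:
  assumes k: "reg s 1 = k" and m: "reg s 13 = m"
  shows "run power_loop s (50 * (Suc k * Suc m)) (\<lambda>s'. reg s' 14 = m ^ k)"
  unfolding power_loop_def
proof (rule run_Seq[where V = 2 and U = "48 * (Suc k * Suc m)", OF run_Assign], goal_cases)
  case 1
  show ?case
  proof (rule run_For[where Inv = "\<lambda>j s'. reg s' 14 = m ^ j" and T = "30 * Suc m"], goal_cases)
    case (2 j s1)
    have r1: "reg s1 13 = m" using 2(2) m by (auto simp: frame_def)
    show ?case
    proof (rule run_Seq[where U = "28 * Suc m", OF run_Assign], goal_cases)
      case 1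
      show ?case
      proof (rule run_Seq_frame[where U = 3, OF run_For[where Inv = "\<lambda>i s'. reg s' 18 = i * m ^ j" and T = 8
          and Q = "\<lambda>s'. reg s' 18 = m * m ^ j" and T' = "16 * Suc m"]], goal_cases)
        case (2 i s2)
        have "reg s2 14 = m ^ j" using 2(2) \<open>reg s1 14 = m ^ j\<close> by (auto simp: frame_def)
        with 2 show ?case by (intro run_Assign) auto
      next
        case (12 s2)
        thus ?case by (intro run_Assign) auto
      qed (use r1 in auto)
    qed auto
  next
    case 10
    show ?case using mult_le_mono2[of "30 * Suc m + 8" "48 * Suc m" "Suc k"] k
      by (simp add: algebra_simps)
  qed (use k in auto)
next
  case 3
  show ?case using scale_add[of 1 "Suc k * Suc m" 48 2 50] by simp
qed auto

section \<open>Searching the kernel\<close>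

text \<open>Counting up in base \<open>m\<close>: the carry reaches digit \<open>j\<close> exactly
  when \<open>m ^ j\<close> divides \<open>Suc c\<close>, and is passed on exactly when that digit
  is maximal.\<close>

lemma dvd_Suc_digit:
  fixes m j c :: nat
  assumes "m ^ j dvd Suc c"
  shows "Suc c div m ^ j mod m = (if Suc (c div m ^ j mod m) = m then 0 else Suc (c div m ^ j mod m))"
    and "m ^ Suc j dvd Suc c \<longleftrightarrow> Suc (c div m ^ j mod m) = m"
proof -
  have q: "Suc c div m ^ j = Suc (c div m ^ j)" using assms by (simp add: div_Suc dvd_eq_mod_eq_0)
  show *: "Suc c div m ^ j mod m = (if Suc (c div m ^ j mod m) = m then 0 else Suc (c div m ^ j mod m))"
    unfolding q by (rule mod_Suc)
  obtain b where b: "Suc c = m ^ j * b" using assms by blast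
  hence pos: "m ^ j > 0" by (metis mult_is_0 nat.distinct(1) neq0_conv)
  have "m ^ Suc j dvd Suc c \<longleftrightarrow> m dvd b" unfolding b power_Suc2 by (rule nat_mult_dvd_cancel1[OF pos])
  also have "\<dots> \<longleftrightarrow> Suc c div m ^ j mod m = 0" unfolding b using pos by (simp add: dvd_eq_mod_eq_0)
  also have "\<dots> \<longleftrightarrow> Suc (c div m ^ j mod m) = m" unfolding * by simp
  finally show "m ^ Suc j dvd Suc c \<longleftrightarrow> Suc (c div m ^ j mod m) = m" .
qed

lemma not_dvd_Suc_digit:
  fixes m j c :: nat
  assumes "\<not> m ^ j dvd Suc c"
  shows "Suc c div m ^ j mod m = c div m ^ j mod m" "\<not> m ^ Suc j dvd Suc c"
  using assms by (auto simp: div_Suc dvd_eq_mod_eq_0[symmetric] dest: dvd_mult_right dvd_mult_left)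

text \<open>Hence counting from 0 to \<open>m ^ k - 1\<close> runs through all selections.\<close>

lemma digits_exist:
  fixes e :: "nat \<Rightarrow> nat"
  assumes "\<And>i. i < k \<Longrightarrow> e i < m"
  shows "\<exists>c < m ^ k. \<forall>i<k. c div m ^ i mod m = e i"
  using assms
proof (induction k arbitrary: e)
  case (Suc k)
  from Suc.IH[of "\<lambda>i. e (Suc i)"] Suc.prems obtain c where
    c: "c < m ^ k" "\<And>i. i < k \<Longrightarrow> c div m ^ i mod m = e (Suc i)" by auto
  have e0: "e 0 < m" using Suc.prems by simp
  let ?c = "e 0 + m * c"
  have "?c < m * Suc c" using e0 by simp
  also have "\<dots> \<le> m * m ^ k" using c(1) by (intro mult_le_mono2) simp
  finally have "?c < m ^ Suc k" by simp
  moreover have "?c div m ^ i mod m = e i" if "i < Suc k" for i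
  proof (cases i)
    case (Suc j)
    have "?c div m ^ i = c div m ^ j"
      unfolding Suc power_Suc div_mult2_eq using e0 by simp
    thus ?thesis using c(2)[of j] that Suc by simp
  qed (use e0 in simp)
  ultimately show ?case by blast
qed simp

definition increment :: com where
  "increment = Seq (Assign 17 (Const 1))
     (For 16 1 (Cond (Reg 17)
       (Cond (Minus (Reg 13) (Plus (Arr 8 (Reg 16)) (Const 1)))
         (Seq (ArrStore 8 (Reg 16) (Plus (Arr 8 (Reg 16)) (Const 1))) (Assign 17 (Const 0)))
         (ArrStore 8 (Reg 16) (Const 0))) Skip))"

lemma syntax_increment [simp]:
  "wregs increment = {16, 17}" "warrs increment = {8}" "array_only increment"
  by (auto simp: increment_def)

lemma run_increment:
  assumes k: "reg s 1 = k" and m: "reg s 13 = m" "m > 0"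
    and d: "\<forall>j<k. arr s 8 j = c div m ^ j mod m"
  shows "run increment s (200 * Suc k) (\<lambda>s'. \<forall>j<k. arr s' 8 j = Suc c div m ^ j mod m)"
  unfolding increment_def
proof (rule run_Seq[where V = 2 and U = "158 * Suc k", OF run_Assign], goal_cases)
  case 1
  \<comment> \<open>Digits below \<open>j\<close> already belong to \<open>Suc c\<close>, the others
    still to \<open>c\<close>; register 17 is the carry into digit \<open>j\<close>.\<close>
  let ?I = "\<lambda>j s'. (\<forall>i<j. arr s' 8 i = Suc c div m ^ i mod m) \<and>
    (\<forall>i<k. j \<le> i \<longrightarrow> arr s' 8 i = c div m ^ i mod m) \<and> (reg s' 17 \<noteq> 0 \<longleftrightarrow> m ^ j dvd Suc c)"
  show ?case
  proof (rule run_For[where Inv = ?I and T = 150], goal_cases)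
    case (2 j s1)
    have r: "reg s1 13 = m" "j < k" using 2 m k by (auto simp: frame_def)
    have dj: "arr s1 8 j = c div m ^ j mod m" using 2(4) r by simp
    have "arr s1 8 j < m" using dj m by simp
    hence lt: "m - Suc (arr s1 8 j) = 0 \<longleftrightarrow> Suc (arr s1 8 j) = m" by linarith
    let ?c = "Cond (Reg 17)
       (Cond (Minus (Reg 13) (Plus (Arr 8 (Reg 16)) (Const 1)))
         (Seq (ArrStore 8 (Reg 16) (Plus (Arr 8 (Reg 16)) (Const 1))) (Assign 17 (Const 0)))
         (ArrStore 8 (Reg 16) (Const 0))) Skip"
    show ?case
    proof (rule run_straight)
      have s: "arr (sem ?c s1) 8 = (arr s1 8)(j := Suc c div m ^ j mod m)"
        "reg (sem ?c s1) 17 \<noteq> 0 \<longleftrightarrow> m ^ Suc j dvd Suc c"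
      proof (atomize(full), cases "m ^ j dvd Suc c")
        case True
        thus "arr (sem ?c s1) 8 = (arr s1 8)(j := Suc c div m ^ j mod m) \<and>
            (reg (sem ?c s1) 17 \<noteq> 0 \<longleftrightarrow> m ^ Suc j dvd Suc c)"
          using 2(3,4) r lt dj unfolding dvd_Suc_digit[OF True] by (simp del: power_Suc)
      next
        case False
        have "sem ?c s1 = s1" using False 2(4) by simp
        thus "arr (sem ?c s1) 8 = (arr s1 8)(j := Suc c div m ^ j mod m) \<and>
            (reg (sem ?c s1) 17 \<noteq> 0 \<longleftrightarrow> m ^ Suc j dvd Suc c)"
          using False 2(4) dj not_dvd_Suc_digit[OF False] by (simp del: power_Suc add: fun_eq_iff)
      qed
      show "?I (Suc j) (sem ?c s1)"
        unfolding s using 2(4) by (auto simp: less_Suc_eq simp del: power_Suc)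
    qed auto
  qed (use k d in auto)
qed auto

text \<open>
  The function \<open>d\<close> selects \<open>k\<close> arcs from a list of arcs with tails \<open>L\<close> and heads \<open>R\<close>. Two arcs
  with the same head may be selected, in which case only one of them is prescribed.
\<close>

definition prescribes :: "nat \<Rightarrow> nat \<Rightarrow> (nat \<Rightarrow> nat) \<Rightarrow> (nat \<Rightarrow> nat) \<Rightarrow> (nat \<Rightarrow> nat) \<Rightarrow> (nat \<Rightarrow> nat) \<Rightarrow> bool" where
  "prescribes n k L R d h \<longleftrightarrow> (\<forall>v<n. h v = 0 \<and> (\<forall>i<k. R (d i) \<noteq> v) \<or>
     (\<exists>i<k. R (d i) = v \<and> h v = Suc (L (d i))))"

lemma prescribes_cong:
  "\<forall>j<k. d j = d' j \<Longrightarrow> prescribes n k L R d h \<longleftrightarrow> prescribes n k L R d' h"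
  by (simp add: prescribes_def cong: conj_cong)

definition prescribe :: com where
  "prescribe =
     Seq (For 4 0 (ArrStore 1 (Reg 4) (Const 0)))
     (For 16 1 (ArrStore 1 (Arr 7 (Arr 8 (Reg 16))) (Plus (Arr 6 (Arr 8 (Reg 16))) (Const 1))))"

lemma syntax_prescribe [simp]:
  "wregs prescribe = {4, 16}" "warrs prescribe = {1}" "array_only prescribe"
  by (auto simp: prescribe_def)

lemma run_prescribe:
  assumes n: "reg s 0 = n" and k: "reg s 1 = k"
  shows "run prescribe s (33 * Suc n + 3100 * Suc k)
    (\<lambda>s'. prescribes n k (arr s 6) (arr s 7) (arr s 8) (arr s' 1))"
  unfolding prescribe_def
proof (rule run_Seq_frame[where U = "3100 * Suc k", OF run_fill], goal_cases)
  case (5 s1)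
  have s1: "arr s1 6 = arr s 6" "arr s1 7 = arr s 7" "arr s1 8 = arr s 8" "reg s1 1 = k"
    using 5(2) k by (auto simp: frame_def)
  show ?case
  proof (rule run_For[where Inv = "\<lambda>j s'. prescribes n j (arr s 6) (arr s 7) (arr s 8) (arr s' 1)" and T = 3090], goal_cases)
    case 1
    show ?case using 5(1) n by (simp add: prescribes_def)
  next
    case (2 j s2)
    have "arr s2 6 = arr s 6" "arr s2 7 = arr s 7" "arr s2 8 = arr s 8"
      using 2(2) s1 by (auto simp: frame_def)
    with 2(3,4) show ?case by (intro run_straight) (auto simp: prescribes_def less_Suc_eq)
  qed (use s1 in auto)
qed (use n in auto)

text \<open>Distinct heads rule out clashes, so \<open>h\<close> codes the restriction of
  \<open>p\<close> to \<open>H\<close>. The tree then obeys its own prescription, and injectivity of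
  \<open>p\<close> on \<open>H\<close> yields \<open>k\<close> tails.\<close>

lemma prescribes_distinct:
  assumes P: "prescribes n k L R d h" and t: "btree n E r p e"
    and H: "H \<subseteq> {..<n} - {r}" "card H = k" "inj_on p H"
    and f: "bij_betw f {..<k} H" and LR: "\<And>i. i < k \<Longrightarrow> L (d i) = p (f i) \<and> R (d i) = f i"
  shows "btree n (allowed E h) r p e" "k \<le> card (tails n r h)"
proof -
  have fH: "f i \<in> H" if "i < k" for i using f that by (auto simp: bij_betw_def)
  have h: "h v = (if v \<in> H then Suc (p v) else 0)" if "v < n" for v
  proof (cases "v \<in> H")
    case True
    with f obtain i where "i < k" "f i = v" by (auto simp: bij_betw_def)
    with P that LR have "h v \<noteq> 0 \<and> (\<exists>j<k. f j = v \<and> h v = Suc (p (f j)))"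
      unfolding prescribes_def by (metis nat.distinct(1))
    thus ?thesis using True by auto
  next
    case False
    with P that LR fH show ?thesis unfolding prescribes_def by auto
  qed
  show "btree n (allowed E h) r p e"
  proof (rule btreeI[OF btreeD(1)[OF t]])
    fix v assume "v < n" "v \<noteq> r"
    thus "p v < n \<and> (p v, v) \<in> allowed E h \<and> e (p v) < e v"
      using btreeD(2-4)[OF t, of v] h[of v] by (auto simp: allowed_def)
  qed
  have "p ` H \<subseteq> tails n r h"
  proof (rule image_subsetI)
    fix v assume "v \<in> H"
    moreover from this H(1) have "v < n" "v \<noteq> r" by auto
    ultimately show "p v \<in> tails n r h" using h[of v] unfolding tails_def by auto
  qed
  from card_mono[OF finite_tails this] show "k \<le> card (tails n r h)"
    using H by (simp add: card_image)
qed

lemma checked_frame: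
  "checked n k E r s \<Longrightarrow> frame X A s s' \<Longrightarrow> X \<inter> {9, 10} = {} \<Longrightarrow> A \<inter> {1, 2, 3} = {} \<Longrightarrow> checked n k E r s'"
proof -
  assume c: "checked n k E r s" and f: "frame X A s s'" "X \<inter> {9, 10} = {}" "A \<inter> {1, 2, 3} = {}"
  have "arr s' 1 = arr s 1" "arr s' 2 = arr s 2" "arr s' 3 = arr s 3" "reg s' 9 = reg s 9" "reg s' 10 = reg s 10"
    using f by (auto simp: frame_def)
  thus ?thesis using c unfolding checked_def by simp
qed

text \<open>The loop has no early exit: after a success the remaining rounds only increment, and the
  tree found stays in array 2.\<close>

definition search :: com where
  "search =
     Seq (For 16 1 (ArrStore 8 (Reg 16) (Const 0)))
     (For 15 14 (Seq (Cond (Reg 9) Skip (Seq prescribe check)) increment))"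

lemma syntax_search [simp]:
  "wregs search = {4, 5, 6, 7, 8, 9, 10, 15, 16, 17}" "warrs search = {1, 2, 3, 8}" "array_only search"
  by (auto simp: search_def)

lemma run_search:
  assumes G: "graph_state n k E s" and r: "reg s 3 = r" "r < n" and k: "k > 0"
    and m: "reg s 13 = m" "reg s 14 = m ^ k" and found: "reg s 9 = 0"
  defines "P \<equiv> (\<lambda>i. (arr s 6 i, arr s 7 i)) ` {..<m}"
  shows "run search s (6000 * (Suc (m ^ k) * (Suc n ^ 3 * Suc k))) (\<lambda>s'.
    (reg s' 9 \<noteq> 0 \<longrightarrow> checked n k E r s') \<and>
    (reg s' 9 = 0 \<longrightarrow> \<not> (\<exists>p d H. btree n E r p d \<and> H \<subseteq> {..<n} - {r} \<and> card H = k \<and> inj_on p H \<and>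
      (\<forall>v\<in>H. (p v, v) \<in> P))))"
proof -
  let ?L = "arr s 6" and ?R = "arr s 7"
  define X where "X = Suc n ^ 3 * Suc k"
  have one: "1 \<le> Suc n ^ 3" by simp
  have X2: "Suc k \<le> X" using mult_le_mono1[OF one, of "Suc k"] by (simp only: X_def mult_1)
  have "Suc n ^ 3 * 1 \<le> X" unfolding X_def by (rule mult_le_mono2) simp
  hence X: "Suc n ^ 3 \<le> X" "Suc k \<le> X" "1 \<le> X" using X2 by simp_all
  have "Suc n \<le> Suc n ^ 3" by (rule self_le_power) auto
  with X(1) have Xn: "Suc n \<le> X" by linarith
  \<comment> \<open>What a failed check proves of a prescription, by \<open>checked_tails\<close>.
    The invariant asserts some bad \<open>h\<close> for each number tried, because a selection with
    a repeated head does not determine \<open>h\<close>.\<close>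
  define bad where "bad = (\<lambda>h. \<not> (\<exists>p d. btree n (allowed E h) r p d \<and> k \<le> card (tails n r h)))"
  let ?dig = "\<lambda>c j. c div m ^ j mod m"
  let ?I = "\<lambda>c s'. (\<forall>j<k. arr s' 8 j = ?dig c j) \<and> (reg s' 9 \<noteq> 0 \<longrightarrow> checked n k E r s') \<and>
    (reg s' 9 = 0 \<longrightarrow> (\<forall>c'<c. \<exists>h. prescribes n k ?L ?R (?dig c') h \<and> bad h))"
  have "run search s (6000 * (Suc (m ^ k) * X)) (?I (m ^ k))"
    unfolding search_def
  proof (rule run_Seq_frame[where U = "5960 * (Suc (m ^ k) * X)", OF run_fill], goal_cases)
    case (5 s1)
    have G1: "graph_state n k E s1" using graph_state_frame[OF G 5(2)] by auto
    have s1: "reg s1 3 = r" "reg s1 13 = m" "reg s1 14 = m ^ k" "reg s1 9 = 0" "arr s1 6 = ?L" "arr s1 7 = ?R"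
      "\<forall>j<k. arr s1 8 j = 0" "reg s1 1 = k"
      using 5 r m found graph_stateD[OF G] by (auto simp: frame_def)
    show ?case
    proof (rule run_For[where Inv = ?I and T = "5900 * X"], goal_cases)
      case 1
      show ?case using s1 by simp
    next
      case (2 c s2)
      have G2: "graph_state n k E s2" using graph_state_frame[OF G1 2(2)] by auto
      have s2: "reg s2 3 = r" "reg s2 13 = m" "reg s2 14 = m ^ k" "arr s2 6 = ?L" "arr s2 7 = ?R" "reg s2 1 = k"
        using 2(2) s1 by (auto simp: frame_def)
      have c: "c < m ^ k" using 2(1) s1 by simp
      hence mpos: "m > 0" using k by (cases "m = 0") (simp_all add: zero_power)
      let ?J = "\<lambda>s'. (reg s' 9 \<noteq> 0 \<longrightarrow> checked n k E r s') \<and>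
        (reg s' 9 = 0 \<longrightarrow> (\<forall>c'<Suc c. \<exists>h. prescribes n k ?L ?R (?dig c') h \<and> bad h))"
      show ?case
      proof (rule run_Seq_frame[where V = "5200 * X" and U = "200 * Suc k" and P = ?J], goal_cases)
        case 1
        show ?case
        proof (rule run_Cond[where T' = "5100 * X"], goal_cases)
          case 1
          thus ?case using 2(4) X by (intro run_straight) auto
        next
          case 2
          have f0: "reg s2 9 = 0" using 2 by simp
          have IH: "\<forall>c'<c. \<exists>h. prescribes n k ?L ?R (?dig c') h \<and> bad h" using \<open>?I c s2\<close> f0 by blast
          show ?case
          proof (rule run_Seq_frame[where U = "1700 * Suc n ^ 3", OF run_prescribe[OF graph_stateD(1,2)[OF G2]]], goal_cases)
            case (2 s3)
            have G3: "graph_state n k E s3" using graph_state_frame[OF G2 2(2)] by auto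
            have r3: "reg s3 3 = r" using 2(2) s2 by (auto simp: frame_def)
            let ?h = "arr s3 1"
            have "prescribes n k ?L ?R (?dig c) ?h"
              using 2(1) prescribes_cong[of k "arr s2 8" "?dig c"] \<open>?I c s2\<close> s2 by simp
            note pre = this
            show ?case
            proof (rule run_frame[where R = "wregs check" and A = "warrs check"],
                rule run_mono[OF run_check[OF G3 r3 r(2)] order_refl], rule impI)
              fix s4 assume s4: "checked n k E r s4" "frame (wregs check) (warrs check) s3 s4"
              have h4: "arr s4 1 = ?h" using s4(2) by (auto simp: frame_def)
              have "bad ?h" if "reg s4 9 = 0"
                unfolding bad_def using checked_tails[OF s4(1)] that h4 by auto
              thus "?J s4" using s4(1) IH pre by (auto simp: less_Suc_eq)
            qed auto
          next
            case 3
            have "33 * a + 3100 * b + 1700 * c \<le> 5100 * X" if "a \<le> X" "b \<le> X" "c \<le> X" for a b c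
              using that by simp
            from this[OF Xn X(2,1)] show ?case .
          qed auto
        next
          case 3
          show ?case using X by simp
        qed
      next
        case (3 s3)
        let ?c = "Cond (Reg 9) Skip (Seq prescribe check)"
        have s3: "reg s3 1 = k" "reg s3 13 = m" "arr s3 8 = arr s2 8"
          using 3(2) s2 by (auto simp: frame_def)
        have d: "\<forall>j<k. arr s3 8 j = ?dig c j" using s3 2(4) by simp
        show ?case
        proof (rule run_frame[where R = "wregs increment" and A = "warrs increment"],
            rule run_mono[OF run_increment[OF s3(1,2) mpos d] order_refl], rule impI)
          fix s4 assume s4: "\<forall>j<k. arr s4 8 j = ?dig (Suc c) j" "frame (wregs increment) (warrs increment) s3 s4"
          have "reg s4 9 = reg s3 9" using s4(2) by (auto simp: frame_def)
          moreover have "checked n k E r s4" if "checked n k E r s3"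
            using checked_frame[OF that s4(2)] by auto
          ultimately show "?I (Suc c) s4" using s4(1) 3(1) by auto
        qed auto
      next
        case 4
        show ?case using X(2) by simp
      qed auto
    next
      case (3 s2)
      show ?case using 3(2) unfolding s1(3) .
    next
      case 4
      thus ?case by (auto simp: checked_def)
    next
      case 10
      show ?case unfolding s1 using X mult_le_mono2[of "5900 * X + 8" "5960 * X" "Suc (m ^ k)"]
        by (simp only: mult.left_commute)
    qed auto
  next
    case 6
    have "Suc k \<le> Suc (m ^ k) * X" using X(2) mult_le_mono[of 1 "Suc (m ^ k)" "Suc k" X] by simp
    moreover have "reg s 1 = k" using graph_stateD[OF G] by simp
    ultimately show ?case using scale_add[of "Suc k" "Suc (m ^ k) * X" 5960 33 6000] by simp
  qed auto
  thus ?thesis unfolding X_def[symmetric]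
  proof (rule run_mono[OF _ order_refl], intro conjI impI notI; elim conjE)
    fix s' assume f: "reg s' 9 = 0" and
      c: "reg s' 9 = 0 \<longrightarrow> (\<forall>c'<m ^ k. \<exists>h. prescribes n k ?L ?R (?dig c') h \<and> bad h)" and
      ex: "\<exists>p d H. btree n E r p d \<and> H \<subseteq> {..<n} - {r} \<and> card H = k \<and> inj_on p H \<and> (\<forall>v\<in>H. (p v, v) \<in> P)"
    from ex obtain p d H where t: "btree n E r p d" and H: "H \<subseteq> {..<n} - {r}" "card H = k" "inj_on p H"
      and HP: "\<forall>v\<in>H. (p v, v) \<in> P" by blast
    have "finite H" using H(1) finite_subset by blast
    from ex_bij_betw_nat_finite[OF this] H(2) obtain f where fb: "bij_betw f {..<k} H"
      by (auto simp: atLeast0LessThan)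
    have "\<forall>i. \<exists>e. i < k \<longrightarrow> e < m \<and> ?L e = p (f i) \<and> ?R e = f i"
    proof
      fix i
      show "\<exists>e. i < k \<longrightarrow> e < m \<and> ?L e = p (f i) \<and> ?R e = f i"
      proof (cases "i < k")
        case True
        hence "f i \<in> H" using fb by (auto simp: bij_betw_def)
        with HP have "(p (f i), f i) \<in> P" by blast
        then obtain e where "e < m" "?L e = p (f i)" "?R e = f i" by (auto simp: P_def)
        thus ?thesis by blast
      qed simp
    qed
    then obtain e where e: "\<And>i. i < k \<Longrightarrow> e i < m \<and> ?L (e i) = p (f i) \<and> ?R (e i) = f i" by metis
    from digits_exist[of k e m] e obtain c' where c': "c' < m ^ k" "\<forall>i<k. ?dig c' i = e i" by auto
    from c f c'(1) obtain h where h: "prescribes n k ?L ?R (?dig c') h" "bad h" by blast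
    have "btree n (allowed E h) r p d" "k \<le> card (tails n r h)"
      using prescribes_distinct[OF h(1) t H fb] e c'(2) by auto
    thus False using h(2) unfolding bad_def by blast
  qed auto
qed

text \<open>One child is taken for each of \<open>k\<close> internal vertices; the children differ
  because their parents do.\<close>

lemma choose_children:
  assumes "k \<le> card (internals n r p)"
  shows "\<exists>H. H \<subseteq> {..<n} - {r} \<and> card H = k \<and> inj_on p H"
proof -
  from assms obtain X where X: "X \<subseteq> internals n r p" "card X = k" by (rule obtain_subset_with_card_n)
  then obtain H where "H \<subseteq> {..<n} - {r}" "X = p ` H" "inj_on p H"
    unfolding internals_def by (metis subset_image_inj)
  with X(2) show ?thesis by (intro exI[of _ H]) (auto simp: card_image)
qed

definition kernel_set :: "(nat \<times> nat) set \<Rightarrow> nat \<Rightarrow> nat set \<Rightarrow> nat set" where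
  "kernel_set E M S = S \<union> (\<Union>y\<in>S. \<Union>w\<in>S. firsts E M y w)"

text \<open>A vertex was left out only if \<open>firsts\<close> was full for its pair, so the
  vertices kept for that pair are the supply that \<open>exchange\<close> asks for.\<close>

lemma kernel_complete:
  assumes E: "E \<subseteq> {..<n} \<times> {..<n}" and S: "S \<subseteq> {..<n}" "r \<in> S"
    and cover: "\<forall>(u, v) \<in> E. u \<in> S \<or> v \<in> S" and M: "2 * k + 2 * card S < M"
    and t: "btree n E r p d" and k: "k \<le> card (internals n r p)"
  shows "\<exists>p d H. btree n E r p d \<and> H \<subseteq> {..<n} - {r} \<and> card H = k \<and> inj_on p H \<and>
    (\<forall>v\<in>H. (p v, v) \<in> kernel_set E M S \<times> kernel_set E M S)"
proof -
  let ?V = "kernel_set E M S"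
  from choose_children[OF k] obtain H where H: "H \<subseteq> {..<n} - {r}" "card H = k" "inj_on p H" by blast
  have sub: "firsts E M y w \<subseteq> {..<n}" for y w using E by (auto simp: firsts_def via_def)
  have V: "?V \<subseteq> {..<n}" unfolding kernel_set_def using S(1) sub by blast
  have "\<exists>p d H. btree n E r p d \<and> H \<subseteq> {..<n} - {r} \<and> card H = k \<and> inj_on p H \<and> H \<union> p ` H \<subseteq> ?V"
  proof (rule exchange[OF E _ _ S(2) _ V _ t H])
    show "S \<subseteq> ?V" by (auto simp: kernel_set_def)
    show "finite S" using S(1) finite_subset by blast
    show "u \<in> S \<or> v \<in> S" if "(u, v) \<in> E" for u v using cover that by blast
    fix y w x assume *: "y \<in> S" "w \<in> S" "via E y w x" "x \<notin> ?V"
    have "x \<notin> firsts E M y w" using * by (auto simp: kernel_set_def)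
    from firsts_full[OF *(3) this] have "M \<le> card (firsts E M y w)" .
    also have "\<dots> \<le> card {x \<in> ?V. via E y w x}"
      using *(1,2) finite_subset[OF V] by (intro card_mono) (auto simp: kernel_set_def firsts_def)
    finally show "2 * k + 2 * card S < card {x \<in> ?V. via E y w x}" using M by simp
  qed
  thus ?thesis by blast
qed

text \<open>There are at most \<open>3 * k\<close> vertices in \<open>S\<close>, and each of the
  \<open>9 * k^2\<close> pairs adds at most \<open>8 * k\<close>; finally
  \<open>3 * k + 72 * k^3 <= 75 * k^3\<close>.\<close>

lemma card_kernel_set:
  assumes S: "finite S" "card S \<le> 3 * k" and k: "k > 0"
  shows "card (kernel_set E (8 * k) S) \<le> 75 * k ^ 3"
proof -
  let ?F = "\<lambda>y w. firsts E (8 * k) y w"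
  have 1: "card (\<Union>w\<in>S. ?F y w) \<le> 3 * k * (8 * k)" for y
  proof -
    have "card (\<Union>w\<in>S. ?F y w) \<le> (\<Sum>w\<in>S. card (?F y w))" using S(1) by (rule card_UN_le)
    also have "\<dots> \<le> (\<Sum>w\<in>S. 8 * k)" using card_firsts by (intro sum_mono) blast
    also have "\<dots> \<le> 3 * k * (8 * k)" using S(2) by (simp add: mult_le_mono1)
    finally show ?thesis .
  qed
  have "card (\<Union>y\<in>S. \<Union>w\<in>S. ?F y w) \<le> (\<Sum>y\<in>S. card (\<Union>w\<in>S. ?F y w))" using S(1) by (rule card_UN_le)
  also have "\<dots> \<le> (\<Sum>y\<in>S. 3 * k * (8 * k))" using 1 by (intro sum_mono)
  also have "\<dots> = card S * (3 * k * (8 * k))" by simp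
  also have "\<dots> \<le> 3 * k * (3 * k * (8 * k))" using S(2) by (intro mult_le_mono1)
  finally have "card (\<Union>y\<in>S. \<Union>w\<in>S. ?F y w) \<le> 72 * k ^ 3" by (simp add: power3_eq_cube)
  moreover have "card (kernel_set E (8 * k) S) \<le> card S + card (\<Union>y\<in>S. \<Union>w\<in>S. ?F y w)"
    unfolding kernel_set_def by (rule card_Un_le)
  moreover have "k \<le> k ^ 3" using k by (intro self_le_power) auto
  ultimately show ?thesis using S(2) by linarith
qed

section \<open>The program\<close>

definition try_root :: com where
  "try_root =
     Seq (For 4 0 (ArrStore 1 (Reg 4) (Const 0)))
     (Seq check
     (Cond (EAnd (Reg 10) (ENot (Reg 9)))
       (Seq cover (Seq check (Cond (Reg 9) Skip
         (Seq kernel (Seq arc_list (Seq power_loop search))))))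
       Skip))"

lemma syntax_try_root [simp]:
  "wregs try_root = {4, 5, 6, 7, 8, 9, 10, 11, 13, 14, 15, 16, 17, 18}"
  "warrs try_root = {1, 2, 3, 4, 5, 6, 7, 8}" "array_only try_root"
  by (auto simp: try_root_def)

definition num_arcs :: "nat \<Rightarrow> nat" where
  "num_arcs k = (75 * k ^ 3) ^ 2"

text \<open>A common bound for the last two phases: \<open>(k + 1) * (m + 1)\<close> for computing
  \<open>m ^ k\<close>, and \<open>(k + 1) * (m ^ k + 1)\<close> for the search, apart from the
  powers of \<open>n\<close>.\<close>

definition search_cost :: "nat \<Rightarrow> nat" where
  "search_cost k = Suc k * Suc (num_arcs k) * Suc (num_arcs k ^ k)"

lemma run_try_root:
  assumes G: "graph_state n k E s" and r: "reg s 3 = r" "r < n" and k: "k > 0" and M: "reg s 12 = 8 * k"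
  shows "run try_root s (20000 * (Suc n ^ 3 * search_cost k)) (\<lambda>s'.
    (reg s' 9 \<noteq> 0 \<longrightarrow> checked n k E r s') \<and>
    (reg s' 9 = 0 \<longrightarrow> \<not> (\<exists>p d. btree n E r p d \<and> k \<le> card (internals n r p))))"
proof -
  define X where "X = Suc n ^ 3 * search_cost k"
  define Q where "Q = (\<lambda>s'. (reg s' 9 \<noteq> 0 \<longrightarrow> checked n k E r s') \<and>
    (reg s' 9 = 0 \<longrightarrow> \<not> (\<exists>p d. btree n E r p d \<and> k \<le> card (internals n r p))))"
  have c1: "1 \<le> search_cost k" by (simp add: search_cost_def)
  have X3: "Suc n ^ 3 \<le> X" unfolding X_def using mult_le_mono2[OF c1, of "Suc n ^ 3"] by (simp only: mult_1_right)
  have X2: "Suc n ^ 2 \<le> X" by (rule le_trans[OF power_increasing X3]) auto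
  have X1: "Suc n \<le> X" by (rule le_trans[OF self_le_power X3]) auto
  have X0: "1 \<le> X" using X1 by simp
  show ?thesis unfolding X_def[symmetric] Q_def[symmetric] try_root_def
  proof (rule run_Seq_frame[where U = "19900 * X", OF run_fill], goal_cases)
    case (5 s1)
    have G1: "graph_state n k E s1" using graph_state_frame[OF G 5(2)] by auto
    have s1: "reg s1 3 = r" "reg s1 12 = 8 * k" "\<forall>v<n. arr s1 1 v = 0"
      using 5 r M graph_stateD[OF G] by (auto simp: frame_def)
    show ?case
    proof (rule run_Seq_frame[where U = "18000 * X", OF run_check[OF G1 s1(1) r(2)]], goal_cases)
      case (2 s2)
      have G2: "graph_state n k E s2" using graph_state_frame[OF G1 2(2)] by auto
      have s2: "reg s2 3 = r" "reg s2 12 = 8 * k" and h2: "\<And>v. v < n \<Longrightarrow> arr s2 1 v = 0"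
        using 2(2) s1 by (auto simp: frame_def)
      note C2 = 2(1)
      have En: "E \<subseteq> {..<n} \<times> {..<n}" using graph_stateD(3)[OF G] .
      \<comment> \<open>The prescription is empty, so the first check decides whether any branching
        starts at \<open>r\<close>.\<close>
      have allE: "allowed E (arr s2 1) = E" using En h2 by (auto simp: allowed_def)
      let ?p = "\<lambda>v. arr s2 2 v - 1"
      show ?case
      proof (rule run_Cond[where T' = "17900 * X"], goal_cases)
        case 1
        have found: "reg s2 9 = 0" "reg s2 10 \<noteq> 0" using 1 by auto
        then obtain d2 where t2: "btree n E r ?p d2" and int: "\<forall>u<n. arr s2 3 u \<noteq> 0 \<longleftrightarrow> u \<in> internals n r ?p"
          and few: "card (internals n r ?p) < k"
          using C2 unfolding checked_def Let_def allE by (auto simp: not_le)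
        have I2: "marked n 3 s2 = internals n r ?p"
          using int internals_subset[OF t2] by (auto simp: marked_def)
        show ?case
        proof (rule run_Seq_frame[where U = "17400 * X", OF run_cover[OF G2 s2(1) r(2) h2]], goal_cases)
          case (3 s3)
          let ?S = "marked n 4 s3"
          have G3: "graph_state n k E s3" using graph_state_frame[OF G2 3(2)] by auto
          have s3: "reg s3 3 = r" "reg s3 12 = 8 * k" using 3(2) s2 by (auto simp: frame_def)
          have mat: "matching n E (insert r (internals n r ?p)) (arr s3 1) ?S"
            and cov: "\<forall>(u, v) \<in> E. u \<in> ?S \<or> v \<in> ?S" using 3(1) unfolding I2 by auto
          show ?case
          proof (rule run_Seq_frame[where U = "15000 * X", OF run_check[OF G3 s3(1) r(2)]], goal_cases)
            case (2 s4)
            have G4: "graph_state n k E s4" using graph_state_frame[OF G3 2(2)] by auto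
            have s4: "reg s4 3 = r" "reg s4 12 = 8 * k" "arr s4 1 = arr s3 1" "arr s4 4 = arr s3 4"
              using 2(2) s3 by (auto simp: frame_def)
            have S4: "marked n 4 s4 = ?S" using s4(4) by (simp add: marked_def)
            note C4 = 2(1)
            show ?case
            proof (rule run_Cond[where T' = "14000 * X"], goal_cases)
              case 1
              thus ?case using C4 X0 by (intro run_straight) (auto simp: Q_def)
            next
              case 2
              have f4: "reg s4 9 = 0" using 2 by simp
              \<comment> \<open>The matching arcs can all be made tree arcs, so with
                \<open>k\<close> of them this check would have set register 9.\<close>
              from matching_btree[OF mat t2 refl] obtain p4 d4 where "btree n (allowed E (arr s4 1)) r p4 d4"
                unfolding s4(3) by blast
              from checked_tails[OF C4 this] f4 have tails: "card (tails n r (arr s3 1)) < k"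
                unfolding s4(3) by (meson not_le)
              have "card ?S \<le> card (insert r (internals n r ?p)) + 2 * card (tails n r (arr s3 1))"
                by (rule matching_card[OF mat]) auto
              moreover have "card (insert r (internals n r ?p)) \<le> Suc (card (internals n r ?p))"
                by (simp add: card_insert_if)
              \<comment> \<open>At most \<open>k\<close> for the internal vertices and the root, at
                most \<open>2 * (k - 1)\<close> for the ends of the matching.\<close>
              ultimately have Sk: "card ?S + 2 \<le> 3 * k" using few tails by linarith
              have S: "?S \<subseteq> {..<n}" "finite ?S" by (auto simp: marked_def)
              have rS: "r \<in> ?S" using mat by (auto simp: matching_def)
              let ?V = "kernel_set E (8 * k) ?S"
              define m where "m = card ?V * card ?V"
              have "card ?V \<le> 75 * k ^ 3" using S(2) Sk k by (intro card_kernel_set) auto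
              hence m: "m \<le> num_arcs k" unfolding m_def num_arcs_def power2_eq_square by (intro mult_le_mono)
              have mk: "m ^ k \<le> num_arcs k ^ k" using m by (rule power_mono) simp
              have b1: "Suc k * Suc m \<le> X"
              proof -
                have "1 * (Suc k * Suc m * 1) \<le> Suc n ^ 3 * (Suc k * Suc (num_arcs k) * Suc (num_arcs k ^ k))"
                  using m by (intro mult_le_mono) auto
                thus ?thesis by (simp only: X_def search_cost_def mult_1 mult_1_right)
              qed
              have b2: "Suc (m ^ k) * (Suc n ^ 3 * Suc k) \<le> X"
              proof -
                have "Suc n ^ 3 * (Suc k * 1 * Suc (m ^ k)) \<le> Suc n ^ 3 * (Suc k * Suc (num_arcs k) * Suc (num_arcs k ^ k))"
                  using mk by (intro mult_le_mono) auto
                thus ?thesis by (simp only: X_def search_cost_def mult_1_right mult.commute mult.left_commute)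
              qed
              show ?case
              proof (rule run_Seq_frame[where U = "12000 * X", OF run_kernel[OF G4]], goal_cases)
                case (2 s5)
                have G5: "graph_state n k E s5" using graph_state_frame[OF G4 2(2)] by auto
                have s5: "reg s5 3 = r" "reg s5 9 = 0" using 2(2) s4 f4 by (auto simp: frame_def)
                have V: "marked n 5 s5 = ?V" using 2(1) unfolding S4 s4(2) kernel_set_def .
                show ?case
                proof (rule run_Seq_frame[where U = "10000 * X", OF run_arc_list[OF graph_stateD(1)[OF G5]]], goal_cases)
                  case (2 s6)
                  have G6: "graph_state n k E s6" using graph_state_frame[OF G5 2(2)] by auto
                  have s6: "reg s6 3 = r" "reg s6 9 = 0" using 2(2) s5 by (auto simp: frame_def)
                  have m6: "reg s6 13 = m" using conjunct1[OF 2(1)] unfolding V m_def .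
                  have P6: "(\<lambda>i. (arr s6 6 i, arr s6 7 i)) ` {..<m} = ?V \<times> ?V"
                    using conjunct2[OF 2(1)] unfolding m6 V .
                  show ?case
                  proof (rule run_Seq_frame[where U = "6000 * (Suc (m ^ k) * (Suc n ^ 3 * Suc k))",
                      OF run_power_loop[OF graph_stateD(2)[OF G6] m6]], goal_cases)
                    case (2 s7)
                    have G7: "graph_state n k E s7" using graph_state_frame[OF G6 2(2)] by auto
                    have s7: "reg s7 3 = r" "reg s7 9 = 0" "reg s7 13 = m" "arr s7 6 = arr s6 6" "arr s7 7 = arr s6 7"
                      using 2(2) s6 m6 by (auto simp: frame_def)
                    show ?case
                    proof (rule run_mono[OF run_search[OF G7 s7(1) r(2) k s7(3) 2(1) s7(2)] order_refl])
                      fix s'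
                      assume s': "(reg s' 9 \<noteq> 0 \<longrightarrow> checked n k E r s') \<and>
                        (reg s' 9 = 0 \<longrightarrow> \<not> (\<exists>p d H. btree n E r p d \<and> H \<subseteq> {..<n} - {r} \<and> card H = k \<and> inj_on p H \<and>
                        (\<forall>v\<in>H. (p v, v) \<in> (\<lambda>i. (arr s7 6 i, arr s7 7 i)) ` {..<m})))"
                      have "2 * k + 2 * card ?S < 8 * k" using Sk by simp
                      from kernel_complete[OF En S(1) rS cov this] s' show "Q s'"
                        unfolding Q_def s7(4,5) P6 by blast
                    qed
                  next
                    case 3
                    have "50 * a + 6000 * b \<le> 10000 * X" if "a \<le> X" "b \<le> X" for a b using that by simp
                    from this[OF b1 b2] show ?case .
                  qed auto
                next
                  case 3
                  show ?case using scale_add[OF X2, of 10000 500 12000] by simp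
                qed auto
              next
                case 3
                show ?case using scale_add[OF X3, of 12000 500 14000] by simp
              qed auto
            next
              case 3
              show ?case using X0 by simp
            qed
          next
            case 3
            show ?case using scale_add[OF X3, of 15000 1700 17400] by simp
          qed auto
        next
          case 4
          show ?case using scale_add[OF X2, of 17400 500 17900] by simp
        qed auto
      next
        case 2
        \<comment> \<open>Either the first tree is already a solution, or no tree starts at
          \<open>r\<close> at all.\<close>
        hence *: "reg s2 9 = 0 \<Longrightarrow> reg s2 10 = 0" by auto
        have "Q s2" unfolding Q_def
          using C2 * unfolding checked_def Let_def allE by (cases "reg s2 9 = 0") (auto simp: checked_def Let_def allE)
        thus ?case using X0 by (intro run_straight) auto
      next
        case 3
        show ?case using X0 by simp
      qed
    next
      case 3
      show ?case using scale_add[OF X3, of 18000 1700 19900] by simp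
    qed auto
  next
    case 6
    show ?case using scale_add[OF X1, of 19900 33 20000] graph_stateD(1)[OF G] by simp
  qed auto
qed

section \<open>Setup, the loop over all roots, and the output\<close>

definition setup_arrays :: com where
  "setup_arrays =
     Seq (For 4 0 (Assign 18 (Plus (Reg 18) (Reg 0))))
     (Seq (Assign 2 (Reg 18))
     (Seq (Assign 18 (Const 0))
     (Seq (For 4 0 (Seq (ArrStore 0 (Reg 4) (Reg 18)) (Assign 18 (Plus (Reg 18) (Reg 0)))))
     (Assign 12 (times 8 (Reg 1))))))"

text \<open>With base address 0 the nine arrays interleave over the whole memory, so writing to none
  of them fixes every cell. This is the situation before register 2 receives
  \<open>n * n\<close>.\<close>

lemma frame_mem:
  assumes "frame R {} s s'" "reg s 2 = 0"
  shows "mem s' = mem s"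
proof
  fix a :: nat
  have "arr s' (a mod 9) (a div 9) = arr s (a mod 9) (a div 9)"
    using frame_arr[OF assms(1), of "a mod 9"] by simp
  moreover have "reg s' 2 = 0" using assms by (simp add: frame_def)
  ultimately show "mem s' a = mem s a" using assms(2) by (simp add: arr_def)
qed

lemma run_setup_arrays:
  assumes s: "reg s 0 = n" "reg s 1 = k" "reg s 2 = 0" "reg s 9 = 0" "reg s 18 = 0"
    and E: "\<forall>u<n. \<forall>v<n. mem s (n * u + v) \<noteq> 0 \<longleftrightarrow> (u, v) \<in> E" "E \<subseteq> {..<n} \<times> {..<n}" "\<forall>u. (u, u) \<notin> E"
  shows "run setup_arrays s (200 * Suc n) (\<lambda>s'. graph_state n k E s' \<and> reg s' 12 = 8 * k \<and> reg s' 9 = 0)"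
  unfolding setup_arrays_def
proof (rule run_Seq_frame[where V = "20 * Suc n" and U = "180 * Suc n" and P = "\<lambda>s'. reg s' 18 = n * n"], goal_cases)
  case 1
  show ?case
  proof (rule run_For[where Inv = "\<lambda>m s'. reg s' 18 = m * n" and T = 10], goal_cases)
    case (2 m s1)
    have "reg s1 0 = n" using 2(2) s by (auto simp: frame_def)
    thus ?case using 2 by (intro run_Assign) auto
  qed (use s in auto)
next
  case (3 s1)
  have s1: "reg s1 0 = n" "reg s1 1 = k" "reg s1 9 = 0" "reg s1 18 = n * n" using 3 s by (auto simp: frame_def)
  have mem1: "mem s1 = mem s" by (rule frame_mem) (use 3(2) s in auto)
  show ?case
  proof (rule run_Seq[where V = 2 and U = "170 * Suc n", OF run_Assign], goal_cases)
    case 1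
    let ?t = "setr 2 (val (Reg 18) s1) s1"
    show ?case
    proof (rule run_Seq[where V = 2 and U = "160 * Suc n", OF run_Assign], goal_cases)
      case 1
      let ?t' = "setr 18 (val (Const 0) ?t) ?t"
      let ?I = "\<lambda>m s'. reg s' 18 = n * m \<and> (\<forall>u<m. arr s' 0 u = n * u)"
      show ?case
      proof (rule run_Seq_frame[where U = 100, OF run_For[where Inv = ?I and T = 40 and T' = "48 * Suc n" and Q = "?I n"]], goal_cases)
        case (2 m s2)
        have "reg s2 0 = n" using 2(2) s1 by (auto simp: frame_def)
        with 2(3,4) show ?case by (intro run_straight) (auto simp: less_Suc_eq)
      next
        case (12 s2)
        have s2: "reg s2 0 = n" "reg s2 1 = k" "reg s2 2 = n * n" "reg s2 9 = 0"
          using 12(2) s1 by (auto simp: frame_def)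
        have "mem s2 a = mem s a" if "a < n * n" for a
          using 12(2) s1 mem1 that by (auto simp: frame_def)
        hence "\<forall>u<n. \<forall>v<n. mem s2 (n * u + v) \<noteq> 0 \<longleftrightarrow> (u, v) \<in> E" using E(1) by (simp add: row_address)
        thus ?case using 12(1) s2 E(2,3) by (intro run_Assign) (auto simp: graph_state_def)
      qed (use s1 in auto)
    qed auto
  qed auto
qed auto

definition root_loop :: com where
  "root_loop = For 3 0 (Cond (Reg 9) Skip try_root)"

lemma syntax_root_loop [simp]:
  "wregs root_loop = {3, 4, 5, 6, 7, 8, 9, 10, 11, 13, 14, 15, 16, 17, 18}"
  "warrs root_loop = {1, 2, 3, 4, 5, 6, 7, 8}" "array_only root_loop"
  by (auto simp: root_loop_def)

lemma run_root_loop: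
  assumes G: "graph_state n k E s" and s: "reg s 12 = 8 * k" "reg s 9 = 0" and k: "k > 0"
  shows "run root_loop s (20100 * (Suc n ^ 4 * search_cost k)) (\<lambda>s'.
    (reg s' 9 \<noteq> 0 \<longrightarrow> (\<exists>r<n. checked n k E r s')) \<and>
    (reg s' 9 = 0 \<longrightarrow> (\<forall>r<n. \<not> (\<exists>p d. btree n E r p d \<and> k \<le> card (internals n r p)))))"
  unfolding root_loop_def
proof (rule run_For[where T = "20010 * (Suc n ^ 3 * search_cost k)" and Inv = "\<lambda>m s'.
    (reg s' 9 \<noteq> 0 \<longrightarrow> (\<exists>r<n. checked n k E r s')) \<and>
    (reg s' 9 = 0 \<longrightarrow> (\<forall>r<m. \<not> (\<exists>p d. btree n E r p d \<and> k \<le> card (internals n r p))))"], goal_cases)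
  case 1
  show ?case using s by simp
next
  case (2 r s1)
  have G1: "graph_state n k E s1" using graph_state_frame[OF G 2(2)] by auto
  have r: "r < n" and M: "reg s1 12 = 8 * k" using 2(1,2) graph_stateD[OF G] s by (auto simp: frame_def)
  have one: "1 \<le> Suc n ^ 3 * search_cost k" by (simp add: search_cost_def Suc_le_eq del: mult_Suc mult_Suc_right)
  show ?case
  proof (rule run_Cond[where T' = "20000 * (Suc n ^ 3 * search_cost k)"], goal_cases)
    case 1
    thus ?case using 2(4) one by (intro run_straight) (auto simp: less_Suc_eq)
  next
    case 2
    hence "reg s1 9 = 0" by simp
    show ?case
      by (rule run_mono[OF run_try_root[OF G1 \<open>reg s1 3 = r\<close> r k M] order_refl])
        (use \<open>reg s1 9 = 0\<close> \<open>_ \<and> _\<close> r in \<open>auto simp: less_Suc_eq\<close>)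
  next
    case 3
    show ?case using scale_add[OF one, of 20000 10 20010] by simp
  qed
next
  case (3 s1)
  thus ?case using graph_stateD[OF G] by simp
next
  case (4 m x s1)
  thus ?case by (auto simp: checked_def)
next
  case 10
  have n: "reg s 0 = n" using graph_stateD[OF G] by simp
  let ?Y = "Suc n ^ 3 * search_cost k"
  have one: "1 \<le> ?Y" by (simp add: search_cost_def Suc_le_eq del: mult_Suc mult_Suc_right)
  have "20010 * ?Y + 8 * 1 \<le> 20100 * ?Y" by (rule scale_add[OF one]) simp
  hence "Suc n * (20010 * ?Y + 8) \<le> Suc n * (20100 * ?Y)" by (intro mult_le_mono2) simp
  also have "\<dots> = 20100 * (Suc n ^ 4 * search_cost k)"
    using power_Suc[of "Suc n" 3] by (simp add: algebra_simps)
  finally show ?case unfolding n .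
qed auto

text \<open>The root's entry \<open>Suc n\<close> differs from \<open>Suc u\<close> for all
  \<open>u < n\<close>, so its dummy parent produces no arc. The stores go to the matrix itself,
  where \<open>array_only\<close> fails; hence the explicit invariants in
  \<open>run_write_output\<close>.\<close>

definition write_output :: com where
  "write_output =
     Seq (Cond (Reg 9)
       (For 5 0 (For 6 0 (Store (Plus (Arr 0 (Reg 5)) (Reg 6)) (EEq (Arr 2 (Reg 6)) (Plus (Reg 5) (Const 1))))))
       Skip)
     (Assign 0 (Reg 9))"

lemma row_address_inj:
  fixes n :: nat
  assumes "n * u + v = n * u' + v'" "v < n" "v' < n"
  shows "u = u' \<and> v = v'"
proof -
  have "(n * u + v) div n = u" using assms(2) by simp
  moreover have "(n * u' + v') div n = u'" using assms(3) by simp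
  ultimately show ?thesis using assms(1) by auto
qed

lemma run_write_output:
  assumes G: "graph_state n k E s"
  shows "run write_output s (300 * Suc n ^ 2) (\<lambda>s'. reg s' 0 = reg s 9 \<and>
    (reg s 9 \<noteq> 0 \<longrightarrow> (\<forall>u<n. \<forall>v<n. mem s' (n * u + v) \<noteq> 0 \<longleftrightarrow> arr s 2 v = Suc u)))"
proof -
  let ?st = "Store (Plus (Arr 0 (Reg 5)) (Reg 6)) (EEq (Arr 2 (Reg 6)) (Plus (Reg 5) (Const 1)))"
  let ?D = "\<lambda>u v s'. mem s' (n * u + v) \<noteq> 0 \<longleftrightarrow> arr s 2 v = Suc u"
  let ?K = "\<lambda>s'. reg s' 0 = n \<and> reg s' 2 = n * n \<and> reg s' 9 = reg s 9 \<and> (\<forall>u<n. arr s' 0 u = n * u) \<and> arr s' 2 = arr s 2"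
  have Ks: "?K s" using G by (simp add: graph_state_def)
  have sq: "1 \<le> Suc n ^ 2" by simp
  show ?thesis unfolding write_output_def
  proof (rule run_Seq[where V = "290 * Suc n ^ 2" and U = 2], rule run_Cond[where T' = "280 * Suc n ^ 2"], goal_cases)
    case 1
    show ?case
    proof (rule run_mono[OF run_For_basic[where Inv = "\<lambda>m s'. ?K s' \<and> (\<forall>u<m. \<forall>v<n. ?D u v s')" and n = n
          and T = "200 * Suc n ^ 1"] order_refl], goal_cases)
      case (2 u s1)
      show ?case
      proof (rule run_mono[OF run_For_basic[where n = n and T = 150 and
            Inv = "\<lambda>m s'. reg s' 5 = u \<and> ?K s' \<and> (\<forall>x<u. \<forall>v<n. ?D x v s') \<and> (\<forall>v<m. ?D u v s')"] order_refl], goal_cases)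
        case (2 v s2)
        have uv: "u < n" "v < n" using 2 \<open>u < n\<close> by auto
        have lt: "n * u + v < reg s2 2" using 2(3) row_address[OF uv] by simp
        have arr: "arr (sem ?st s2) j = arr s2 j" for j using 2(2,3) lt uv by (auto simp: arr_def)
        have mem: "mem (sem ?st s2) = (mem s2)(n * u + v := of_bool (arr s 2 v = Suc u))"
          using 2(2,3) uv by auto
        have regs: "reg (sem ?st s2) = reg s2" by simp
        have D: "?D u v (sem ?st s2)" unfolding mem by simp
        have D': "?D u' v' (sem ?st s2)" if "?D u' v' s2" "v' < n" "u' \<noteq> u \<or> v' \<noteq> v" for u' v'
          using that row_address_inj[of n u' v' u v] uv unfolding mem by auto
        show ?case
        proof (rule run_straight)
          show "reg (sem ?st s2) 5 = u \<and> ?K (sem ?st s2) \<and> (\<forall>x<u. \<forall>v<n. ?D x v (sem ?st s2)) \<and>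
            (\<forall>w<Suc v. ?D u w (sem ?st s2))"
            unfolding arr regs using 2(3) D D' uv by (auto simp: less_Suc_eq simp del: sem.simps)
        qed auto
      next
        case (9 s2)
        thus ?case by (auto simp: less_Suc_eq)
      qed (use 2 in auto)
    next
      case 8
      show ?case by (rule le_trans[OF For_bound[OF order_refl, of 200 208 2 1]]) simp_all
    next
      case (9 s1)
      thus ?case by (intro run_Assign) auto
    qed (use Ks in auto)
  next
    case 2
    thus ?case using Ks sq by (intro run_straight run_Assign) auto
  next
    case 3
    show ?case using scale_add[OF sq, of 280 2 290] by simp
  next
    case 4
    show ?case using scale_add[OF sq, of 290 2 300] by simp
  qed
qed

definition program :: com where
  "program = Seq setup_arrays (Seq root_loop write_output)"

lemma run_program:
  assumes s: "reg s 0 = n" "reg s 1 = k" "reg s 2 = 0" "reg s 9 = 0" "reg s 18 = 0"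
    and E: "\<forall>u<n. \<forall>v<n. mem s (n * u + v) \<noteq> 0 \<longleftrightarrow> (u, v) \<in> E" "E \<subseteq> {..<n} \<times> {..<n}" "\<forall>u. (u, u) \<notin> E"
    and k: "k > 0"
  shows "run program s (21000 * (Suc n ^ 4 * search_cost k)) (\<lambda>s'.
    if answer s' then \<exists>r p d. btree n E r p d \<and> k \<le> card (internals n r p) \<and>
      (\<forall>u<n. \<forall>v<n. mem s' (n * u + v) \<noteq> 0 \<longleftrightarrow> v \<noteq> r \<and> p v = u)
    else \<not> (\<exists>r p d. btree n E r p d \<and> k \<le> card (internals n r p)))"
proof -
  let ?X = "Suc n ^ 4 * search_cost k"
  have c1: "1 \<le> search_cost k" by (simp add: search_cost_def)
  have "Suc n ^ 4 * 1 \<le> ?X" using c1 by (rule mult_le_mono2)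
  hence X4: "Suc n ^ 4 \<le> ?X" by (simp only: mult_1_right)
  have X2: "Suc n ^ 2 \<le> ?X" by (rule le_trans[OF power_increasing X4]) auto
  have X1: "Suc n \<le> ?X" by (rule le_trans[OF self_le_power X4]) auto
  show ?thesis unfolding program_def
  proof (rule run_Seq[where U = "20500 * ?X", OF run_mono[OF run_setup_arrays[OF s E] order_refl]], goal_cases)
    case (1 s1)
    hence G1: "graph_state n k E s1" and s1: "reg s1 12 = 8 * k" "reg s1 9 = 0" by auto
    show ?case
    proof (rule run_Seq_frame[where U = "300 * Suc n ^ 2", OF run_root_loop[OF G1 s1 k]], goal_cases)
      case (2 s2)
      have G2: "graph_state n k E s2" using graph_state_frame[OF G1 2(2)] by auto
      show ?case
      proof (rule run_mono[OF run_write_output[OF G2] order_refl])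
        fix s' :: state
        assume s': "reg s' 0 = reg s2 9 \<and>
          (reg s2 9 \<noteq> 0 \<longrightarrow> (\<forall>u<n. \<forall>v<n. mem s' (n * u + v) \<noteq> 0 \<longleftrightarrow> arr s2 2 v = Suc u))"
        show "if answer s' then \<exists>r p d. btree n E r p d \<and> k \<le> card (internals n r p) \<and>
            (\<forall>u<n. \<forall>v<n. mem s' (n * u + v) \<noteq> 0 \<longleftrightarrow> v \<noteq> r \<and> p v = u)
          else \<not> (\<exists>r p d. btree n E r p d \<and> k \<le> card (internals n r p))"
        proof (cases "reg s2 9 = 0")
          case True
          hence "\<forall>r<n. \<not> (\<exists>p d. btree n E r p d \<and> k \<le> card (internals n r p))" using 2(1) by blast
          hence "\<not> (\<exists>r p d. btree n E r p d \<and> k \<le> card (internals n r p))" using btreeD(1) by blast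
          thus ?thesis using True s' by (simp add: answer_def)
        next
          case False
          then obtain r where r: "r < n" "checked n k E r s2" using 2(1) by blast
          let ?p = "\<lambda>v. arr s2 2 v - 1"
          obtain d where d: "btree n (allowed E (arr s2 1)) r ?p d" and "k \<le> card (internals n r ?p)"
            and par: "arr s2 2 r = Suc n" "\<forall>v<n. v \<noteq> r \<longrightarrow> arr s2 2 v = Suc (?p v)"
            using r(2) False unfolding checked_def Let_def by blast
          moreover have "btree n E r ?p d" using btree_mono[OF d allowed_subset] .
          moreover have "mem s' (n * u + v) \<noteq> 0 \<longleftrightarrow> v \<noteq> r \<and> ?p v = u" if "u < n" "v < n" for u v
            using s' False par that by (cases "v = r") auto
          ultimately have "\<exists>r p d. btree n E r p d \<and> k \<le> card (internals n r p) \<and>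
            (\<forall>u<n. \<forall>v<n. mem s' (n * u + v) \<noteq> 0 \<longleftrightarrow> v \<noteq> r \<and> p v = u)"
            by (intro exI[of _ r] exI[of _ ?p] exI[of _ d]) blast
          thus ?thesis using False s' by (simp add: answer_def)
        qed
      qed
    next
      case 3
      show ?case using scale_add[OF X2, of 20100 300 20500] by simp
    qed auto
  next
    case 2
    show ?case using scale_add[OF X1, of 20500 200 21000] by simp
  qed
qed

section \<open>Out-branchings and parent functions\<close>

lemma simple_walk_suffix:
  assumes "pcas y q v" "distinct (pawalk_verts y q)" "x \<in> set (pawalk_verts y q)"
  shows "\<exists>q'. pcas x q' v \<and> set q' \<subseteq> set q \<and> distinct (pawalk_verts x q')"
  using assms
proof (induction q arbitrary: y)
  case (Cons e q)
  show ?case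
  proof (cases "x = y")
    case True
    thus ?thesis using Cons.prems by blast
  next
    case False
    with Cons.prems Cons.IH[of "snd e"] show ?thesis by fastforce
  qed
qed auto

lemma rtrancl_simple_walk:
  "(u, v) \<in> R\<^sup>* \<Longrightarrow> \<exists>q. pcas u q v \<and> set q \<subseteq> R \<and> distinct (pawalk_verts u q)"
proof (induction rule: converse_rtrancl_induct)
  case base
  show ?case by (intro exI[of _ "[]"]) simp
next
  case (step x y)
  then obtain q where q: "pcas y q v" "set q \<subseteq> R" "distinct (pawalk_verts y q)" by blast
  show ?case
  proof (cases "x \<in> set (pawalk_verts y q)")
    case True
    from simple_walk_suffix[OF q(1,3) this] q(2) show ?thesis by blast
  next
    case False
    thus ?thesis using q step by (intro exI[of _ "(x, y) # q"]) auto
  qed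
qed

lemma pawalk_verts_eq: "pcas u q v \<Longrightarrow> pawalk_verts u q = u # map snd q"
  by (induction q arbitrary: u) auto

lemma pcas_snoc: "pcas u q v \<Longrightarrow> pcas u (q @ [(v, w)]) w"
  by (induction q arbitrary: u) auto

text \<open>A simple walk from \<open>u\<close> to \<open>v\<close> that avoids the arc itself has
  at least two arcs, and closing it by \<open>(v, u)\<close> gives a cycle of length at least
  three.\<close>

lemma bridge:
  assumes no_cycle: "\<not> (\<exists>p. pre_digraph.cycle (with_proj G) p \<and> 3 \<le> length p)"
    and uv: "(v, u) \<in> parcs G" "u \<noteq> v" "u \<in> pverts G"
  shows "(u, v) \<notin> (parcs G - {(u, v)})\<^sup>*"
proof
  assume "(u, v) \<in> (parcs G - {(u, v)})\<^sup>*"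
  from rtrancl_simple_walk[OF this] obtain q where
    q: "pcas u q v" "set q \<subseteq> parcs G - {(u, v)}" "distinct (pawalk_verts u q)" by blast
  have len: "2 \<le> length q"
  proof (rule ccontr)
    assume "\<not> 2 \<le> length q"
    then consider "q = []" | e where "q = [e]" by (cases q; cases "tl q") auto
    thus False by cases (use q uv in auto)
  qed
  let ?p = "q @ [(v, u)]"
  have p: "pcas u ?p u" using q(1) by (rule pcas_snoc)
  have "tl (pawalk_verts u ?p) = map snd q @ [u]" by (simp add: pawalk_verts_eq[OF p])
  hence "distinct (tl (pawalk_verts u ?p))" using q(3) unfolding pawalk_verts_eq[OF q(1)] by auto
  hence "pre_digraph.cycle (with_proj G) ?p"
    unfolding pre_digraph.cycle_def pre_digraph.awalk_def cas_with_proj_eq awalk_verts_with_proj_eq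
    using p q(2) uv by (intro exI[of _ u]) auto
  with no_cycle len show False by auto
qed

lemma rtrancl_until: "(x, u) \<in> A\<^sup>* \<Longrightarrow> (x, u) \<in> (A \<inter> {(a, b). a \<noteq> u})\<^sup>*"
proof (induction rule: converse_rtrancl_induct)
  case (step x y)
  show ?case
  proof (cases "x = u")
    case False
    with step show ?thesis by (intro converse_rtrancl_into_rtrancl[of x y]) auto
  qed simp
qed simp

text \<open>A walk to \<open>u\<close> through \<open>v\<close> would end with a walk from
  \<open>v\<close> to \<open>u\<close>.\<close>

lemma rtrancl_avoiding:
  assumes "(x, u) \<in> A\<^sup>*" "(v, u) \<notin> A\<^sup>*"
  shows "(x, u) \<in> (A \<inter> {(a, b). a \<noteq> v \<and> b \<noteq> v})\<^sup>*"
  using assms(1)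
proof (induction rule: converse_rtrancl_induct)
  case (step x y)
  have "x \<noteq> v" "y \<noteq> v" using step(1,2) assms(2) by (auto intro: converse_rtrancl_into_rtrancl)
  with step show ?case by (intro converse_rtrancl_into_rtrancl[of x y]) auto
qed simp

lemma parcs_mk_symmetric_eq:
  "tail T = fst \<Longrightarrow> head T = snd \<Longrightarrow> parcs (mk_symmetric T) = arcs T \<union> (arcs T)\<inverse>"
  by (auto simp: mk_symmetric_def)

text \<open>Every arc of an oriented tree is a bridge of the underlying graph. This excludes
  directed cycles and second in-neighbours, which makes the parent well defined and the number of
  proper ancestors a rank.\<close>

lemma out_branching_btree:
  assumes D: "pverts D = {..<n}" and ob: "out_branching T (with_proj D)"
  obtains r p d where "btree n (parcs D) r p d" "card (leaves T) + card (internals n r p) = n"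
proof -
  define A where "A = arcs T"
  have sp: "spanning T (with_proj D)" and ot: "oriented_tree T" and ex1: "\<exists>!r. r \<in> verts T \<and> in_degree T r = 0"
    using ob by (auto simp: out_branching_def)
  have V: "verts T = {..<n}" and AD: "A \<subseteq> parcs D" and th: "tail T = fst" "head T = snd"
    using sp D by (auto simp: spanning_def subgraph_def compatible_def A_def)
  interpret T: digraph T using ot by (simp add: oriented_tree_def)
  have An: "A \<subseteq> {..<n} \<times> {..<n}"
    using T.tail_in_verts T.head_in_verts unfolding th V A_def by fastforce
  have finA: "finite A" unfolding A_def by simp
  have ends: "arcs_ends T = A" by (simp add: arcs_ends_conv th A_def)
  have as: "(v, u) \<notin> A" if "(u, v) \<in> A" for u v
    using ot that ends asymD[of A u v] by (simp add: oriented_tree_def)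
  define S where "S = A \<union> A\<inverse>"
  have S: "parcs (mk_symmetric T) = S" using parcs_mk_symmetric_eq[OF th] by (simp add: S_def A_def)
  have bridge: "(u, v) \<notin> (S - {(u, v)})\<^sup>*" if "(u, v) \<in> A" for u v
    unfolding S[symmetric]
  proof (rule bridge)
    show "\<not> (\<exists>p. pre_digraph.cycle (with_proj (mk_symmetric T)) p \<and> 3 \<le> length p)"
      using ot by (simp add: oriented_tree_def)
    show "(v, u) \<in> parcs (mk_symmetric T)" unfolding S S_def using that by blast
    show "u \<noteq> v" using as[OF that] that by blast
    show "u \<in> pverts (mk_symmetric T)" using that An V by auto
  qed
  have bridge': "(v, u) \<notin> (S - {(v, u)})\<^sup>*" if "(u, v) \<in> A" for u v
  proof
    assume "(v, u) \<in> (S - {(v, u)})\<^sup>*"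
    hence "(u, v) \<in> ((S - {(v, u)})\<inverse>)\<^sup>*" by (simp add: rtrancl_converse)
    moreover have "(S - {(v, u)})\<inverse> = S - {(u, v)}" unfolding S_def by auto
    ultimately show False using bridge[OF that] by simp
  qed
  \<comment> \<open>A directed cycle through \<open>(x, y)\<close> would lead from \<open>y\<close>
    back to \<open>x\<close> without the arc \<open>(y, x)\<close>, against
    \<open>bridge'\<close>.\<close>
  have acyc: "acyclic A"
  proof (rule acyclicI, intro allI notI)
    fix x assume "(x, x) \<in> A\<^sup>+"
    then obtain y where xy: "(x, y) \<in> A" "(y, x) \<in> A\<^sup>*" by (meson tranclD)
    have "(y, x) \<in> (A \<inter> {(a, b). a \<noteq> x})\<^sup>*" using xy(2) by (rule rtrancl_until)
    moreover have "A \<inter> {(a, b). a \<noteq> x} \<subseteq> S - {(y, x)}" unfolding S_def using as[OF xy(1)] by auto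
    ultimately have "(y, x) \<in> (S - {(y, x)})\<^sup>*" using rtrancl_mono by blast
    with bridge'[OF xy(1)] show False ..
  qed
  have wf: "wf A" using finA acyc by (rule finite_acyclic_wf)
  have indeg: "in_degree T v = 0 \<longleftrightarrow> (\<forall>u. (u, v) \<notin> A)" for v
    using finA by (auto simp: in_degree_def in_arcs_def th A_def card_eq_0_iff)
  from ex1 obtain r where r: "r < n" "\<forall>u. (u, r) \<notin> A" and uniq: "\<And>v. v < n \<Longrightarrow> \<forall>u. (u, v) \<notin> A \<Longrightarrow> v = r"
    unfolding V indeg by auto
  \<comment> \<open>Climbing along in-neighbours terminates by well-foundedness, and only at
    \<open>r\<close>, the one vertex without any.\<close>
  have reach: "(r, v) \<in> A\<^sup>*" if "v < n" for v
    using wf that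
  proof (induction v rule: wf_induct_rule)
    case (less v)
    show ?case
    proof (cases "v = r")
      case False
      then obtain u where "(u, v) \<in> A" using uniq less.prems by blast
      with less.IH[of u] An show ?thesis by (auto intro: rtrancl_into_rtrancl)
    qed simp
  qed
  \<comment> \<open>Going back from \<open>u\<close> to \<open>r\<close>, on to \<open>u'\<close>
    and then to \<open>v\<close> avoids the arc \<open>(u, v)\<close>, against
    \<open>bridge\<close>: by acyclicity \<open>v\<close> reaches neither \<open>u\<close> nor
    \<open>u'\<close>, so the walks from \<open>r\<close> to them stay away from
    \<open>v\<close>.\<close>
  have unique: "u = u'" if "(u, v) \<in> A" "(u', v) \<in> A" for u u' v
  proof (rule ccontr)
    assume "u \<noteq> u'"
    have un: "u < n" "u' < n" using that An by auto
    have no: "(v, w) \<notin> A\<^sup>*" if "(w, v) \<in> A" for w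
      using acyc that unfolding acyclic_def by (meson rtrancl_into_trancl2)
    let ?B = "A \<inter> {(a, b). a \<noteq> v \<and> b \<noteq> v}"
    have Bu: "(r, u) \<in> ?B\<^sup>*" by (rule rtrancl_avoiding[OF reach[OF un(1)] no[OF that(1)]])
    have Bu': "(r, u') \<in> ?B\<^sup>*" by (rule rtrancl_avoiding[OF reach[OF un(2)] no[OF that(2)]])
    have BS: "?B \<subseteq> S - {(u, v)}" "?B\<inverse> \<subseteq> S - {(u, v)}" unfolding S_def by auto
    have "(u, r) \<in> (S - {(u, v)})\<^sup>*"
      using subsetD[OF rtrancl_mono[OF BS(2)] rtrancl_converseI[OF Bu]] .
    moreover have "(r, u') \<in> (S - {(u, v)})\<^sup>*"
      using subsetD[OF rtrancl_mono[OF BS(1)] Bu'] .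
    moreover have "(u', v) \<in> S - {(u, v)}" using that \<open>u \<noteq> u'\<close> unfolding S_def by auto
    ultimately have "(u, v) \<in> (S - {(u, v)})\<^sup>*" by (meson rtrancl.rtrancl_into_rtrancl rtrancl_trans)
    with bridge[OF that(1)] show False ..
  qed
  define p where "p = (\<lambda>v. THE u. (u, v) \<in> A)"
  have pA: "(p v, v) \<in> A" if v: "v < n" "v \<noteq> r" for v
  proof -
    obtain u where "(u, v) \<in> A" using uniq[OF v(1)] v(2) by blast
    thus ?thesis unfolding p_def by (rule theI) (rule unique[OF _ \<open>(u, v) \<in> A\<close>])
  qed
  define d where "d = (\<lambda>v. card {u. (u, v) \<in> A\<^sup>+})"
  have dlt: "d u < d v" if "(u, v) \<in> A" for u v
  proof -
    have "{x. (x, v) \<in> A\<^sup>+} \<subseteq> {..<n}" using trancl_subset_Sigma[OF An] by auto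
    hence "finite {x. (x, v) \<in> A\<^sup>+}" using finite_subset by blast
    moreover have "{x. (x, u) \<in> A\<^sup>+} \<subseteq> {x. (x, v) \<in> A\<^sup>+}"
      using trancl_into_trancl[OF _ that] by blast
    moreover have "u \<in> {x. (x, v) \<in> A\<^sup>+} - {x. (x, u) \<in> A\<^sup>+}"
      using that acyc unfolding acyclic_def by blast
    ultimately have "finite {x. (x, v) \<in> A\<^sup>+}" "{x. (x, u) \<in> A\<^sup>+} \<subset> {x. (x, v) \<in> A\<^sup>+}" by blast+
    thus ?thesis unfolding d_def by (rule psubset_card_mono)
  qed
  have t: "btree n (parcs D) r p d"
    by (rule btreeI[OF r(1)]) (use pA An AD dlt in auto)
  have int: "internals n r p = {u. \<exists>v. (u, v) \<in> A}"
  proof (intro equalityI subsetI)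
    fix u assume "u \<in> {u. \<exists>v. (u, v) \<in> A}"
    then obtain v where uv: "(u, v) \<in> A" by blast
    have v: "v < n" "v \<noteq> r" using uv An r(2) by auto
    with unique[OF uv pA] show "u \<in> internals n r p" unfolding internals_def by auto
  qed (use pA in \<open>auto simp: internals_def\<close>)
  have "out_degree T v = 0 \<longleftrightarrow> (\<forall>u. (v, u) \<notin> A)" for v
    using finA by (auto simp: out_degree_def out_arcs_def th A_def card_eq_0_iff)
  hence "leaves T = {..<n} - internals n r p" unfolding leaves_def V int by auto
  moreover have "internals n r p \<subseteq> {..<n}" using internals_subset[OF t] .
  ultimately have "card (leaves T) + card (internals n r p) = n"
    using card_mono[of "{..<n}" "internals n r p"] by (simp add: card_Diff_subset)
  with t show ?thesis by (rule that)
qed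

lemma pawalk_last: "pcas u q v \<Longrightarrow> last (pawalk_verts u q) = v"
proof (induction q arbitrary: u)
  case (Cons e q)
  thus ?case using Cons.IH[of "snd e"] pawalk_verts_eq[of "snd e" q v] by simp
qed simp

lemma pawalk_nth:
  "pcas u q v \<Longrightarrow> i < length q \<Longrightarrow> q ! i = (pawalk_verts u q ! i, pawalk_verts u q ! Suc i)"
proof (induction q arbitrary: u i)
  case (Cons e q)
  have pv: "pawalk_verts (snd e) q = snd e # map snd q" using Cons.prems(1) by (intro pawalk_verts_eq[of _ _ v]) simp
  show ?case
  proof (cases i)
    case 0
    thus ?thesis using pv by (simp add: prod_eq_iff)
  qed (use Cons in auto)
qed simp

lemma btree_out_branching:
  assumes D: "pair_digraph D" "pverts D = {..<n}" and t: "btree n (parcs D) r p d"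
  defines "B \<equiv> \<lparr>pverts = {..<n}, parcs = {(u, v). u < n \<and> v < n \<and> v \<noteq> r \<and> p v = u}\<rparr>"
  shows "out_branching (with_proj B) (with_proj D)"
    and "card (leaves (with_proj B)) + card (internals n r p) = n"
proof -
  interpret D: pair_digraph D by (rule D)
  let ?A = "{(u, v). u < n \<and> v < n \<and> v \<noteq> r \<and> p v = u}"
  note tD = btreeD[OF t]
  have A: "?A \<subseteq> parcs D" using tD(3) by auto
  have lt: "d u < d v" if "(u, v) \<in> ?A" for u v
  proof -
    have "v < n" "v \<noteq> r" "p v = u" using that by auto
    with tD(4)[of v] show ?thesis by simp
  qed
  interpret B: pair_digraph B
  proof
    show "finite (parcs B)" unfolding B_def using finite_subset[OF A] by simp
    show "fst e \<noteq> snd e" if "e \<in> parcs B" for e using that lt[of "fst e" "snd e"] by (auto simp: B_def)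
  qed (auto simp: B_def)
  have th: "tail (with_proj B) = fst" "head (with_proj B) = snd" by simp_all
  have S: "parcs (mk_symmetric (with_proj B)) = ?A \<union> ?A\<inverse>"
    unfolding parcs_mk_symmetric_eq[OF th] by (simp add: B_def)
  have "spanning (with_proj B) (with_proj D)"
    unfolding spanning_def subgraph_def compatible_def
    using A D(2) B.wf_digraph D.wf_digraph by (auto simp: B_def)
  moreover have "oriented_tree (with_proj B)" unfolding oriented_tree_def
  proof (intro conjI notI)
    show "digraph (with_proj B)" ..
    show "asym (arcs_ends (with_proj B))"
    proof (rule asymI)
      fix u v assume "(u, v) \<in> arcs_ends (with_proj B)"
      hence "(u, v) \<in> ?A" by (simp add: B_def)
      hence "(v, u) \<notin> ?A" using lt[of u v] lt[of v u] by (meson less_asym)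
      thus "(v, u) \<notin> arcs_ends (with_proj B)" by (simp add: B_def)
    qed
    have reach: "r \<rightarrow>\<^sup>*\<^bsub>with_proj B\<^esub> v" if "v < n" for v
      using that
    proof (induction "d v" arbitrary: v rule: less_induct)
      case less
      show ?case
      proof (cases "v = r")
        case True
        thus ?thesis using less.prems B.reachable_refl[of v] by (simp add: B_def)
      next
        case False
        hence "(p v, v) \<in> parcs B" using less.prems tD(2) by (auto simp: B_def)
        moreover have "r \<rightarrow>\<^sup>*\<^bsub>with_proj B\<^esub> p v" using False less tD(2,4) by blast
        ultimately show ?thesis using B.reachable_adj_trans by simp
      qed
    qed
    show "Digraph_Component.connected (with_proj B)"
      unfolding Digraph_Component.connected_def strongly_connected_def
    proof (intro conjI ballI)
      show "verts (with_proj (mk_symmetric (with_proj B))) \<noteq> {}" using tD(1) by (auto simp: B_def)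
      fix u v
      assume "u \<in> verts (with_proj (mk_symmetric (with_proj B)))" "v \<in> verts (with_proj (mk_symmetric (with_proj B)))"
      hence "u < n" "v < n" by (auto simp: B_def)
      hence ru: "r \<rightarrow>\<^sup>*\<^bsub>with_proj (mk_symmetric (with_proj B))\<^esub> u"
        and rv: "r \<rightarrow>\<^sup>*\<^bsub>with_proj (mk_symmetric (with_proj B))\<^esub> v"
        using B.reachable_mk_symmetricI reach by blast+
      interpret M: pair_wf_digraph "mk_symmetric (with_proj B)" by (rule B.wellformed_mk_symmetric)
      show "u \<rightarrow>\<^sup>*\<^bsub>with_proj (mk_symmetric (with_proj B))\<^esub> v"
        using symmetric_reachable[OF symmetric_mk_symmetric ru] rv by (rule M.reachable_trans)
    qed
    \<comment> \<open>A vertex of maximal rank on a cycle is joined to both its neighbours by arcs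
      into it, so both are its parent; but on a cycle of length at least three they are
      distinct.\<close>
    assume "\<exists>c. pre_digraph.cycle (with_proj (mk_symmetric (with_proj B))) c \<and> 3 \<le> length c"
    then obtain c u where c: "pcas u c u" "set c \<subseteq> ?A \<union> ?A\<inverse>" "distinct (tl (pawalk_verts u c))" "3 \<le> length c"
      unfolding pre_digraph.cycle_def pre_digraph.awalk_def cas_with_proj_eq awalk_verts_with_proj_eq
      by (auto simp: S)
    define L where "L = length c"
    define y where "y = (\<lambda>i. pawalk_verts u c ! i)"
    have ys: "pawalk_verts u c = u # map snd c" using c(1) by (rule pawalk_verts_eq)
    have y0: "y 0 = y L"
    proof -
      have "last (pawalk_verts u c) = u" using c(1) by (rule pawalk_last)
      thus ?thesis using last_conv_nth[of "u # map snd c"] unfolding y_def L_def ys by (simp del: last.simps)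
    qed
    have inj: "i = j" if "y i = y j" "1 \<le> i" "i \<le> L" "1 \<le> j" "j \<le> L" for i j
    proof -
      have "map snd c ! (i - 1) = map snd c ! (j - 1)" using that unfolding y_def ys by (cases i; cases j) auto
      moreover have "distinct (map snd c)" using c(3) by (simp add: ys)
      ultimately have "i - 1 = j - 1" using that by (subst (asm) nth_eq_iff_index_eq) (auto simp: L_def)
      thus ?thesis using that by simp
    qed
    have edge: "(y i, y (Suc i)) \<in> ?A \<union> ?A\<inverse>" if "i < L" for i
      using pawalk_nth[OF c(1), of i] c(2) that nth_mem[of i c] unfolding y_def L_def by auto
    let ?M = "(\<lambda>i. d (y i)) ` {1..L}"
    have "?M \<noteq> {}" using c(4) by (simp add: L_def)
    hence "Max ?M \<in> ?M" by (intro Max_in) auto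
    then obtain i where i: "1 \<le> i" "i \<le> L" "d (y i) = Max ?M" by auto
    have top: "d (y j) \<le> d (y i)" if "1 \<le> j" "j \<le> L" for j
      unfolding i(3) using that by (intro Max_ge) auto
    have parent: "y j = p (y i)" if "(y j, y i) \<in> ?A \<union> ?A\<inverse>" "1 \<le> j" "j \<le> L" for j
      using that(1) top[OF that(2,3)] lt[of "y i" "y j"] by auto
    \<comment> \<open>Positions run from 1 to \<open>L\<close>, as position 0 repeats position
      \<open>L\<close>; \<open>a\<close> and \<open>b\<close> are the cyclic neighbours of
      \<open>i\<close>.\<close>
    define a where "a = (if i = 1 then L else i - 1)"
    define b where "b = (if i = L then 1 else Suc i)"
    have L3: "3 \<le> L" using c(4) by (simp add: L_def)
    have "y a = p (y i)"
    proof (rule parent)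
      have "(y (i - 1), y i) \<in> ?A \<union> ?A\<inverse>" using edge[of "i - 1"] i(1,2) by simp
      moreover have "y a = y (i - 1)" using y0 by (simp add: a_def)
      ultimately show "(y a, y i) \<in> ?A \<union> ?A\<inverse>" by (simp only:)
    qed (use i(1,2) L3 in \<open>auto simp: a_def\<close>)
    moreover have "y b = p (y i)"
    proof (rule parent)
      have "(y i, y b) \<in> ?A \<union> ?A\<inverse>"
      proof (cases "i = L")
        case True
        hence "y i = y 0" "y b = y (Suc 0)" using y0 by (simp_all add: b_def)
        thus ?thesis using edge[of 0] L3 by simp
      next
        case False
        thus ?thesis using edge[of i] i(1,2) by (simp add: b_def)
      qed
      thus "(y b, y i) \<in> ?A \<union> ?A\<inverse>" by auto
    qed (use i(1,2) L3 in \<open>auto simp: b_def\<close>)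
    ultimately have yab: "y a = y b" by simp
    have "1 \<le> a" "a \<le> L" "1 \<le> b" "b \<le> L" using i(1,2) by (auto simp: a_def b_def)
    from inj[OF yab this] show False using i(1,2) L3
      by (cases "i = 1"; cases "i = L") (simp_all add: a_def b_def)
  qed
  moreover have "\<exists>!r. r \<in> verts (with_proj B) \<and> in_degree (with_proj B) r = 0"
  proof -
    have "in_degree (with_proj B) v = 0 \<longleftrightarrow> (\<forall>u. (u, v) \<notin> ?A)" for v
      using B.finite_in_arcs[of v] by (auto simp: in_degree_def in_arcs_def B_def)
    thus ?thesis using tD(1,2) by (intro ex1I[of _ r]) (auto simp: B_def)
  qed
  ultimately show "out_branching (with_proj B) (with_proj D)" unfolding out_branching_def by blast
  have "out_degree (with_proj B) v = 0 \<longleftrightarrow> (\<forall>u. (v, u) \<notin> ?A)" for v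
    using B.finite_out_arcs[of v] by (auto simp: out_degree_def out_arcs_def B_def)
  hence "leaves (with_proj B) = {..<n} - internals n r p"
    using tD(2) by (auto simp: leaves_def B_def internals_def)
  moreover have "internals n r p \<subseteq> {..<n}" using internals_subset[OF t] .
  ultimately show "card (leaves (with_proj B)) + card (internals n r p) = n"
    using card_mono[of "{..<n}" "internals n r p"] by (simp add: card_Diff_subset)
qed

section \<open>The running time\<close>

text \<open>The three factors of \<open>search_cost k\<close> are each at most
  \<open>(num_arcs k + 2) ^ (k + 1)\<close>, so its cube needs the exponent
  \<open>9 * (k + 1)\<close>; 15 leaves room.\<close>

definition growth :: "nat \<Rightarrow> real" where
  "growth k = 15 * (real k + 1) * log 2 (real (num_arcs k) + 2)"

text \<open>For \<open>k >= 2\<close> the constants in \<open>num_arcs k + 2\<close> are absorbed by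
  \<open>2 ^ 13 <= k ^ 13\<close>, which leaves \<open>k ^ 19\<close>. Together with
  \<open>k + 1 <= 2 * k\<close> this gives 570 as 15 times 2 times 19.\<close>

lemma growth_bigo: "growth \<in> O(\<lambda>k. real k * log 2 (real k))"
proof (rule bigoI[where c = 570], rule eventually_mono[OF eventually_ge_at_top[of 2]])
  fix k :: nat
  assume k: "2 \<le> k"
  have "num_arcs k = 5625 * k ^ 6"
    by (simp add: num_arcs_def power_mult_distrib power_mult[symmetric])
  moreover have "1 \<le> k ^ 6" using k by simp
  ultimately have "num_arcs k + 2 \<le> 2 ^ 13 * k ^ 6" by simp
  also have "\<dots> \<le> k ^ 13 * k ^ 6" using k by (intro mult_le_mono1 power_mono) auto
  finally have "num_arcs k + 2 \<le> k ^ 19" by (simp add: power_add[symmetric])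
  hence "real (num_arcs k) + 2 \<le> real k ^ 19" by (metis of_nat_add of_nat_le_iff of_nat_numeral of_nat_power)
  hence "log 2 (real (num_arcs k) + 2) \<le> log 2 (real k ^ 19)" by (intro log_mono) auto
  also have "\<dots> = 19 * log 2 (real k)" using k by (simp add: log_nat_power)
  finally have "log 2 (real (num_arcs k) + 2) \<le> 19 * log 2 (real k)" .
  moreover have "real k + 1 \<le> 2 * real k" using k by simp
  moreover have "0 \<le> log 2 (real (num_arcs k) + 2)" by simp
  ultimately have "growth k \<le> 15 * (2 * real k) * (19 * log 2 (real k))" "0 \<le> growth k"
    unfolding growth_def by (intro mult_mono mult_nonneg_nonneg; simp)+
  moreover have "0 \<le> log 2 (real k)" using k by simp
  ultimately show "norm (growth k) \<le> 570 * norm (real k * log 2 (real k))" by simp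
qed

lemma search_cost_le:
  "real (search_cost k) ^ 3 \<le> 2 powr growth k"
proof -
  define b where "b = num_arcs k + 2"
  have b2: "2 \<le> b" by (simp add: b_def)
  have "Suc k \<le> b ^ (k + 1)"
    using less_exp[of "k + 1"] power_mono[OF b2, of "k + 1"] by linarith
  moreover have "Suc (num_arcs k) \<le> b ^ (k + 1)"
    using self_le_power[of b "k + 1"] by (simp add: b_def)
  moreover have "Suc (num_arcs k ^ k) \<le> b ^ (k + 1)"
  proof -
    have "num_arcs k ^ k \<le> b ^ k" by (rule power_mono) (simp_all add: b_def)
    moreover have "1 \<le> b ^ k" using b2 by simp
    moreover have "2 * b ^ k \<le> b ^ (k + 1)" using b2 by simp
    ultimately show ?thesis by linarith
  qed
  ultimately have "search_cost k \<le> b ^ (k + 1) * b ^ (k + 1) * b ^ (k + 1)"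
    unfolding search_cost_def by (intro mult_le_mono)
  also have "\<dots> = (b ^ (k + 1)) ^ 3" by (simp only: power3_eq_cube)
  finally have "search_cost k ^ 3 \<le> ((b ^ (k + 1)) ^ 3) ^ 3" by (intro power_mono) auto
  also have "\<dots> = b ^ ((k + 1) * 3 * 3)" by (simp only: power_mult)
  also have "\<dots> \<le> b ^ (15 * (k + 1))" using b2 by (intro power_increasing) auto
  finally have "real (search_cost k ^ 3) \<le> real (b ^ (15 * (k + 1)))" by (simp only: of_nat_le_iff)
  hence "real (search_cost k) ^ 3 \<le> real b ^ (15 * (k + 1))" by (simp only: of_nat_power)
  also have "\<dots> = real b powr (15 * (real k + 1))"
    using b2 by (subst powr_realpow[symmetric]) (auto simp: algebra_simps)
  also have "\<dots> = (2 powr log 2 (real b)) powr (15 * (real k + 1))" using b2 by simp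
  also have "\<dots> = 2 powr growth k"
    unfolding powr_powr by (simp add: growth_def b_def mult.commute add.commute)
  finally show ?thesis .
qed

text \<open>If \<open>y <= x ^ 2\<close>, the product is at most \<open>x ^ 6\<close>; otherwise
  \<open>x ^ 4 <= y ^ 2\<close>, and it is at most \<open>y ^ 3\<close>.\<close>

lemma split_product:
  fixes x y :: real
  assumes "0 \<le> x" "0 \<le> y"
  shows "x ^ 4 * y \<le> y ^ 3 + x ^ 6"
proof (cases "y \<le> x ^ 2")
  case True
  hence "x ^ 4 * y \<le> x ^ 4 * x ^ 2" by (intro mult_left_mono) auto
  also have "\<dots> = x ^ 6" by (simp add: power_add[symmetric])
  finally show ?thesis using assms by (simp add: add_increasing)
next
  case False
  hence "(x ^ 2) ^ 2 \<le> y ^ 2" by (intro power_mono) auto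
  hence "x ^ 4 * y \<le> y ^ 2 * y" using assms by (intro mult_right_mono) auto
  also have "\<dots> = y ^ 3" by (simp add: power2_eq_square power3_eq_cube)
  finally show ?thesis using assms by (simp add: add_increasing2)
qed

lemma total_time:
  assumes n: "n > 0"
  shows "real (21000 * (Suc n ^ 4 * search_cost k)) \<le> 336000 * (2 powr growth k + real n ^ 6)"
proof -
  \<comment> \<open>As \<open>n > 0\<close>, \<open>Suc n\<close> is at most \<open>2 * n\<close>,
    which costs a factor 16 and turns 21000 into 336000.\<close>
  have "Suc n ^ 4 \<le> (2 * n) ^ 4" using n by (intro power_mono) auto
  hence "Suc n ^ 4 * search_cost k \<le> (2 * n) ^ 4 * search_cost k" by (rule mult_le_mono1)
  hence "21000 * (Suc n ^ 4 * search_cost k) \<le> 336000 * (n ^ 4 * search_cost k)"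
    by (simp add: power_mult_distrib)
  hence "real (21000 * (Suc n ^ 4 * search_cost k)) \<le> real (336000 * (n ^ 4 * search_cost k))"
    by (simp only: of_nat_le_iff)
  also have "\<dots> = 336000 * (real n ^ 4 * real (search_cost k))" by simp
  also have "\<dots> \<le> 336000 * (real (search_cost k) ^ 3 + real n ^ 6)"
    by (intro mult_left_mono split_product) auto
  also have "\<dots> \<le> 336000 * (2 powr growth k + real n ^ 6)" using search_cost_le[of k] by simp
  finally show ?thesis .
qed

lemma input_matrix:
  assumes E: "parcs D \<subseteq> {..<n} \<times> {..<n}" and uv: "u < n" "v < n"
  shows "mem (input n k D) (n * u + v) \<noteq> 0 \<longleftrightarrow> (u, v) \<in> parcs D"
proof -
  have "(\<exists>(u', v') \<in> parcs D. n * u + v = n * u' + v') \<longleftrightarrow> (u, v) \<in> parcs D"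
  proof
    assume "\<exists>(u', v') \<in> parcs D. n * u + v = n * u' + v'"
    then obtain u' v' where *: "(u', v') \<in> parcs D" "n * u + v = n * u' + v'" by blast
    with E have "v' < n" by auto
    from row_address_inj[OF *(2) uv(2) this] *(1) show "(u, v) \<in> parcs D" by simp
  qed blast
  thus ?thesis by (simp add: input_def)
qed

theorem theorem4:
  shows "\<exists>(P :: com) (C :: real). \<exists>g \<in> O(\<lambda>k::nat. real k * log 2 (real k)).
    \<forall>(D :: nat pair_pre_digraph) (n :: nat) (k :: nat).
      pair_digraph D \<longrightarrow> pverts D = {..<n} \<longrightarrow> l_min (with_proj D) > 0 \<longrightarrow> k > 0 \<longrightarrow>
      (\<exists>t s. exec P (input n k D) t s \<and>
         real t \<le> C * (2 powr g k + real n ^ 6) \<and>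
         (if answer s
          then out_branching (with_proj (output_digraph n s)) (with_proj D) \<and>
               int (card (leaves (with_proj (output_digraph n s)))) \<le> int n - int k
          else \<not> (\<exists>T. out_branching T (with_proj D) \<and>
                       int (card (leaves T)) \<le> int n - int k)))"
proof (intro exI[of _ program] exI[of _ "336000 :: real"] bexI[OF _ growth_bigo] allI impI)
  fix D :: "nat pair_pre_digraph" and n k :: nat
  assume D: "pair_digraph D" "pverts D = {..<n}" and l: "l_min (with_proj D) > 0" and k: "k > 0"
  interpret pair_digraph D by (rule D)
  let ?E = "parcs D"
  have E: "?E \<subseteq> {..<n} \<times> {..<n}" using arc_fst_in_verts arc_snd_in_verts D(2) by fastforce
  have irr: "\<forall>u. (u, u) \<notin> ?E" using no_loops' by blast
  \<comment> \<open>\<open>l_min\<close> is positive only if an out-branching exists, and this has a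
    root among the \<open>n\<close> vertices.\<close>
  have n: "n > 0"
  proof -
    from l obtain T :: "(nat, nat \<times> nat) pre_digraph" where "out_branching T (with_proj D)"
      unfolding l_min_def by (auto split: if_splits)
    from out_branching_btree[OF D(2) this] obtain r p d where "btree n ?E r p d" by blast
    thus ?thesis using btreeD(1) by fastforce
  qed
  \<comment> \<open>The bound on the leaves is an integer, negative if \<open>k > n\<close>; then no
    branching qualifies, just as none has more than \<open>n\<close> internal vertices.\<close>
  have leaves_iff: "int l \<le> int n - int k \<longleftrightarrow> k \<le> i" if "l + i = n" for l i using that by linarith
  have "run program (input n k D) (21000 * (Suc n ^ 4 * search_cost k)) (\<lambda>s'.
    if answer s' then \<exists>r p d. btree n ?E r p d \<and> k \<le> card (internals n r p) \<and>
      (\<forall>u<n. \<forall>v<n. mem s' (n * u + v) \<noteq> 0 \<longleftrightarrow> v \<noteq> r \<and> p v = u)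
    else \<not> (\<exists>r p d. btree n ?E r p d \<and> k \<le> card (internals n r p)))"
    by (rule run_program) (use E irr k input_matrix[OF E] in \<open>auto simp: input_def\<close>)
  then obtain t s where t: "exec program (input n k D) t s" "t \<le> 21000 * (Suc n ^ 4 * search_cost k)"
    and s: "if answer s then \<exists>r p d. btree n ?E r p d \<and> k \<le> card (internals n r p) \<and>
      (\<forall>u<n. \<forall>v<n. mem s (n * u + v) \<noteq> 0 \<longleftrightarrow> v \<noteq> r \<and> p v = u)
    else \<not> (\<exists>r p d. btree n ?E r p d \<and> k \<le> card (internals n r p))"
    unfolding run_def by blast
  have "real t \<le> real (21000 * (Suc n ^ 4 * search_cost k))" using t(2) by (simp only: of_nat_le_iff)
  also have "\<dots> \<le> 336000 * (2 powr growth k + real n ^ 6)" by (rule total_time[OF n])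
  finally have time: "real t \<le> 336000 * (2 powr growth k + real n ^ 6)" .
  have "if answer s
          then out_branching (with_proj (output_digraph n s)) (with_proj D) \<and>
               int (card (leaves (with_proj (output_digraph n s)))) \<le> int n - int k
          else \<not> (\<exists>T. out_branching T (with_proj D) \<and>
                       int (card (leaves T)) \<le> int n - int k)"
  proof (cases "answer s")
    case True
    with s obtain r p d where t: "btree n ?E r p d" and int: "k \<le> card (internals n r p)"
      and out: "\<forall>u<n. \<forall>v<n. mem s (n * u + v) \<noteq> 0 \<longleftrightarrow> v \<noteq> r \<and> p v = u" by auto
    have "output_digraph n s = \<lparr>pverts = {..<n}, parcs = {(u, v). u < n \<and> v < n \<and> v \<noteq> r \<and> p v = u}\<rparr>"
      using out by (auto simp: output_digraph_def)
    with btree_out_branching[OF D t] leaves_iff int True show ?thesis by simp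
  next
    case False
    have "\<not> (out_branching T (with_proj D) \<and> int (card (leaves T)) \<le> int n - int k)" for T
    proof (intro notI, elim conjE)
      assume T: "out_branching T (with_proj D)" "int (card (leaves T)) \<le> int n - int k"
      from out_branching_btree[OF D(2) T(1)] obtain r p d where
        t: "btree n ?E r p d" and card: "card (leaves T) + card (internals n r p) = n" .
      have "k \<le> card (internals n r p)" using leaves_iff[OF card] T(2) by simp
      with t s False show False by (simp only: if_False) blast
    qed
    with False show ?thesis by simp
  qed
  with t(1) time show "\<exists>t s. exec program (input n k D) t s \<and>
         real t \<le> 336000 * (2 powr growth k + real n ^ 6) \<and>
         (if answer s
          then out_branching (with_proj (output_digraph n s)) (with_proj D) \<and>
               int (card (leaves (with_proj (output_digraph n s)))) \<le> int n - int k
          else \<not> (\<exists>T. out_branching T (with_proj D) \<and>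
                       int (card (leaves T)) \<le> int n - int k))"
    by blast
qed

end
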